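(* Consider $SO(N)$ lattice gauge theory on $\mathbb{Z}^2$ in the strong coupling regime $|\beta|<\beta_0$. Then for every simple loop $\ell$ of area $k$, $$w(\ell,\beta)=\lim_{N\to\infty}\frac{\langle W_\ell\rangle_{\Lambda_N,N,\beta}}{N}=\beta^{k}.$$
   Context: Model. $E$ is the set of directed nearest-neighbour edges of $\mathbb{Z}^2$; $e^{-1}$ is the reversal of $e$; $E^+$ is the set of positively oriented edges (ending point larger than starting point in the lexicographic order). A plaquette $p=e_1e_2e_3e_4$ is a closed walk of length four around a unit square (four distinct edges), identified up to cyclic permutation; it is positively oriented if its smallest and second smallest vertices (lexicographically) occur in that order. For finite $\Lambda\subset\mathbb{Z}^2$, $E_\Lambda^+$ is the set of edges of $E^+$ with both endpoints in $\Lambda$, and $\mathcal{P}_\Lambda^+$ is the set of positively oriented plaquettes with all edges in $\Lambda$. For $N\ge 1$, $\beta\in\mathbb{R}$, the Gibbs measure $\mu_{\Lambda,N,\beta}$ is the probability measure on configurations $Q=(Q_e)_{e\in E_\Lambda^+}\in SO(N)^{E_\Lambda^+}$ whose density with respect to product Haar probability measure is $Z_{\Lambda,N,\beta}^{-1}\exp\big(N\beta\sum_{p\in\mathcal{P}_\Lambda^+}\mathrm{Tr}(Q_p)\big)$, where $Q_{e^{-1}}=Q_e^{-1}$ and $Q_p=Q_{e_1}Q_{e_2}Q_{e_3}Q_{e_4}$. Expectation is denoted $\langle\cdot\rangle_{\Lambda,N,\beta}$. Loops. A loop $\ell=e_1\cdots e_n$ is a non-backtracking closed walk; $W_\ell=\mathrm{Tr}(Q_{e_1}\cdots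 Q_{e_n})$. A loop $e_1\cdots e_n$ is simple if the endpoints of the $e_i$'s are all distinct. The area of a simple loop is the number of unit squares (plaquettes) contained in the bounded component of its complement in the plane. Strong coupling regime. Fix finite sets $\Lambda_1\subset\Lambda_2\subset\cdots$ with union $\mathbb{Z}^2$. By a theorem of Chatterjee there is $\beta_0>0$ such that for $|\beta|<\beta_0$ and every loop $\ell$ the limit $w(\ell,\beta)=\lim_N\langle W_\ell\rangle_{\Lambda_N,N,\beta}/N$ exists (independently of the choice of $(\Lambda_N)$), normalized expectations of products of Wilson loop variables factorize as $N\to\infty$, and $w(\ell,\beta)=\sum_{k\ge0}a_k(\ell)\beta^k$ is an absolutely convergent power series. $\beta_0$ denotes such a constant. *)

theory Defs
  imports
    "HOL-Probability.Probability"
    "HOL-Algebra.Group"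
    "Jordan_Normal_Form.Determinant"
begin

text \<open>Matrices are those of Jordan_Normal_Form, because the matrix size N is a variable that
  tends to infinity. HOL-Analysis has constants of the same base names, hence the
  qualification of the determinant.\<close>

section \<open>The lattice\<close>

type_synonym vertex = "int \<times> int"
type_synonym edge = "vertex \<times> vertex"

text \<open>The order class on pairs is the componentwise one in HOL-Analysis, so the lexicographic
  order is a separate predicate.\<close>

definition lex_less :: "vertex \<Rightarrow> vertex \<Rightarrow> bool" where
  "lex_less u v \<longleftrightarrow> fst u < fst v \<or> (fst u = fst v \<and> snd u < snd v)"

definition edges :: "edge set" where
  "edges = {(u, v). \<bar>fst u - fst v\<bar> + \<bar>snd u - snd v\<bar> = 1}"

definition rev_edge :: "edge \<Rightarrow> edge" where
  "rev_edge e = (snd e, fst e)"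

definition pos_edges :: "edge set" where
  "pos_edges = {e \<in> edges. lex_less (fst e) (snd e)}"

definition pos_edges_in :: "vertex set \<Rightarrow> edge set" where
  "pos_edges_in \<Lambda> = {e \<in> pos_edges. fst e \<in> \<Lambda> \<and> snd e \<in> \<Lambda>}"

text \<open>Walks are lists of directed edges; indices of closed walks are read cyclically.\<close>

definition closed_walk :: "edge list \<Rightarrow> bool" where
  "closed_walk es \<longleftrightarrow> es \<noteq> [] \<and> set es \<subseteq> edges \<and>
     (\<forall>i < length es. snd (es ! i) = fst (es ! (Suc i mod length es)))"

definition is_loop :: "edge list \<Rightarrow> bool" where
  "is_loop es \<longleftrightarrow> closed_walk es \<and>
     (\<forall>i < length es. es ! (Suc i mod length es) \<noteq> rev_edge (es ! i))"

definition simple_loop :: "edge list \<Rightarrow> bool" where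
  "simple_loop es \<longleftrightarrow> is_loop es \<and> distinct (map snd es)"

definition unit_square_vertices :: "vertex \<Rightarrow> vertex set" where
  "unit_square_vertices x =
     {x, (fst x + 1, snd x), (fst x, snd x + 1), (fst x + 1, snd x + 1)}"

definition is_plaquette :: "edge list \<Rightarrow> bool" where
  "is_plaquette p \<longleftrightarrow> closed_walk p \<and> length p = 4 \<and> distinct p \<and>
     (\<exists>x. set (map fst p) = unit_square_vertices x)"

text \<open>A plaquette is only given up to cyclic permutation. A positively oriented one is
  represented by its unique cyclic rotation that starts at the smallest vertex; positive
  orientation says that the second smallest vertex then comes next.\<close>

definition pos_plaquette :: "edge list \<Rightarrow> bool" where
  "pos_plaquette p \<longleftrightarrow> is_plaquette p \<and>
     (\<forall>v \<in> set (map fst p) - {fst (p ! 0)}. lex_less (fst (p ! 0)) v) \<and>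
     (\<forall>v \<in> set (map fst p) - {fst (p ! 0), fst (p ! 1)}. lex_less (fst (p ! 1)) v)"

definition pos_plaquettes_in :: "vertex set \<Rightarrow> edge list set" where
  "pos_plaquettes_in \<Lambda> =
     {p. pos_plaquette p \<and> (\<forall>e \<in> set p. fst e \<in> \<Lambda> \<and> snd e \<in> \<Lambda>)}"

text \<open>The library's inside S is the union of the bounded components of the complement
  of S; for the trace of a simple loop there is exactly one. The unit squares are taken open,
  since the closed ones along the boundary meet the loop.\<close>

definition plane_point :: "vertex \<Rightarrow> complex" where
  "plane_point v = Complex (of_int (fst v)) (of_int (snd v))"

definition loop_trace :: "edge list \<Rightarrow> complex set" where
  "loop_trace es = (\<Union>e \<in> set es. closed_segment (plane_point (fst e)) (plane_point (snd e)))"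

definition open_unit_square :: "vertex \<Rightarrow> complex set" where
  "open_unit_square x = box (plane_point x) (plane_point (fst x + 1, snd x + 1))"

definition loop_area :: "edge list \<Rightarrow> nat" where
  "loop_area es = card {x. open_unit_square x \<subseteq> inside (loop_trace es)}"

section \<open>The special orthogonal group and its Haar measure\<close>

definition mat_trace :: "real mat \<Rightarrow> real" where
  "mat_trace A = (\<Sum>i < dim_row A. A $$ (i, i))"

definition SO :: "nat \<Rightarrow> real mat monoid" where
  "SO N = \<lparr>carrier = {A \<in> carrier_mat N N.
                        transpose_mat A * A = 1\<^sub>m N \<and> Determinant.det A = 1},
           monoid.mult = (\<lambda>A B. A * B), one = 1\<^sub>m N\<rparr>"

text \<open>The Borel sigma-algebra that SO(N) carries as a subset of the N*N-dimensional space of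
  matrix entries.\<close>

definition SO_borel :: "nat \<Rightarrow> real mat measure" where
  "SO_borel N = vimage_algebra (carrier (SO N))
     (\<lambda>A. \<lambda>ij \<in> {..<N} \<times> {..<N}. A $$ ij)
     (PiM ({..<N} \<times> {..<N}) (\<lambda>_. borel))"

text \<open>The Haar probability measure on SO(N): the (unique) left-invariant Borel probability
  measure.\<close>

definition is_haar_SO :: "nat \<Rightarrow> real mat measure \<Rightarrow> bool" where
  "is_haar_SO N \<mu> \<longleftrightarrow> prob_space \<mu> \<and>
     space \<mu> = carrier (SO N) \<and> sets \<mu> = sets (SO_borel N) \<and>
     (\<forall>A \<in> carrier (SO N). distr \<mu> \<mu> (\<lambda>B. A \<otimes>\<^bsub>SO N\<^esub> B) = \<mu>)"

section \<open>Lattice gauge theory\<close>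

definition edge_val :: "nat \<Rightarrow> (edge \<Rightarrow> real mat) \<Rightarrow> edge \<Rightarrow> real mat" where
  "edge_val N Q e = (if e \<in> pos_edges then Q e else inv\<^bsub>SO N\<^esub> (Q (rev_edge e)))"

definition holonomy :: "nat \<Rightarrow> (edge \<Rightarrow> real mat) \<Rightarrow> edge list \<Rightarrow> real mat" where
  "holonomy N Q es = foldr (\<lambda>e A. edge_val N Q e \<otimes>\<^bsub>SO N\<^esub> A) es \<one>\<^bsub>SO N\<^esub>"

definition wilson :: "nat \<Rightarrow> (edge \<Rightarrow> real mat) \<Rightarrow> edge list \<Rightarrow> real" where
  "wilson N Q es = mat_trace (holonomy N Q es)"

definition boltzmann :: "vertex set \<Rightarrow> nat \<Rightarrow> real \<Rightarrow> (edge \<Rightarrow> real mat) \<Rightarrow> real" where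
  "boltzmann \<Lambda> N \<beta> Q =
     exp (real N * \<beta> * (\<Sum>p \<in> pos_plaquettes_in \<Lambda>. mat_trace (holonomy N Q p)))"

text \<open>The family H gives the Haar measure H N on each SO(N).\<close>

definition product_haar ::
    "(nat \<Rightarrow> real mat measure) \<Rightarrow> vertex set \<Rightarrow> nat \<Rightarrow> (edge \<Rightarrow> real mat) measure" where
  "product_haar H \<Lambda> N = PiM (pos_edges_in \<Lambda>) (\<lambda>_. H N)"

definition partition_fun ::
    "(nat \<Rightarrow> real mat measure) \<Rightarrow> vertex set \<Rightarrow> nat \<Rightarrow> real \<Rightarrow> real" where
  "partition_fun H \<Lambda> N \<beta> = (LINT Q | product_haar H \<Lambda> N. boltzmann \<Lambda> N \<beta> Q)"

definition gibbs ::
    "(nat \<Rightarrow> real mat measure) \<Rightarrow> vertex set \<Rightarrow> nat \<Rightarrow> real \<Rightarrow> (edge \<Rightarrow> real mat) measure" where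
  "gibbs H \<Lambda> N \<beta> = density (product_haar H \<Lambda> N)
     (\<lambda>Q. ennreal (boltzmann \<Lambda> N \<beta> Q / partition_fun H \<Lambda> N \<beta>))"

definition wilson_expect ::
    "(nat \<Rightarrow> real mat measure) \<Rightarrow> vertex set \<Rightarrow> nat \<Rightarrow> real \<Rightarrow> edge list \<Rightarrow> real" where
  "wilson_expect H \<Lambda> N \<beta> es = (LINT Q | gibbs H \<Lambda> N \<beta>. wilson N Q es)"

section \<open>The strong coupling regime\<close>

definition exhaustion :: "(nat \<Rightarrow> vertex set) \<Rightarrow> bool" where
  "exhaustion \<Lambda> \<longleftrightarrow> (\<forall>N \<ge> 1. finite (\<Lambda> N) \<and> \<Lambda> N \<subseteq> \<Lambda> (Suc N)) \<and> (\<Union>N \<in> {1..}. \<Lambda> N) = UNIV"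

text \<open>The limit is required to be the same for all exhaustions; the description is proper
  whenever such a common limit exists.\<close>

definition wilson_limit :: "(nat \<Rightarrow> real mat measure) \<Rightarrow> edge list \<Rightarrow> real \<Rightarrow> real" where
  "wilson_limit H es \<beta> = (THE w. \<forall>\<Lambda>. exhaustion \<Lambda> \<longrightarrow>
     (\<lambda>N. wilson_expect H (\<Lambda> N) N \<beta> es / real N) \<longlonglongrightarrow> w)"

text \<open>The properties of the constant provided by Chatterjee's theorem: existence of the limits,
  independently of the exhaustion; factorization; absolutely convergent power series.\<close>

definition strong_coupling_constant :: "(nat \<Rightarrow> real mat measure) \<Rightarrow> real \<Rightarrow> bool" where
  "strong_coupling_constant H \<beta>\<^sub>0 \<longleftrightarrow> \<beta>\<^sub>0 > 0 \<and>
     (\<forall>\<beta> es \<Lambda>. \<bar>\<beta>\<bar> < \<beta>\<^sub>0 \<longrightarrow> is_loop es \<longrightarrow> exhaustion \<Lambda> \<longrightarrow>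
        (\<lambda>N. wilson_expect H (\<Lambda> N) N \<beta> es / real N) \<longlonglongrightarrow> wilson_limit H es \<beta>) \<and>
     (\<forall>\<beta> ls \<Lambda>. \<bar>\<beta>\<bar> < \<beta>\<^sub>0 \<longrightarrow> (\<forall>es \<in> set ls. is_loop es) \<longrightarrow> exhaustion \<Lambda> \<longrightarrow>
        (\<lambda>N. (LINT Q | gibbs H (\<Lambda> N) N \<beta>. prod_list (map (wilson N Q) ls)) / real N ^ length ls)
          \<longlonglongrightarrow> prod_list (map (\<lambda>es. wilson_limit H es \<beta>) ls)) \<and>
     (\<exists>a :: edge list \<Rightarrow> nat \<Rightarrow> real. \<forall>\<beta> es. \<bar>\<beta>\<bar> < \<beta>\<^sub>0 \<longrightarrow> is_loop es \<longrightarrow>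
        summable (\<lambda>k. \<bar>a es k * \<beta> ^ k\<bar>) \<and>
        wilson_limit H es \<beta> = (\<Sum>k. a es k * \<beta> ^ k))"

end

(*
  Integrating out one edge variable at a time shows that in two dimensions the expectation of a
  simple loop of area k is exactly N * c_N^k in every box containing the loop, where c_N is the
  expected normalized trace of a single SO(N) variable A with density proportional to
  exp(N beta Tr A): a plaquette at an extreme corner of the enclosed region has an edge that occurs
  in no other plaquette and only once in the loop, so averaging over that edge replaces the
  plaquette variable by c_N. This either shortens the loop around the corner or splits it into two
  simple loops around disjoint regions.

  The same reduction applies to powers of a plaquette, whose limits w_n exist and factorize by
  hypothesis. Invariance of Haar measure under infinitesimal rotations gives
  sum_{m<n} w_m w_{n-m} = beta (w_{n-1} - w_{n+1}), which for small beta has only the solution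
  w_1 = beta, w_n = 0 for n > 1. Since w_1 is a power series in beta, w_1 = beta for all
  |beta| < beta_0, that is, c_N tends to beta.
*)

theory Submission
  imports Defs
begin

section \<open>Closed lattice paths and their winding numbers\<close>

text \<open>Two obstacles shape the proof. First, the induction must stay in a class of regions
  stable under removing a corner. Topology is therefore replaced by winding numbers of faces: a
  region is the set of faces with winding number 1, removing a corner changes that function at one
  face only, and the topological interior is met just once, to identify the area. Second, where a
  corner removal pinches the loop, the trace of a product of two closed holonomies must become a
  product of traces. The regions of the two pieces share no edge, and a gauge transformation at the
  common vertex, acting on one region only, shows that the averaged holonomy of that piece is a
  scalar matrix. The other piece has to ride along as a factor free of the region being integrated,
  so the inductive statement carries an arbitrary such factor. Scalar matrices come from commuting
  with all of SO(N), which is used for N at least 3; only the limit matters. In the loop equations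
  the term made of transposed powers is of order N against N^2 for the others, which is why the
  limit does not show it.\<close>

fun edge_path :: "vertex \<Rightarrow> edge list \<Rightarrow> vertex \<Rightarrow> bool" where
  "edge_path x [] y \<longleftrightarrow> x = y"
| "edge_path x (e # es) y \<longleftrightarrow> fst e = x \<and> e \<in> edges \<and> edge_path (snd e) es y"

lemma edge_path_append:
  "edge_path x (as @ bs) y \<longleftrightarrow> (\<exists>z. edge_path x as z \<and> edge_path z bs y)"
  by (induction as arbitrary: x) auto

lemma edge_path_edges: "edge_path x es y \<Longrightarrow> set es \<subseteq> edges"
  by (induction es arbitrary: x) (simp, metis edge_path.simps(2) insert_subset list.set(2))

text \<open>Paths of length two, going back and forth along an edge, are allowed: they arise as
  degenerate pieces when a loop is split at a corner.\<close>

definition circuit :: "edge list \<Rightarrow> bool" where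
  "circuit es \<longleftrightarrow> es \<noteq> [] \<and> edge_path (fst (hd es)) es (fst (hd es)) \<and> distinct (map fst es)"

lemma circuit_ConsI: "edge_path (fst e) (e # es) (fst e) \<Longrightarrow> distinct (map fst (e # es)) \<Longrightarrow> circuit (e # es)"
  by (simp add: circuit_def)

lemma circuit_edges: "circuit es \<Longrightarrow> set es \<subseteq> edges"
  by (auto simp: circuit_def dest: edge_path_edges)

lemma circuit_rotate:
  assumes "circuit (as @ bs)"
  shows "circuit (bs @ as)"
proof (cases "as = [] \<or> bs = []")
  case False
  then obtain a as' b bs' where ab: "as = a # as'" "bs = b # bs'"
    by (metis neq_Nil_conv)
  then obtain z where z: "edge_path (fst a) as z" "edge_path z bs (fst a)"
    using assms unfolding circuit_def edge_path_append by (metis ab(1) append_Cons list.sel(1))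
  have d: "distinct (map fst (bs @ as))" using assms unfolding circuit_def by auto
  have "z = fst b" using z(2) ab by simp
  then have "edge_path (fst b) (bs @ as) (fst b)" using z unfolding edge_path_append by blast
  then show ?thesis using d ab by (simp add: circuit_def)
qed (use assms in auto)

lemma edge_path_ends:
  "edge_path x es y \<Longrightarrow> x # map snd es = map fst es @ [y]"
  by (induction es arbitrary: x) auto

lemma circuit_distinct_snd:
  assumes "circuit es" shows "distinct (map snd es)" and "set (map snd es) = set (map fst es)"
proof -
  have "mset (map snd es) = mset (map fst es)"
    using assms arg_cong[OF edge_path_ends, of "fst (hd es)" es "fst (hd es)" mset]
    by (auto simp: circuit_def)
  then show "distinct (map snd es)" "set (map snd es) = set (map fst es)"
    using assms mset_eq_imp_distinct_iff mset_eq_setD unfolding circuit_def by blast+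
qed

lemma circuit_out_unique: "circuit es \<Longrightarrow> e \<in> set es \<Longrightarrow> e' \<in> set es \<Longrightarrow> fst e = fst e' \<Longrightarrow> e = e'"
  by (metis circuit_def distinct_map inj_onD)

lemma circuit_in_unique: "circuit es \<Longrightarrow> e \<in> set es \<Longrightarrow> e' \<in> set es \<Longrightarrow> snd e = snd e' \<Longrightarrow> e = e'"
  by (metis circuit_distinct_snd(1) distinct_map inj_onD)

lemma circuit_rotate_to:
  assumes "circuit es" "e \<in> set es"
  obtains as bs where "es = as @ e # bs" "circuit (e # bs @ as)"
  using assms by (metis append_Cons circuit_rotate split_list)

text \<open>Induction along a circuit: rotated so as to start at \<open>e0\<close>, it is a path
  through all other edges, and each step passes from an edge to its successor.\<close>

lemma circuit_propagate:
  assumes "circuit es" "e0 \<in> set es" "P e0"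
    and step: "\<And>e e'. e \<in> set es \<Longrightarrow> e' \<in> set es \<Longrightarrow> snd e = fst e' \<Longrightarrow> P e \<Longrightarrow> P e'"
    and "e \<in> set es"
  shows "P e"
proof -
  obtain as bs where *: "es = as @ e0 # bs" "circuit (e0 # bs @ as)"
    using circuit_rotate_to assms by metis
  have "P a \<Longrightarrow> a \<in> set es \<Longrightarrow> edge_path (snd a) l y \<Longrightarrow> set l \<subseteq> set es \<Longrightarrow> \<forall>e \<in> set l. P e" for a l y
  proof (induction l arbitrary: a)
    case (Cons b l)
    then have "P b" using step[of a b] by simp
    then show ?case using Cons.IH[of b] Cons.prems by simp
  qed simp
  moreover have "edge_path (snd e0) (bs @ as) (fst e0)" using *(2) by (simp add: circuit_def)
  moreover have "set (bs @ as) \<subseteq> set es" using *(1) by auto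
  ultimately have "\<forall>e \<in> set (bs @ as). P e" using \<open>P e0\<close> \<open>e0 \<in> set es\<close> by blast
  then show ?thesis using \<open>P e0\<close> \<open>e \<in> set es\<close> *(1) by auto
qed

lemma rev_edge_simps [simp]:
  "rev_edge (a, b) = (b, a)" "fst (rev_edge e) = snd e" "snd (rev_edge e) = fst e"
  "rev_edge (rev_edge e) = e"
  by (auto simp: rev_edge_def)

lemma rev_edge_in_edges [simp]: "rev_edge e \<in> edges \<longleftrightarrow> e \<in> edges"
  by (cases e) (auto simp: edges_def abs_minus_commute)

lemma edges_irrefl: "(x, x) \<notin> edges"
  by (auto simp: edges_def)

text \<open>Exactly one edge leaves the end of \<open>e\<close>, so \<open>rev_edge e\<close> comes
  directly after \<open>e\<close>; it returns to the start of \<open>e\<close>, which a circuit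
  visits once, so nothing can follow.\<close>

lemma circuit_backtrack:
  assumes "circuit es" "e \<in> set es" "rev_edge e \<in> set es"
  shows "length es = 2"
proof -
  obtain as bs where *: "es = as @ e # bs" "circuit (e # bs @ as)"
    using circuit_rotate_to assms by metis
  let ?l = "bs @ as"
  have p: "edge_path (snd e) ?l (fst e)" and d: "distinct (map fst (e # ?l))" and ee: "e \<in> edges"
    using *(2) by (auto simp: circuit_def)
  have "e \<noteq> rev_edge e" using ee edges_irrefl by (cases e) auto
  then have r: "rev_edge e \<in> set ?l" using assms(3) *(1) by auto
  then obtain c l' where l: "?l = c # l'" by (cases ?l) auto
  have "c = rev_edge e"
    using circuit_out_unique[OF *(2), of c "rev_edge e"] r p l by auto
  then have p': "edge_path (fst e) l' (fst e)" using p l by simp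
  have "l' = []"
  proof (cases l')
    case (Cons a m)
    then show ?thesis using p' d l by auto
  qed auto
  then show ?thesis using l *(1) by (metis append_Cons length_Cons length_append length_rev list.size(3) add.commute
        numeral_2_eq_2 add_Suc_right)
qed

section \<open>Winding numbers of faces and their jump across an edge\<close>

definition flow :: "edge list \<Rightarrow> edge \<Rightarrow> int" where
  "flow es e = (\<Sum>c\<leftarrow>es. if c = e then 1 else if c = rev_edge e then -1 else 0)"

text \<open>A face is named by its lower left corner. The winding number of a closed path around a face
  is the signed number of crossings with the upward vertical ray from that face.\<close>

definition crossing :: "vertex \<Rightarrow> edge \<Rightarrow> int" where
  "crossing f e = (if snd f < snd (fst e) \<and> snd (fst e) = snd (snd e) then
     (if fst (fst e) = fst f + 1 \<and> fst (snd e) = fst f then 1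
      else if fst (fst e) = fst f \<and> fst (snd e) = fst f + 1 then -1 else 0) else 0)"

definition wind :: "edge list \<Rightarrow> vertex \<Rightarrow> int" where
  "wind es f = (\<Sum>e\<leftarrow>es. crossing f e)"

lemma wind_simps [simp]:
  "wind [] f = 0" "wind (e # es) f = crossing f e + wind es f"
  "wind (as @ bs) f = wind as f + wind bs f"
  by (auto simp: wind_def)

lemma flow_simps [simp]:
  "flow [] e = 0" "flow (as @ bs) e = flow as e + flow bs e"
  by (auto simp: flow_def)

lemma flow_notin: "e \<notin> set es \<Longrightarrow> rev_edge e \<notin> set es \<Longrightarrow> flow es e = 0"
  unfolding flow_def by (induction es) auto

lemma rev_edge_neq: "e \<in> edges \<Longrightarrow> rev_edge e \<noteq> e"
  by (metis edges_irrefl prod.collapse rev_edge_simps(2))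

lemma flow_rev:
  assumes "e \<in> edges" shows "flow es (rev_edge e) = - flow es e"
proof (induction es)
  case (Cons c es)
  then show ?case using rev_edge_neq[OF assms] by (simp add: flow_def)
qed simp

lemma flow_pos_imp_mem: 
  assumes "flow es e > 0" shows "e \<in> set es"
proof (rule ccontr)
  assume "e \<notin> set es"
  then have "flow es e \<le> 0" unfolding flow_def by (induction es) auto
  with assms show False by simp
qed

lemma edge_cases:
  assumes "e \<in> edges"
  obtains (Right) x y where "e = ((x, y), (x + 1, y))" | (Left) x y where "e = ((x, y), (x - 1, y))"
    | (Up) x y where "e = ((x, y), (x, y + 1))" | (Down) x y where "e = ((x, y), (x, y - 1))"
proof -
  obtain x y x' y' where e: "e = ((x, y), (x', y'))" by (metis prod.exhaust)
  have "\<bar>x - x'\<bar> + \<bar>y - y'\<bar> = 1" using assms e by (simp add: edges_def)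
  then have "(x' = x + 1 \<and> y' = y) \<or> (x' = x - 1 \<and> y' = y) \<or> (x' = x \<and> y' = y + 1) \<or> (x' = x \<and> y' = y - 1)"
    by (auto simp: abs_if split: if_splits)
  then show ?thesis using that e by auto
qed

text \<open>The upward rays of the two faces differ by a single horizontal edge, and
  \<open>flow\<close> counts the passages through it.\<close>

lemma wind_vertical:
  assumes "set es \<subseteq> edges"
  shows "wind es (a, b) - wind es (a, b + 1) = flow es ((a + 1, b + 1), (a, b + 1))"
  using assms
proof (induction es)
  case (Cons e es)
  then have "e \<in> edges" by auto
  then have "crossing (a, b) e - crossing (a, b + 1) e = flow [e] ((a + 1, b + 1), (a, b + 1))"
    by (cases rule: edge_cases) (auto simp: crossing_def flow_def)
  moreover have "flow (e # es) c = flow [e] c + flow es c" for c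
    by (simp add: flow_def)
  ultimately show ?case using Cons by simp
qed auto

text \<open>A balance of entries and exits for the half-line of vertices (a, y) with y > b: the two
  rays count horizontal passages into and out of it, the flow counts those through its lower end,
  and the right-hand side records whether the path ends or starts on it. For a closed path the last
  two terms cancel.\<close>

lemma wind_horizontal_path:
  assumes "edge_path x es y"
  shows "wind es (a, b) - wind es (a - 1, b) - flow es ((a, b + 1), (a, b)) =
     of_bool (fst y = a \<and> b < snd y) - of_bool (fst x = a \<and> b < snd x)"
  using assms
proof (induction es arbitrary: x)
  case (Cons e es)
  then have e: "e \<in> edges" "fst e = x" and p: "edge_path (snd e) es y" by auto
  have "crossing (a, b) e - crossing (a - 1, b) e - flow [e] ((a, b + 1), (a, b)) =
      of_bool (fst (snd e) = a \<and> b < snd (snd e)) - of_bool (fst (fst e) = a \<and> b < snd (fst e))"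
    using e(1) by (cases rule: edge_cases) (auto simp: crossing_def flow_def)
  moreover have "flow (e # es) c = flow [e] c + flow es c" for c
    by (simp add: flow_def)
  ultimately show ?case using Cons.IH[OF p] e by simp
qed auto

lemma wind_horizontal:
  assumes "edge_path x es x"
  shows "wind es (a, b) - wind es (a - 1, b) = flow es ((a, b + 1), (a, b))"
  using wind_horizontal_path[OF assms, of a b] by simp

definition left_face :: "edge \<Rightarrow> vertex" where
  "left_face e = (let (x, y) = fst e; (x', y') = snd e in
     if x' < x then (x - 1, y - 1) else if x < x' then (x, y)
     else if y < y' then (x - 1, y) else (x, y - 1))"

abbreviation right_face :: "edge \<Rightarrow> vertex" where
  "right_face e \<equiv> left_face (rev_edge e)"

lemma wind_left_right:
  assumes "edge_path x es x" "e \<in> edges"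
  shows "wind es (left_face e) - wind es (right_face e) = flow es e"
proof -
  note E = edge_path_edges[OF assms(1)]
  show ?thesis using assms(2)
  proof (cases rule: edge_cases)
    case (Right x y)
    then show ?thesis
      using wind_vertical[OF E, of x "y - 1"] flow_rev[OF assms(2), of es] by (simp add: left_face_def)
  next
    case (Left x y)
    then show ?thesis
      using wind_vertical[OF E, of "x - 1" "y - 1"] by (simp add: left_face_def)
  next
    case (Up x' y)
    then show ?thesis
      using wind_horizontal[OF assms(1), of x' y] flow_rev[OF assms(2), of es] by (simp add: left_face_def)
  next
    case (Down x' y)
    then show ?thesis
      using wind_horizontal[OF assms(1), of x' "y - 1"] by (simp add: left_face_def)
  qed
qed

lemma circuit_wind_left_right:
  "circuit es \<Longrightarrow> e \<in> edges \<Longrightarrow> wind es (left_face e) - wind es (right_face e) = flow es e"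
  using wind_left_right unfolding circuit_def by blast

text \<open>Above the bounding box and to its sides the ray meets no edge of the path. Below the box
  the value is carried from the far left column by column, since no vertical edge of the path lies
  that low.\<close>

lemma wind_eq_0:
  assumes "edge_path x es x" and B: "\<And>e. e \<in> set es \<Longrightarrow> \<bar>fst (fst e)\<bar> \<le> B \<and> \<bar>snd (fst e)\<bar> \<le> B"
    and out: "\<bar>a\<bar> > B \<or> \<bar>b\<bar> > B"
  shows "wind es (a, b) = 0"
proof -
  have E: "set es \<subseteq> edges" using assms(1) by (rule edge_path_edges)
  have B': "\<bar>fst (snd e)\<bar> \<le> B \<and> \<bar>snd (snd e)\<bar> \<le> B" if "e \<in> set es" for e
  proof -
    have "x \<in> set (map fst es)" using assms(1) that by (cases es) auto
    moreover have "snd e \<in> set (map fst es @ [x])"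
      unfolding edge_path_ends[OF assms(1), symmetric] using that by simp
    ultimately have "snd e \<in> set (map fst es)" by auto
    then show ?thesis using B by auto
  qed
  have no: "wind es (a', b) = 0" if "\<bar>a'\<bar> > B \<or> b > B" for a'
  proof -
    have "crossing (a', b) e = 0" if "e \<in> set es" for e
      using B[OF that] B'[OF that] \<open>\<bar>a'\<bar> > B \<or> b > B\<close> by (auto simp: crossing_def)
    then have "map (crossing (a', b)) es = map (\<lambda>_. 0) es" by (intro map_cong) auto
    then show ?thesis unfolding wind_def by (simp only: sum_list_0)
  qed
  show ?thesis
  proof (cases "\<bar>a\<bar> > B \<or> b > B")
    case True
    then show ?thesis by (rule no)
  next
    case False
    then have b: "b < - B" using out by auto
    \<comment> \<open>The sign of \<open>B\<close> is not known, hence the absolute value in the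
      starting column.\<close>
    have "wind es (- \<bar>B\<bar> - 1 + int n, b) = 0" for n
    proof (induction n)
      case 0
      show ?case by (rule no) auto
    next
      case (Suc n)
      let ?a = "- \<bar>B\<bar> - 1 + int (Suc n)"
      have "flow es ((?a, b + 1), (?a, b)) = 0"
        using B B' b by (intro flow_notin) fastforce+
      then have "wind es (?a, b) = wind es (?a - 1, b)"
        using wind_horizontal[OF assms(1), of ?a b] by linarith
      also have "?a - 1 = - \<bar>B\<bar> - 1 + int n" by simp
      also have "wind es (\<dots>, b) = 0" by (rule Suc)
      finally show ?case .
    qed
    from this[of "nat (a + \<bar>B\<bar> + 1)"] show ?thesis using False by (simp split: if_splits)
  qed
qed

lemma edge_list_bound:
  fixes es :: "edge list"
  obtains B where "B > 0" "\<And>e. e \<in> set es \<Longrightarrow> \<bar>fst (fst e)\<bar> \<le> B \<and> \<bar>snd (fst e)\<bar> \<le> B"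
proof -
  have f: "finite (insert 1 ((\<lambda>e. \<bar>fst (fst e)\<bar>) ` set es \<union> (\<lambda>e. \<bar>snd (fst e)\<bar>) ` set es))" (is "finite ?S") by auto
  show ?thesis
  proof (rule that[of "Max ?S"])
    show "Max ?S > 0" using Max_ge[OF f insertI1] by linarith
    show "\<bar>fst (fst e)\<bar> \<le> Max ?S \<and> \<bar>snd (fst e)\<bar> \<le> Max ?S" if "e \<in> set es" for e
      using that f by (auto intro!: Max_ge)
  qed
qed

lemma finite_wind_support:
  assumes "edge_path x es x"
  shows "finite {f. wind es f \<noteq> 0}"
proof -
  obtain B where B: "\<And>e. e \<in> set es \<Longrightarrow> \<bar>fst (fst e)\<bar> \<le> B \<and> \<bar>snd (fst e)\<bar> \<le> B"
    using edge_list_bound by metis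
  have "{f. wind es f \<noteq> 0} \<subseteq> {-B..B} \<times> {-B..B}"
  proof
    fix f assume "f \<in> {f. wind es f \<noteq> 0}"
    moreover obtain a b where f: "f = (a, b)" by force
    ultimately have "\<not> (\<bar>a\<bar> > B \<or> \<bar>b\<bar> > B)" using wind_eq_0[OF assms B] by blast
    then show "f \<in> {-B..B} \<times> {-B..B}" using f by auto
  qed
  then show ?thesis by (rule finite_subset) auto
qed

section \<open>A discrete Jordan curve theorem\<close>

lemma circuit_flow:
  assumes "circuit es" "length es \<noteq> 2" "e \<in> set es"
  shows "flow es e = 1"
proof -
  obtain as bs where *: "es = as @ e # bs" by (meson assms(3) split_list)
  have d: "distinct es" using assms(1) by (auto simp: circuit_def distinct_map)
  have "rev_edge e \<notin> set es" using assms circuit_backtrack by blast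
  then have "flow as e = 0" "flow bs e = 0" using * d by (auto intro!: flow_notin)
  then show ?thesis using * by (simp add: flow_def)
qed

lemma circuit_vertex_flow:
  assumes "circuit es" "e \<in> set es" "e' \<in> set es" "snd e = fst e'" "w \<noteq> fst e" "w \<noteq> snd e'"
  shows "(snd e, w) \<notin> set es" "(w, snd e) \<notin> set es"
  using assms circuit_out_unique[OF assms(1), of "(snd e, w)" e'] circuit_in_unique[OF assms(1), of "(w, snd e)" e]
  by (metis fst_conv snd_conv)+

text \<open>Turning about the vertex between \<open>e\<close> and \<open>e'\<close>, one gets from
  the left face of \<open>e\<close> to that of \<open>e'\<close> across other edges at that vertex
  only, and likewise on the right. A \<open>g\<close> that does not jump across those edges takes
  equal values at both ends. It will be a winding number or the membership in a set of
  faces.\<close>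

lemma turn_left_faces:
  fixes g :: "vertex \<Rightarrow> 'b"
  assumes "e \<in> edges" "e' \<in> edges" "snd e = fst e'" "snd e' \<noteq> fst e"
    and eq: "\<And>w. (snd e, w) \<in> edges \<Longrightarrow> w \<noteq> fst e \<Longrightarrow> w \<noteq> snd e' \<Longrightarrow>
      g (left_face (snd e, w)) = g (right_face (snd e, w))"
  shows "g (left_face e) = g (left_face e')" "g (right_face e) = g (right_face e')"
proof -
  obtain x y p q where v: "e = (p, (x, y))" "e' = ((x, y), q)"
    using assms(3) by (metis prod.exhaust fst_conv snd_conv)
  have 1: "p = (x + 1, y) \<or> q = (x + 1, y) \<or> g (x, y) = g (x, y - 1)"
    using eq[of "(x + 1, y)"] v by (simp add: left_face_def edges_def) metis
  have 2: "p = (x, y + 1) \<or> q = (x, y + 1) \<or> g (x - 1, y) = g (x, y)"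
    using eq[of "(x, y + 1)"] v by (simp add: left_face_def edges_def) metis
  have 3: "p = (x - 1, y) \<or> q = (x - 1, y) \<or> g (x - 1, y - 1) = g (x - 1, y)"
    using eq[of "(x - 1, y)"] v by (simp add: left_face_def edges_def) metis
  have 4: "p = (x, y - 1) \<or> q = (x, y - 1) \<or> g (x, y - 1) = g (x - 1, y - 1)"
    using eq[of "(x, y - 1)"] v by (simp add: left_face_def edges_def) metis
  have 5: "p = (x + 1, y) \<or> p = (x - 1, y) \<or> p = (x, y + 1) \<or> p = (x, y - 1)"
    using assms(1) v by (cases rule: edge_cases) auto
  have 6: "q = (x + 1, y) \<or> q = (x - 1, y) \<or> q = (x, y + 1) \<or> q = (x, y - 1)"
    using assms(2) v by (cases rule: edge_cases) auto
  have n: "q \<noteq> p" using assms(4) v by simp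
  have "g (left_face (p, (x, y))) = g (left_face ((x, y), q)) \<and>
      g (right_face (p, (x, y))) = g (right_face ((x, y), q))"
    using 5 6 by (elim disjE; insert 1 2 3 4 n; simp add: left_face_def)
  then show "g (left_face e) = g (left_face e')" "g (right_face e) = g (right_face e')"
    using v by simp_all
qed

lemma circuit_left_faces:
  fixes g :: "vertex \<Rightarrow> 'b"
  assumes "circuit es" "length es \<noteq> 2"
    and eq: "\<And>e. e \<in> edges \<Longrightarrow> e \<notin> set es \<Longrightarrow> rev_edge e \<notin> set es \<Longrightarrow> g (left_face e) = g (right_face e)"
    and "e \<in> set es" "e' \<in> set es"
  shows "g (left_face e) = g (left_face e') \<and> g (right_face e) = g (right_face e')"
proof (rule circuit_propagate[OF assms(1) \<open>e \<in> set es\<close> _ _ \<open>e' \<in> set es\<close>,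
    of "\<lambda>c. g (left_face e) = g (left_face c) \<and> g (right_face e) = g (right_face c)"])
  fix c c' assume c: "c \<in> set es" "c' \<in> set es" "snd c = fst c'"
    and "g (left_face e) = g (left_face c) \<and> g (right_face e) = g (right_face c)"
  have E: "c \<in> edges" "c' \<in> edges" using circuit_edges[OF assms(1)] c by auto
  have n: "snd c' \<noteq> fst c" using circuit_backtrack[OF assms(1) c(1)] c assms(2)
    by (metis prod.collapse rev_edge_def)
  have "g (left_face c) = g (left_face c')" "g (right_face c) = g (right_face c')"
    using turn_left_faces[OF E c(3) n, of g] eq circuit_vertex_flow[OF assms(1) c] by (metis rev_edge_simps(1))+
  with \<open>g (left_face e) = g (left_face c) \<and> _\<close>
  show "g (left_face e) = g (left_face c') \<and> g (right_face e) = g (right_face c')" by simp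
qed auto

lemma right_edge_faces:
  "((x, y), (x, y + 1)) \<in> edges" "left_face ((x, y), (x, y + 1)) = (x - 1, y)"
  "right_face ((x, y), (x, y + 1)) = (x, y)"
  "((x, y), (x - 1, y)) \<in> edges" "left_face ((x, y), (x - 1, y)) = (x - 1, y - 1)"
  "right_face ((x, y), (x - 1, y)) = (x - 1, y)"
  by (auto simp: left_face_def edges_def)

text \<open>The winding numbers of the faces to the left and to the right of the loop do not change
  along the loop, and two adjacent faces can only differ across the loop.\<close>

theorem discrete_Jordan:
  assumes "circuit es" "length es \<noteq> 2"
  obtains L where "L \<in> {0, 1}" "\<And>e. e \<in> set es \<Longrightarrow> wind es (left_face e) = L \<and> wind es (right_face e) = L - 1"
    "\<And>f. wind es f \<in> {L, L - 1}"
proof -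
  obtain e0 where e0: "e0 \<in> set es" using assms(1) by (metis circuit_def list.set_intros(1) neq_Nil_conv)
  define L where "L = wind es (left_face e0)"
  have p: "edge_path (fst (hd es)) es (fst (hd es))" using assms(1) by (simp add: circuit_def)
  have E: "set es \<subseteq> edges" by (rule circuit_edges[OF assms(1)])
  have LR: "wind es (left_face e) = L \<and> wind es (right_face e) = L - 1" if "e \<in> set es" for e
  proof -
    have "wind es (left_face c) = wind es (right_face c)" if "c \<in> edges" "c \<notin> set es" "rev_edge c \<notin> set es" for c
      using wind_left_right[OF p that(1)] flow_notin[OF that(2,3)] by simp
    from circuit_left_faces[OF assms this e0 \<open>e \<in> set es\<close>]
    have "wind es (left_face e) = L" by (simp add: L_def)
    then show ?thesis using wind_left_right[OF p, of e] E circuit_flow[OF assms] that by auto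
  qed
  have adj: "wind es (left_face c) = wind es (right_face c) \<or> 
      {wind es (left_face c), wind es (right_face c)} = {L, L - 1}" if "c \<in> edges" for c
  proof (cases "c \<in> set es \<or> rev_edge c \<in> set es")
    case False
    then show ?thesis using wind_left_right[OF p that] flow_notin by fastforce
  next
    case True
    then show ?thesis using LR[of c] LR[of "rev_edge c"] by auto
  qed
  obtain B where B: "B > 0" "\<And>e. e \<in> set es \<Longrightarrow> \<bar>fst (fst e)\<bar> \<le> B \<and> \<bar>snd (fst e)\<bar> \<le> B"
    using edge_list_bound by metis
  note out = wind_eq_0[OF p B(2)]
  \<comment> \<open>Far to the left the value is 0, and each step to the right either keeps it or
    exchanges \<open>L\<close> and \<open>L - 1\<close>. So it can leave 0 only if 0 is one of these
    two numbers, and then it stays among them.\<close>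
  have row: "wind es (a, b) = 0 \<or> (0 \<in> {L, L - 1} \<and> wind es (a, b) \<in> {L, L - 1})" for a b
  proof -
    have "wind es (- B - 1 + int n, b) = 0 \<or> (0 \<in> {L, L - 1} \<and> wind es (- B - 1 + int n, b) \<in> {L, L - 1})" for n
    proof (induction n)
      case 0
      then show ?case using out[of "- B - 1" b] B(1) by simp
    next
      case (Suc n)
      let ?a = "- B - 1 + int (Suc n)"
      have a: "?a - 1 = - B - 1 + int n" by simp
      have "wind es (?a - 1, b) = wind es (?a, b) \<or> {wind es (?a - 1, b), wind es (?a, b)} = {L, L - 1}"
        using adj[of "((?a, b), (?a, b + 1))"] right_edge_faces(1-3)[of ?a b] by metis
      with Suc show ?case unfolding a by (metis doubleton_eq_iff insertCI)
    qed
    from this[of "nat (a + B + 1)"] out[of a b] B(1) show ?thesis by (cases "a < - B") (auto simp: abs_if)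
  qed
  have "wind es (left_face e0) = L \<and> wind es (right_face e0) = L - 1" using LR[OF e0] .
  then have z: "0 \<in> {L, L - 1}"
    using row[of "fst (left_face e0)" "snd (left_face e0)"] row[of "fst (right_face e0)" "snd (right_face e0)"] by auto
  show ?thesis
  proof (rule that[OF _ LR])
    show "L \<in> {0, 1}" using z by auto
    show "wind es f \<in> {L, L - 1}" for f using row[of "fst f" "snd f"] z by auto
  qed
qed

text \<open>The witness is the upper edge of a topmost face of \<open>T\<close>, directed so that
  this face is on its left.\<close>

lemma finite_faces_boundary:
  assumes "finite T" "T \<noteq> {}"
  obtains e where "e \<in> edges" "left_face e \<in> T" "right_face e \<notin> T"
proof -
  obtain f where f: "f \<in> T" "\<And>f'. f' \<in> T \<Longrightarrow> snd f' \<le> snd f"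
  proof -
    have "Max (snd ` T) \<in> snd ` T" using assms by (intro Max_in) auto
    then obtain f where "f \<in> T" "snd f = Max (snd ` T)" by auto
    then show ?thesis using that assms(1) by (metis Max_ge finite_imageI imageI)
  qed
  obtain a b where ab: "f = (a, b)" by force
  have "(a, b + 1) \<notin> T" using f(2)[of "(a, b + 1)"] ab by auto
  then show ?thesis
    using that[of "((a + 1, b + 1), (a, b + 1))"] right_edge_faces(4-6)[of "a + 1" "b + 1"] f(1) ab by simp
qed

text \<open>As the boundary of \<open>T\<close> runs within the circuit, membership in
  \<open>T\<close> does not change along either side of the circuit. A finite \<open>T\<close> has
  some boundary edge, so it lies on exactly one side all along: no proper part of a circuit encloses
  faces. This is the connectedness half of the Jordan theorem.\<close>

lemma enclosed_faces:
  assumes "circuit es" "length es \<noteq> 2" "finite T" "T \<noteq> {}"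
    and bd: "\<And>e. e \<in> edges \<Longrightarrow> left_face e \<in> T \<Longrightarrow> right_face e \<notin> T \<Longrightarrow> e \<in> set es \<or> rev_edge e \<in> set es"
    and "e \<in> set es"
  shows "(left_face e \<in> T) \<noteq> (right_face e \<in> T)"
proof -
  obtain c where c: "c \<in> edges" "left_face c \<in> T" "right_face c \<notin> T"
    using finite_faces_boundary assms by metis
  then have "c \<in> set es \<or> rev_edge c \<in> set es" by (rule bd)
  then obtain e0 where e0: "e0 \<in> set es" "(left_face e0 \<in> T) \<noteq> (right_face e0 \<in> T)"
    using c by (metis rev_edge_simps(4))
  have "(left_face c \<in> T) = (right_face c \<in> T)" if "c \<in> edges" "c \<notin> set es" "rev_edge c \<notin> set es" for c
    using bd[of c] bd[of "rev_edge c"] that by auto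
  from circuit_left_faces[OF assms(1,2) this e0(1) \<open>e \<in> set es\<close>] e0(2) show ?thesis by simp
qed

section \<open>The area enclosed by a simple loop\<close>

lemma edge_path_closed_walk:
  assumes "es \<noteq> []" "set es \<subseteq> edges" "\<And>i. Suc i < length es \<Longrightarrow> snd (es ! i) = fst (es ! Suc i)"
  shows "edge_path (fst (hd es)) es (snd (last es))"
  using assms
proof (induction es)
  case (Cons e es)
  show ?case
  proof (cases "es = []")
    case False
    have "snd (es ! i) = fst (es ! Suc i)" if "Suc i < length es" for i
      using Cons.prems(3)[of "Suc i"] that by simp
    moreover have "snd e = fst (hd es)"
      using Cons.prems(3)[of 0] False by (simp add: hd_conv_nth)
    ultimately show ?thesis using Cons False by simp
  qed (use Cons in simp)
qed simp

lemma simple_loop_circuit: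
  assumes "simple_loop es"
  shows "circuit es" "length es \<noteq> 2"
proof -
  have cw: "closed_walk es" and nb: "\<And>i. i < length es \<Longrightarrow> es ! (Suc i mod length es) \<noteq> rev_edge (es ! i)"
    and d: "distinct (map snd es)"
    using assms by (auto simp: simple_loop_def is_loop_def)
  have ne: "es \<noteq> []" and cons: "\<And>i. i < length es \<Longrightarrow> snd (es ! i) = fst (es ! (Suc i mod length es))"
    using cw by (auto simp: closed_walk_def)
  have last: "snd (last es) = fst (hd es)"
    using cons[of "length es - 1"] ne by (simp add: last_conv_nth hd_conv_nth)
  have p: "edge_path (fst (hd es)) es (fst (hd es))"
    using edge_path_closed_walk[OF ne] cw cons last unfolding closed_walk_def
    by (metis Suc_lessD mod_less)
  \<comment> \<open>Simplicity speaks of endpoints and \<open>circuit\<close> of starting points;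
    along a closed path they form the same multiset.\<close>
  have "mset (map snd es) = mset (map fst es)"
    using arg_cong[OF edge_path_ends[OF p], of mset] by simp
  then have "distinct (map fst es)" using d mset_eq_imp_distinct_iff by blast
  then show "circuit es" using p ne by (simp add: circuit_def)
  show "length es \<noteq> 2"
  proof
    assume l: "length es = 2"
    then have "es ! 1 = rev_edge (es ! 0)"
      using cons[of 0] cons[of 1] by (simp add: rev_edge_def prod_eq_iff)
    then show False using nb[of 0] l by simp
  qed
qed

section \<open>Comparison with the topological interior of the loop\<close>

lemma closed_segment_edge:
  assumes "e \<in> edges"
  shows "z \<in> closed_segment (plane_point (fst e)) (plane_point (snd e)) \<longleftrightarrow>
    (snd (fst e) = snd (snd e) \<and> Im z = of_int (snd (fst e)) \<and>
       of_int (min (fst (fst e)) (fst (snd e))) \<le> Re z \<and> Re z \<le> of_int (max (fst (fst e)) (fst (snd e)))) \<or>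
    (fst (fst e) = fst (snd e) \<and> Re z = of_int (fst (fst e)) \<and>
       of_int (min (snd (fst e)) (snd (snd e))) \<le> Im z \<and> Im z \<le> of_int (max (snd (fst e)) (snd (snd e))))"
  using assms
  by (cases rule: edge_cases)
     (simp_all add: plane_point_def closed_segment_same_Im closed_segment_same_Re closed_segment_eq_real_ivl
        min_def max_def)

lemma loop_trace_avoid:
  assumes "z \<notin> loop_trace es" "z \<in> closed_segment (plane_point (fst e)) (plane_point (snd e))"
  shows "e \<notin> set es" "rev_edge e \<notin> set es"
  using assms closed_segment_commute by (fastforce simp: loop_trace_def)+

lemma floor_nearby:
  fixes x :: real
  obtains \<epsilon> where "\<epsilon> > 0" "\<And>x'. \<bar>x' - x\<bar> < \<epsilon> \<Longrightarrow> \<lfloor>x'\<rfloor> = \<lfloor>x\<rfloor> \<or> (x = of_int \<lfloor>x\<rfloor> \<and> \<lfloor>x'\<rfloor> = \<lfloor>x\<rfloor> - 1)"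
proof (cases "x = of_int \<lfloor>x\<rfloor>")
  case True
  then show ?thesis by (intro that[of 1]) (auto simp: floor_eq_iff abs_less_iff; linarith)+
next
  case False
  then have "of_int \<lfloor>x\<rfloor> < x" by (metis of_int_floor_le order_le_imp_less_or_eq)
  moreover have "x < of_int \<lfloor>x\<rfloor> + 1" by linarith
  ultimately show ?thesis
    by (intro that[of "min (x - of_int \<lfloor>x\<rfloor>) (of_int \<lfloor>x\<rfloor> + 1 - x)"]) (auto simp: floor_eq_iff abs_less_iff)
qed

text \<open>A point off the loop may still lie on lattice lines. The squares touching it are then
  separated by edges through the point; none of these is on the loop, so the squares have equal
  winding numbers.\<close>

lemma wind_floor_locally_constant:
  assumes "edge_path p es p" and z: "z \<notin> loop_trace es"
  obtains \<epsilon> where "\<epsilon> > 0"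
    "\<And>w. dist w z < \<epsilon> \<Longrightarrow> wind es (\<lfloor>Re w\<rfloor>, \<lfloor>Im w\<rfloor>) = wind es (\<lfloor>Re z\<rfloor>, \<lfloor>Im z\<rfloor>)"
proof -
  define a b where "a = \<lfloor>Re z\<rfloor>" and "b = \<lfloor>Im z\<rfloor>"
  obtain \<epsilon>1 where 1: "\<epsilon>1 > 0" "\<And>x'. \<bar>x' - Re z\<bar> < \<epsilon>1 \<Longrightarrow> \<lfloor>x'\<rfloor> = a \<or> (Re z = of_int a \<and> \<lfloor>x'\<rfloor> = a - 1)"
    unfolding a_def using floor_nearby by metis
  obtain \<epsilon>2 where 2: "\<epsilon>2 > 0" "\<And>x'. \<bar>x' - Im z\<bar> < \<epsilon>2 \<Longrightarrow> \<lfloor>x'\<rfloor> = b \<or> (Im z = of_int b \<and> \<lfloor>x'\<rfloor> = b - 1)"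
    unfolding b_def using floor_nearby by metis
  have bounds: "of_int a \<le> Re z" "Re z < of_int a + 1" "of_int b \<le> Im z" "Im z < of_int b + 1"
    by (auto simp: a_def b_def)
  have eq: "wind es (left_face e) = wind es (right_face e)"
    if "e \<in> edges" "z \<in> closed_segment (plane_point (fst e)) (plane_point (snd e))" for e
    using wind_left_right[OF assms(1) that(1)] flow_notin[OF loop_trace_avoid[OF z that(2)]] by simp
  \<comment> \<open>The second option for \<open>b'\<close> serves lattice points, at which the edge
    below also ends.\<close>
  have A: "wind es (a - 1, b') = wind es (a, b')" if "Re z = of_int a" "b' = b \<or> (Im z = of_int b \<and> b' = b - 1)" for b'
  proof -
    have "z \<in> closed_segment (plane_point (a, b')) (plane_point (a, b' + 1))"
      using that bounds closed_segment_edge[OF right_edge_faces(1), of z a b'] by auto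
    then show ?thesis using eq[OF right_edge_faces(1)[of a b']] by (simp add: left_face_def)
  qed
  have B: "wind es (a, b - 1) = wind es (a, b)" if "Im z = of_int b"
  proof -
    have "z \<in> closed_segment (plane_point (a + 1, b)) (plane_point (a + 1 - 1, b))"
      using that bounds closed_segment_edge[OF right_edge_faces(4), of z "a + 1" b] by auto
    then show ?thesis using eq[OF right_edge_faces(4)[of "a + 1" b]] by (simp add: left_face_def)
  qed
  show ?thesis
  proof (rule that[of "min \<epsilon>1 \<epsilon>2"])
    fix w assume w: "dist w z < min \<epsilon>1 \<epsilon>2"
    have "\<bar>Re w - Re z\<bar> < \<epsilon>1" "\<bar>Im w - Im z\<bar> < \<epsilon>2"
      using w abs_Re_le_cmod[of "w - z"] abs_Im_le_cmod[of "w - z"] by (auto simp: dist_norm)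
    then show "wind es (\<lfloor>Re w\<rfloor>, \<lfloor>Im w\<rfloor>) = wind es (\<lfloor>Re z\<rfloor>, \<lfloor>Im z\<rfloor>)"
      using 1(2)[of "Re w"] 2(2)[of "Im w"] A B unfolding a_def[symmetric] b_def[symmetric] by metis
  qed (use 1 2 in auto)
qed

lemma wind_floor_constant:
  assumes "edge_path p es p" "connected C" "C \<inter> loop_trace es = {}" "z \<in> C" "w \<in> C"
  shows "wind es (\<lfloor>Re z\<rfloor>, \<lfloor>Im z\<rfloor>) = wind es (\<lfloor>Re w\<rfloor>, \<lfloor>Im w\<rfloor>)"
proof -
  have "\<forall>\<^sub>F w in at z within C. wind es (\<lfloor>Re z\<rfloor>, \<lfloor>Im z\<rfloor>) = wind es (\<lfloor>Re w\<rfloor>, \<lfloor>Im w\<rfloor>)" if "z \<in> C" for z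
  proof -
    have "z \<notin> loop_trace es" using that assms(3) by auto
    from wind_floor_locally_constant[OF assms(1) this] obtain \<epsilon> where "\<epsilon> > 0"
      "\<And>w. dist w z < \<epsilon> \<Longrightarrow> wind es (\<lfloor>Re w\<rfloor>, \<lfloor>Im w\<rfloor>) = wind es (\<lfloor>Re z\<rfloor>, \<lfloor>Im z\<rfloor>)" by metis
    then show ?thesis unfolding eventually_at by metis
  qed
  then show ?thesis
    using connected_local_const[OF assms(2,4,5), of "\<lambda>z. wind es (\<lfloor>Re z\<rfloor>, \<lfloor>Im z\<rfloor>)"] by blast
qed

definition face_center :: "vertex \<Rightarrow> complex" where
  "face_center f = Complex (of_int (fst f) + 1/2) (of_int (snd f) + 1/2)"

lemma floor_face_center [simp]:
  "\<lfloor>Re (face_center f)\<rfloor> = fst f" "\<lfloor>Im (face_center f)\<rfloor> = snd f"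
  by (simp_all add: face_center_def floor_eq_iff)

lemma open_unit_square_iff:
  "z \<in> open_unit_square f \<longleftrightarrow> of_int (fst f) < Re z \<and> Re z < of_int (fst f) + 1 \<and>
     of_int (snd f) < Im z \<and> Im z < of_int (snd f) + 1"
  by (auto simp: open_unit_square_def plane_point_def in_box_complex_iff)

lemma face_center_in_square [simp]: "face_center f \<in> open_unit_square f"
  by (simp add: open_unit_square_iff face_center_def)

lemma open_unit_square_avoids:
  assumes "set es \<subseteq> edges" shows "open_unit_square f \<inter> loop_trace es = {}"
proof -
  have False if "z \<in> open_unit_square f" "e \<in> set es"
    "z \<in> closed_segment (plane_point (fst e)) (plane_point (snd e))" for z e
  proof -
    have "\<exists>n. Re z = of_int n \<or> Im z = of_int n"
      using closed_segment_edge[of e z] that assms by blast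
    then show False using that(1) unfolding open_unit_square_iff
      by (metis of_int_less_iff of_int_add of_int_1 zless_imp_add1_zle not_less)
  qed
  then show ?thesis by (auto simp: loop_trace_def)
qed

lemma of_int_half:
  "real_of_int m \<le> of_int n + 1/2 \<longleftrightarrow> m \<le> n" "of_int n + 1/2 \<le> real_of_int m \<longleftrightarrow> n < m"
  "of_int n - 1/2 \<le> real_of_int m \<longleftrightarrow> n \<le> m" "real_of_int m \<noteq> of_int n + 1/2"
proof -
  show 1: "real_of_int m \<le> of_int n + 1/2 \<longleftrightarrow> m \<le> n"
    using of_int_le_iff[of "n + 1" m, where 'a = real] of_int_le_iff[of m n, where 'a = real]
    by (simp del: of_int_le_iff) linarith
  show 2: "of_int n + 1/2 \<le> real_of_int m \<longleftrightarrow> n < m"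
    using of_int_le_iff[of "n + 1" m, where 'a = real] of_int_le_iff[of m n, where 'a = real]
    by (simp del: of_int_le_iff) linarith
  show "of_int n - 1/2 \<le> real_of_int m \<longleftrightarrow> n \<le> m"
    using of_int_le_iff[of n m, where 'a = real] of_int_le_iff[of m "n - 1", where 'a = real]
    by (simp del: of_int_le_iff) linarith
  show "real_of_int m \<noteq> of_int n + 1/2" using 1 2 by linarith
qed

text \<open>Between the centres of adjacent faces one coordinate is constantly a half-integer and
  the other stays within 1/2 of an integer, so the only lattice edge met is the one separating the
  faces.\<close>

lemma face_center_segment_aux:
  assumes "e \<in> {((x, y), (x, y + 1)), ((x + 1, y), (x, y))}"
    and "w \<in> closed_segment (face_center (left_face e)) (face_center (right_face e))"
    and "c \<in> edges" "w \<in> closed_segment (plane_point (fst c)) (plane_point (snd c))"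
  shows "c = e \<or> c = rev_edge e"
proof (cases "e = ((x, y), (x, y + 1))")
  case True
  have w: "Im w = of_int y + 1/2" "of_int x - 1/2 \<le> Re w" "Re w \<le> of_int x + 1/2"
    using assms(2) unfolding True right_edge_faces
    by (auto simp: face_center_def closed_segment_same_Im closed_segment_eq_real_ivl)
  have n: "Im w \<noteq> of_int n" for n using w(1) of_int_half(4) by metis
  obtain X Y Y' where c: "c = ((X, Y), (X, Y'))" "Re w = of_int X" "of_int (min Y Y') \<le> Im w" "Im w \<le> of_int (max Y Y')"
    using closed_segment_edge[OF assms(3), of w] assms(4) n by (metis prod.collapse)
  have "X = x" using w(2,3) of_int_half(1,3) unfolding c(2) by (simp add: order_antisym)
  moreover have "\<bar>Y - Y'\<bar> = 1" using assms(3) c(1) by (simp add: edges_def)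
  moreover have "min Y Y' \<le> y" "y < max Y Y'" using c(3,4) unfolding w(1) of_int_half .
  ultimately have "(Y = y \<and> Y' = y + 1) \<or> (Y = y + 1 \<and> Y' = y)" by linarith
  then show ?thesis using c(1) \<open>X = x\<close> True by auto
next
  case False
  then have e: "e = ((x + 1, y), (x + 1 - 1, y))" using assms(1) by simp
  have w: "Re w = of_int x + 1/2" "of_int y - 1/2 \<le> Im w" "Im w \<le> of_int y + 1/2"
    using assms(2) unfolding e right_edge_faces
    by (auto simp: face_center_def closed_segment_same_Re closed_segment_eq_real_ivl)
  have n: "Re w \<noteq> of_int n" for n using w(1) of_int_half(4) by metis
  obtain X X' Y where c: "c = ((X, Y), (X', Y))" "Im w = of_int Y" "of_int (min X X') \<le> Re w" "Re w \<le> of_int (max X X')"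
    using closed_segment_edge[OF assms(3), of w] assms(4) n by (metis prod.collapse)
  have "Y = y" using w(2,3) of_int_half(1,3) unfolding c(2) by (simp add: order_antisym)
  moreover have "\<bar>X - X'\<bar> = 1" using assms(3) c(1) by (simp add: edges_def)
  moreover have "min X X' \<le> x" "x < max X X'" using c(3,4) unfolding w(1) of_int_half .
  ultimately have "(X = x \<and> X' = x + 1) \<or> (X = x + 1 \<and> X' = x)" by linarith
  then show ?thesis using c(1) \<open>Y = y\<close> e by auto
qed

lemma face_center_segment_avoids:
  assumes "set es \<subseteq> edges" "e \<in> edges" "e \<notin> set es" "rev_edge e \<notin> set es"
  shows "closed_segment (face_center (left_face e)) (face_center (right_face e)) \<inter> loop_trace es = {}"
proof -
  obtain x y where xy: "e \<in> {((x, y), (x, y + 1)), ((x + 1, y), (x, y))} \<or>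
      rev_edge e \<in> {((x, y), (x, y + 1)), ((x + 1, y), (x, y))}"
    using assms(2)
  proof (cases rule: edge_cases)
    case (Right x y) then show ?thesis using that[of x y] by simp
  next
    case (Left x y) then show ?thesis using that[of "x - 1" y] by simp
  next
    case (Up x y) then show ?thesis using that[of x y] by simp
  next
    case (Down x y) then show ?thesis using that[of x "y - 1"] by simp
  qed
  have "c = e \<or> c = rev_edge e" if c: "c \<in> set es"
    "w \<in> closed_segment (face_center (left_face e)) (face_center (right_face e))"
    "w \<in> closed_segment (plane_point (fst c)) (plane_point (snd c))" for c w
    using xy
  proof
    assume "e \<in> {((x, y), (x, y + 1)), ((x + 1, y), (x, y))}"
    from face_center_segment_aux[OF this c(2) _ c(3)] show ?thesis using assms(1) c(1) by blast
  next
    assume "rev_edge e \<in> {((x, y), (x, y + 1)), ((x + 1, y), (x, y))}"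
    moreover have "w \<in> closed_segment (face_center (left_face (rev_edge e))) (face_center (right_face (rev_edge e)))"
      using c(2) closed_segment_commute by simp blast
    ultimately have "c = rev_edge e \<or> c = rev_edge (rev_edge e)"
      using face_center_segment_aux c(1,3) assms(1) by blast
    then show ?thesis by auto
  qed
  then show ?thesis using assms(3,4) by (fastforce simp: loop_trace_def)
qed

lemma finite_bounded_faces:
  assumes "bounded C" shows "finite {f. face_center f \<in> C}"
proof -
  obtain K where K: "\<And>z. z \<in> C \<Longrightarrow> norm z \<le> K" using assms unfolding bounded_iff by blast
  define B where "B = \<lceil>K\<rceil> + 1"
  have "{f. face_center f \<in> C} \<subseteq> {-B..B} \<times> {-B..B}"
  proof
    fix f assume "f \<in> {f. face_center f \<in> C}"
    then have "\<bar>Re (face_center f)\<bar> \<le> K" "\<bar>Im (face_center f)\<bar> \<le> K"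
      using K[of "face_center f"] abs_Re_le_cmod abs_Im_le_cmod by (auto intro: order_trans)
    then have "\<bar>of_int (fst f)\<bar> \<le> K + 1" "\<bar>of_int (snd f)\<bar> \<le> K + 1" by (simp_all add: face_center_def; linarith)+
    then have "\<bar>fst f\<bar> \<le> B" "\<bar>snd f\<bar> \<le> B" unfolding B_def by linarith+
    then show "f \<in> {-B..B} \<times> {-B..B}" by (cases f) auto
  qed
  then show ?thesis by (rule finite_subset) auto
qed

text \<open>A nonzero winding number persists on the whole component of the square off the loop and
  vanishes far away, so the component is bounded. Conversely, a bounded component with winding
  number 0 would consist of finitely many faces around which no consistent side of the loop
  exists.\<close>

theorem square_inside_iff:
  assumes "circuit es" "length es \<noteq> 2"
  shows "open_unit_square f \<subseteq> inside (loop_trace es) \<longleftrightarrow> wind es f \<noteq> 0"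
proof
  have p: "edge_path (fst (hd es)) es (fst (hd es))" using assms(1) by (simp add: circuit_def)
  have E: "set es \<subseteq> edges" by (rule circuit_edges[OF assms(1)])
  let ?S = "loop_trace es"
  {
    assume nz: "wind es f \<noteq> 0"
    obtain B where B: "B > 0" "\<And>e. e \<in> set es \<Longrightarrow> \<bar>fst (fst e)\<bar> \<le> B \<and> \<bar>snd (fst e)\<bar> \<le> B"
      using edge_list_bound by metis
    show "open_unit_square f \<subseteq> inside ?S"
    proof
      fix z assume z: "z \<in> open_unit_square f"
      then have zS: "z \<notin> ?S" using open_unit_square_avoids[OF E] by blast
      let ?C = "connected_component_set (- ?S) z"
      have fz: "(\<lfloor>Re z\<rfloor>, \<lfloor>Im z\<rfloor>) = f" using z unfolding open_unit_square_iff by (auto simp: prod_eq_iff floor_eq_iff)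
      have "norm w \<le> 2 * (of_int B + 1)" if "w \<in> ?C" for w
      proof -
        have "?C \<inter> ?S = {}" using connected_component_subset[of "- ?S" z] by blast
        then have "wind es (\<lfloor>Re w\<rfloor>, \<lfloor>Im w\<rfloor>) \<noteq> 0"
          using wind_floor_constant[OF p connected_connected_component _ _ that, of z] fz nz zS
          by (simp add: connected_component_refl_eq)
        then have "\<not> (\<bar>\<lfloor>Re w\<rfloor>\<bar> > B \<or> \<bar>\<lfloor>Im w\<rfloor>\<bar> > B)" using wind_eq_0[OF p B(2)] by blast
        then have "\<bar>Re w\<bar> \<le> of_int B + 1" "\<bar>Im w\<bar> \<le> of_int B + 1" by linarith+
        then show ?thesis using cmod_le[of w] by (simp add: algebra_simps)
      qed
      then have "bounded ?C" unfolding bounded_iff by blast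
      then show "z \<in> inside ?S" using zS by (simp add: inside_def)
    qed
  }
  {
    assume ins: "open_unit_square f \<subseteq> inside ?S"
    show "wind es f \<noteq> 0"
    proof
      assume z0: "wind es f = 0"
      define C where "C = connected_component_set (- ?S) (face_center f)"
      define T where "T = {f'. face_center f' \<in> C}"
      define D where "D = {f'. wind es f' \<noteq> 0}"
      have fin: "face_center f \<in> inside ?S" using ins by auto
      then have fT: "f \<in> T" by (simp add: T_def C_def inside_def connected_component_refl_eq)
      have finT: "finite T" unfolding T_def using fin by (intro finite_bounded_faces) (simp add: C_def inside_def)
      have CS: "C \<inter> ?S = {}" using connected_component_subset[of "- ?S"] unfolding C_def by blast
      have T0: "wind es f' = 0" if "f' \<in> T" for f'
        using wind_floor_constant[OF p _ CS, of "face_center f" "face_center f'"] that fT z0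
        by (simp add: T_def) (simp add: C_def)
      have bd: "e \<in> set es \<or> rev_edge e \<in> set es" if "e \<in> edges" "left_face e \<in> T" "right_face e \<notin> T" for e
      proof (rule ccontr)
        assume "\<not> ?thesis"
        then have "closed_segment (face_center (left_face e)) (face_center (right_face e)) \<subseteq> - ?S"
          using face_center_segment_avoids[OF E that(1)] by blast
        then have "connected_component (- ?S) (face_center (left_face e)) (face_center (right_face e))"
          unfolding connected_component_def by (intro exI conjI connected_segment) auto
        then have "face_center (right_face e) \<in> C"
          using that(2) unfolding T_def C_def by (auto intro: connected_component_trans)
        then show False using that(3) by (simp add: T_def)
      qed
      \<comment> \<open>The top edge \<open>e\<close> of \<open>T\<close> and \<open>D\<close>
        together turns out to be on the loop. By \<open>enclosed_faces\<close> the set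
        \<open>T\<close> is on one side of \<open>e\<close>, necessarily the left, so both faces of
        \<open>e\<close> have winding number 0, although the flow along \<open>e\<close> is 1 or
        -1.\<close>
      have "finite (T \<union> D)" using finT finite_wind_support[OF p] by (simp add: D_def)
      moreover have "T \<union> D \<noteq> {}" using fT by auto
      ultimately obtain e where e: "e \<in> edges" "left_face e \<in> T \<union> D" "right_face e \<notin> T \<union> D"
        by (rule finite_faces_boundary)
      have mem: "e \<in> set es \<or> rev_edge e \<in> set es"
      proof (cases "left_face e \<in> T")
        case True
        then show ?thesis using bd e by blast
      next
        case False
        then have "flow es e \<noteq> 0" using e wind_left_right[OF p e(1)] by (auto simp: D_def)
        then show ?thesis using flow_notin by blast
      qed
      have "left_face e \<in> T"
        using mem enclosed_faces[OF assms finT _ bd, of e] enclosed_faces[OF assms finT _ bd, of "rev_edge e"] fT e(3)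
        by auto
      then have "flow es e = 0" using T0 wind_left_right[OF p e(1)] e(3) by (auto simp: D_def)
      then show False using mem circuit_flow[OF assms, of e] circuit_flow[OF assms, of "rev_edge e"] flow_rev[OF e(1), of es] by auto
    qed
  }
qed

corollary loop_area_wind:
  assumes "circuit es" "length es \<noteq> 2"
  shows "loop_area es = card {f. wind es f \<noteq> 0}"
  unfolding loop_area_def square_inside_iff[OF assms] ..

section \<open>The special orthogonal group\<close>


lemma index_mult_mat_sum:
  "A \<in> carrier_mat n n \<Longrightarrow> B \<in> carrier_mat n n \<Longrightarrow> i < n \<Longrightarrow> j < n \<Longrightarrow>
    (A * B) $$ (i, j) = (\<Sum>k<n. A $$ (i, k) * B $$ (k, j))" for A B :: "'a :: semiring_0 mat"
  by (auto simp: scalar_prod_def atLeast0LessThan intro!: sum.cong)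

lemma mat_trace_mult_comm:
  assumes "A \<in> carrier_mat n n" "B \<in> carrier_mat n n"
  shows "mat_trace (A * B) = mat_trace (B * A)"
proof -
  have "mat_trace (A * B) = (\<Sum>i<n. \<Sum>k<n. A $$ (i, k) * B $$ (k, i))"
    using assms by (simp add: mat_trace_def index_mult_mat_sum del: index_mult_mat(1))
  also have "\<dots> = (\<Sum>k<n. \<Sum>i<n. B $$ (k, i) * A $$ (i, k))"
    by (subst sum.swap) (simp add: mult.commute)
  also have "\<dots> = mat_trace (B * A)"
    using assms by (simp add: mat_trace_def index_mult_mat_sum del: index_mult_mat(1))
  finally show ?thesis .
qed

lemma mat_trace_transpose: "A \<in> carrier_mat n n \<Longrightarrow> mat_trace (transpose_mat A) = mat_trace A"
  by (simp add: mat_trace_def)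

lemma mat_trace_one [simp]: "mat_trace (1\<^sub>m n) = real n"
  by (simp add: mat_trace_def)

lemma SO_iff: "A \<in> carrier (SO N) \<longleftrightarrow>
    A \<in> carrier_mat N N \<and> transpose_mat A * A = 1\<^sub>m N \<and> Determinant.det A = 1"
  by (simp add: SO_def)

lemma SO_simps [simp]: "mult (SO N) = (*)" "one (SO N) = 1\<^sub>m N"
  by (simp_all add: SO_def)

lemma SO_carrier_mat: "A \<in> carrier (SO N) \<Longrightarrow> A \<in> carrier_mat N N"
  by (simp add: SO_iff)

lemma SO_transpose_left: "A \<in> carrier (SO N) \<Longrightarrow> transpose_mat A * A = 1\<^sub>m N"
  by (simp add: SO_iff)

lemma SO_transpose_right: "A \<in> carrier (SO N) \<Longrightarrow> A * transpose_mat A = 1\<^sub>m N"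
  by (metis SO_iff mat_mult_left_right_inverse transpose_carrier_mat)

lemma SO_transpose: "A \<in> carrier (SO N) \<Longrightarrow> transpose_mat A \<in> carrier (SO N)"
  using SO_transpose_right[of A N] Determinant.det_transpose[of A N] by (simp add: SO_iff)

lemma SO_mult: "A \<in> carrier (SO N) \<Longrightarrow> B \<in> carrier (SO N) \<Longrightarrow> A * B \<in> carrier (SO N)"
proof -
  assume A: "A \<in> carrier (SO N)" and B: "B \<in> carrier (SO N)"
  note AB = SO_carrier_mat[OF A] SO_carrier_mat[OF B]
  have "transpose_mat (A * B) * (A * B) = transpose_mat B * (transpose_mat A * A) * B"
    using AB by (simp add: Matrix.transpose_mult[OF AB] assoc_mult_mat[of _ N N _ N _ N])
  also have "\<dots> = 1\<^sub>m N" using A B AB by (simp add: SO_transpose_left)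
  finally show "A * B \<in> carrier (SO N)"
    using A B AB by (simp add: SO_iff Determinant.det_mult[OF AB])
qed

lemma SO_one: "1\<^sub>m N \<in> carrier (SO N)"
  by (simp add: SO_iff)

lemma group_SO: "group (SO N)"
proof (rule groupI)
  fix A B C assume *: "A \<in> carrier (SO N)" "B \<in> carrier (SO N)" "C \<in> carrier (SO N)"
  then show "A \<otimes>\<^bsub>SO N\<^esub> B \<otimes>\<^bsub>SO N\<^esub> C = A \<otimes>\<^bsub>SO N\<^esub> (B \<otimes>\<^bsub>SO N\<^esub> C)"
    by (simp add: assoc_mult_mat[OF SO_carrier_mat[OF *(1)] SO_carrier_mat[OF *(2)] SO_carrier_mat[OF *(3)]])
next
  fix A assume "A \<in> carrier (SO N)"
  then show "\<exists>B\<in>carrier (SO N). B \<otimes>\<^bsub>SO N\<^esub> A = \<one>\<^bsub>SO N\<^esub>"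
    by (intro bexI[of _ "transpose_mat A"]) (simp_all add: SO_transpose SO_transpose_left)
qed (auto simp: SO_mult SO_one dest: SO_carrier_mat)

lemma inv_SO: "A \<in> carrier (SO N) \<Longrightarrow> inv\<^bsub>SO N\<^esub> A = transpose_mat A"
  by (rule group.inv_equality[OF group_SO]) (simp_all add: SO_transpose SO_transpose_left)

lemma SO_column_norm:
  assumes "A \<in> carrier (SO N)" "j < N" shows "(\<Sum>k<N. (A $$ (k, j))\<^sup>2) = 1"
proof -
  note A = SO_carrier_mat[OF assms(1)]
  have "(transpose_mat A * A) $$ (j, j) = (\<Sum>k<N. (A $$ (k, j))\<^sup>2)"
    using assms(2) A by (simp add: index_mult_mat_sum[of _ N] power2_eq_square del: index_mult_mat(1))
  then show ?thesis using SO_transpose_left[OF assms(1)] assms(2) by simp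
qed

lemma SO_entry_bound:
  assumes "A \<in> carrier (SO N)" "i < N" "j < N" shows "\<bar>A $$ (i, j)\<bar> \<le> 1"
proof -
  have "(A $$ (i, j))\<^sup>2 \<le> (\<Sum>k<N. (A $$ (k, j))\<^sup>2)"
    using assms(2) by (intro member_le_sum) auto
  then show ?thesis using SO_column_norm[OF assms(1,3)] by (simp add: abs_square_le_1)
qed

lemma SO_trace_bound:
  assumes "A \<in> carrier (SO N)" shows "\<bar>mat_trace A\<bar> \<le> real N"
proof -
  have "\<bar>mat_trace A\<bar> \<le> (\<Sum>i<N. \<bar>A $$ (i, i)\<bar>)"
    using SO_carrier_mat[OF assms] by (auto simp: mat_trace_def intro!: sum_abs)
  also have "\<dots> \<le> (\<Sum>i<N. 1)" by (intro sum_mono) (auto intro!: SO_entry_bound[OF assms])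
  finally show ?thesis by simp
qed

section \<open>Plane rotations\<close>

definition plane_rot :: "nat \<Rightarrow> nat \<Rightarrow> nat \<Rightarrow> real \<Rightarrow> real mat" where
  "plane_rot N i j t = Matrix.mat N N (\<lambda>(a, b).
     if a = i then (if b = i then cos t else if b = j then sin t else 0)
     else if a = j then (if b = i then - sin t else if b = j then cos t else 0)
     else if a = b then 1 else 0)"

lemma plane_rot_carrier [simp]: "plane_rot N i j t \<in> carrier_mat N N"
  by (simp add: plane_rot_def)

lemma plane_rot_mult_entry:
  assumes "B \<in> carrier_mat N N" "i < N" "j < N" "i \<noteq> j" "a < N" "b < N"
  shows "(plane_rot N i j t * B) $$ (a, b) =
    (if a = i then cos t * B $$ (i, b) + sin t * B $$ (j, b)
     else if a = j then - sin t * B $$ (i, b) + cos t * B $$ (j, b) else B $$ (a, b))"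
proof -
  have "(plane_rot N i j t * B) $$ (a, b) = (\<Sum>k<N. plane_rot N i j t $$ (a, k) * B $$ (k, b))"
    using assms by (simp add: index_mult_mat_sum[of _ N] del: index_mult_mat(1))
  also have "\<dots> = (\<Sum>k<N. (if k = i then (if a = i then cos t else if a = j then - sin t else 0) * B $$ (k, b) else 0) +
      (if k = j then (if a = i then sin t else if a = j then cos t else 0) * B $$ (k, b) else 0) +
      (if k = a then (if a = i \<or> a = j then 0 else B $$ (k, b)) else 0))"
    using assms by (intro sum.cong) (auto simp: plane_rot_def)
  also have "\<dots> = (if a = i then cos t * B $$ (i, b) + sin t * B $$ (j, b)
     else if a = j then - sin t * B $$ (i, b) + cos t * B $$ (j, b) else B $$ (a, b))"
    using assms by (simp add: sum.distrib)
  finally show ?thesis .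
qed

lemma plane_rot_add:
  assumes "i < N" "j < N" "i \<noteq> j"
  shows "plane_rot N i j s * plane_rot N i j t = plane_rot N i j (s + t)"
proof (rule eq_matI)
  fix a b assume "a < dim_row (plane_rot N i j (s + t))" "b < dim_col (plane_rot N i j (s + t))"
  then have ab: "a < N" "b < N" by (simp_all add: plane_rot_def)
  show "(plane_rot N i j s * plane_rot N i j t) $$ (a, b) = plane_rot N i j (s + t) $$ (a, b)"
    using plane_rot_mult_entry[OF plane_rot_carrier assms ab, of s i j t] assms ab
    by (auto simp: plane_rot_def cos_add sin_add)
qed (simp_all add: plane_rot_def)

lemma plane_rot_zero: "plane_rot N i j 0 = 1\<^sub>m N"
  by (rule eq_matI) (auto simp: plane_rot_def)

lemma plane_rot_SO:
  assumes "i < N" "j < N" "i \<noteq> j"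
  shows "plane_rot N i j t \<in> carrier (SO N)"
proof -
  have tr: "transpose_mat (plane_rot N i j s) = plane_rot N i j (- s)" for s
    by (rule eq_matI) (auto simp: plane_rot_def)
  have orth: "transpose_mat (plane_rot N i j s) * plane_rot N i j s = 1\<^sub>m N" for s
    by (simp add: tr plane_rot_add[OF assms] plane_rot_zero)
  \<comment> \<open>Orthogonality leaves 1 and -1, so only the square of the determinant is known;
    but a rotation by \<open>t\<close> is the square of the rotation by \<open>t/2\<close>.\<close>
  have "Determinant.det (plane_rot N i j s) * Determinant.det (plane_rot N i j s) = 1" for s
    using arg_cong[OF orth[of s], of Determinant.det]
    by (simp add: Determinant.det_mult[of _ N] Determinant.det_transpose[of _ N])
  then have "Determinant.det (plane_rot N i j (t/2) * plane_rot N i j (t/2)) = 1"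
    by (simp add: Determinant.det_mult[of _ N])
  then show ?thesis using orth by (simp add: SO_iff plane_rot_add[OF assms])
qed

text \<open>A matrix commuting with the half turns in the coordinate planes is diagonal; this needs a
  third index. Commuting with the quarter turns then makes the diagonal constant.\<close>

lemma SO_commuting_scalar:
  assumes "3 \<le> N" and A: "A \<in> carrier_mat N N"
    and comm: "\<And>g. g \<in> carrier (SO N) \<Longrightarrow> g * A = A * g"
    and ij: "i < N" "j < N"
  shows "real N * A $$ (i, j) = (if i = j then mat_trace A else 0)"
proof -
  have right: "(A * plane_rot N p q t) $$ (a, b) =
    (if b = p then cos t * A $$ (a, p) - sin t * A $$ (a, q)
     else if b = q then sin t * A $$ (a, p) + cos t * A $$ (a, q) else A $$ (a, b))"
    if "p < N" "q < N" "p \<noteq> q" "a < N" "b < N" for p q t a b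
  proof -
    have "(A * plane_rot N p q t) $$ (a, b) = (\<Sum>k<N. A $$ (a, k) * plane_rot N p q t $$ (k, b))"
      using that A by (simp add: index_mult_mat_sum[of _ N] del: index_mult_mat(1))
    also have "\<dots> = (\<Sum>k<N. (if k = p then (if b = p then cos t else if b = q then sin t else 0) * A $$ (a, k) else 0) +
        (if k = q then (if b = p then - sin t else if b = q then cos t else 0) * A $$ (a, k) else 0) +
        (if k = b then (if b = p \<or> b = q then 0 else A $$ (a, k)) else 0))"
      using that by (intro sum.cong) (auto simp: plane_rot_def)
    also have "\<dots> = (if b = p then cos t * A $$ (a, p) - sin t * A $$ (a, q)
     else if b = q then sin t * A $$ (a, p) + cos t * A $$ (a, q) else A $$ (a, b))"
      using that by (simp add: sum.distrib)
    finally show ?thesis .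
  qed
  have off: "A $$ (a, b) = 0" if "a < N" "b < N" "a \<noteq> b" for a b
  proof -
    have "card {a, b} \<le> 2" by (simp add: card_insert_if)
    then have "card ({..<N} - {a, b}) > 0"
      using assms(1) diff_card_le_card_Diff[of "{a, b}" "{..<N}"] by simp
    then obtain k where k: "k < N" "k \<noteq> a" "k \<noteq> b"
      by (metis Diff_iff card_gt_0_iff ex_in_conv insertCI lessThan_iff)
    \<comment> \<open>The half turn in the plane of \<open>a\<close> and \<open>k\<close> negates
      row \<open>a\<close> from the left and leaves column \<open>b\<close> alone from the right, so
      the entry equals its own negative.\<close>
    show ?thesis
      using arg_cong[OF comm[OF plane_rot_SO[of a N k pi]], of "\<lambda>M. M $$ (a, b)"]
        plane_rot_mult_entry[OF A, of a k a b pi] right[of a k a b pi] that k by simp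
  qed
  have diag: "A $$ (a, a) = A $$ (b, b)" if "a < N" "b < N" for a b
  proof (cases "a = b")
    case False
    then show ?thesis
      using arg_cong[OF comm[OF plane_rot_SO[of a N b "pi/2"]], of "\<lambda>M. M $$ (a, b)"]
        plane_rot_mult_entry[OF A, of a b a b "pi/2"] right[of a b a b "pi/2"] that by simp
  qed simp
  have "mat_trace A = (\<Sum>k<N. A $$ (k, k))" using A by (simp add: mat_trace_def)
  also have "\<dots> = (\<Sum>k<N. A $$ (i, i))"
    by (rule sum.cong[OF refl]) (rule diag, simp, rule ij)
  finally have "mat_trace A = (\<Sum>k<N. A $$ (i, i))" .
  then show ?thesis using off ij by auto
qed

section \<open>Bounded measurable functions\<close>

text \<open>A class closed under algebraic operations, \<open>exp\<close> and composition with
  measurable maps, whose members are integrable for every finite measure; integrability of all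
  integrands below follows by these rules.\<close>

definition bounded_meas :: "'a measure \<Rightarrow> ('a \<Rightarrow> real) \<Rightarrow> bool" where
  "bounded_meas M f \<longleftrightarrow> f \<in> borel_measurable M \<and> (\<exists>C. \<forall>x \<in> space M. \<bar>f x\<bar> \<le> C)"

lemma bounded_measI: "f \<in> borel_measurable M \<Longrightarrow> (\<And>x. x \<in> space M \<Longrightarrow> \<bar>f x\<bar> \<le> C) \<Longrightarrow> bounded_meas M f"
  by (auto simp: bounded_meas_def)

lemma bounded_meas_measurable: "bounded_meas M f \<Longrightarrow> f \<in> borel_measurable M"
  by (simp add: bounded_meas_def)

lemma bounded_meas_integrable:
  assumes "finite_measure M" "bounded_meas M f" shows "integrable M f"
proof -
  obtain C where "f \<in> borel_measurable M" "\<forall>x \<in> space M. \<bar>f x\<bar> \<le> C" using assms(2) by (auto simp: bounded_meas_def)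
  then show ?thesis by (intro finite_measure.integrable_const_bound[OF assms(1), of _ C]) auto
qed

lemma bounded_meas_const [intro!]: "bounded_meas M (\<lambda>x. c)"
  by (auto simp: bounded_meas_def)

lemma bounded_meas_add [intro]:
  assumes "bounded_meas M f" "bounded_meas M g" shows "bounded_meas M (\<lambda>x. f x + g x)"
proof -
  obtain C D where *: "\<forall>x \<in> space M. \<bar>f x\<bar> \<le> C" "\<forall>x \<in> space M. \<bar>g x\<bar> \<le> D"
    using assms by (auto simp: bounded_meas_def)
  show ?thesis
    by (rule bounded_measI[of _ _ "C + D"])
       (use assms * in \<open>auto simp: bounded_meas_def intro!: order_trans[OF abs_triangle_ineq] add_mono\<close>)
qed

lemma bounded_meas_mult [intro]:
  assumes "bounded_meas M f" "bounded_meas M g" shows "bounded_meas M (\<lambda>x. f x * g x)"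
proof -
  obtain C D where *: "\<forall>x \<in> space M. \<bar>f x\<bar> \<le> C" "\<forall>x \<in> space M. \<bar>g x\<bar> \<le> D"
    using assms by (auto simp: bounded_meas_def)
  show ?thesis
    by (rule bounded_measI[of _ _ "C * D"])
       (use assms * in \<open>auto simp: bounded_meas_def abs_mult intro!: mult_mono intro: order_trans[OF abs_ge_zero]\<close>)
qed

lemma bounded_meas_diff [intro]:
  assumes "bounded_meas M f" "bounded_meas M g" shows "bounded_meas M (\<lambda>x. f x - g x)"
  using bounded_meas_add[OF assms(1) bounded_meas_mult[OF bounded_meas_const[of M "-1"] assms(2)]] by simp

lemma bounded_meas_sum [intro]:
  "(\<And>i. i \<in> I \<Longrightarrow> bounded_meas M (f i)) \<Longrightarrow> bounded_meas M (\<lambda>x. \<Sum>i\<in>I. f i x)"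
  by (induction I rule: infinite_finite_induct) auto

lemma bounded_meas_prod [intro]:
  "(\<And>i. i \<in> I \<Longrightarrow> bounded_meas M (f i)) \<Longrightarrow> bounded_meas M (\<lambda>x. \<Prod>i\<in>I. f i x)"
  by (induction I rule: infinite_finite_induct) auto

lemma bounded_meas_exp [intro]:
  assumes "bounded_meas M f" shows "bounded_meas M (\<lambda>x. exp (f x))"
proof -
  obtain C where *: "\<forall>x \<in> space M. \<bar>f x\<bar> \<le> C" using assms by (auto simp: bounded_meas_def)
  show ?thesis
    by (rule bounded_measI[of _ _ "exp C"]) (use assms * in \<open>force simp: bounded_meas_def\<close>)+
qed

lemma bounded_meas_comp:
  "bounded_meas M f \<Longrightarrow> g \<in> measurable L M \<Longrightarrow> bounded_meas L (\<lambda>x. f (g x))"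
  using measurable_space[of g L M] by (fastforce simp: bounded_meas_def intro: measurable_compose)

lemma bounded_meas_cong:
  "(\<And>x. x \<in> space M \<Longrightarrow> f x = g x) \<Longrightarrow> bounded_meas M f \<longleftrightarrow> bounded_meas M g"
  unfolding bounded_meas_def by (auto cong: measurable_cong)

section \<open>Haar measure on the special orthogonal group\<close>

lemma space_SO_borel [simp]: "space (SO_borel N) = carrier (SO N)"
  by (simp add: SO_borel_def)

lemma measurable_SO_entry:
  assumes "i < N" "j < N" shows "(\<lambda>A. A $$ (i, j)) \<in> borel_measurable (SO_borel N)"
proof -
  have "(\<lambda>A. (\<lambda>ij \<in> {..<N} \<times> {..<N}. A $$ ij)) \<in> measurable (SO_borel N) (PiM ({..<N} \<times> {..<N}) (\<lambda>_. borel))"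
    unfolding SO_borel_def by (rule measurable_vimage_algebra1) (auto simp: space_PiM)
  from measurable_compose[OF this measurable_component_singleton[of "(i, j)"]] show ?thesis
    using assms by simp
qed

lemma measurable_into_SO:
  assumes "\<And>x. x \<in> space M \<Longrightarrow> f x \<in> carrier (SO N)"
    and "\<And>i j. i < N \<Longrightarrow> j < N \<Longrightarrow> (\<lambda>x. f x $$ (i, j)) \<in> borel_measurable M"
  shows "f \<in> measurable M (SO_borel N)"
  unfolding SO_borel_def
proof (rule measurable_vimage_algebra2)
  show "(\<lambda>x. \<lambda>ij\<in>{..<N} \<times> {..<N}. f x $$ ij) \<in> M \<rightarrow>\<^sub>M PiM ({..<N} \<times> {..<N}) (\<lambda>_. borel)"
    by (rule measurable_restrict) (use assms(2) in auto)
qed (use assms in auto)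

lemma measurable_SO_mult:
  assumes f: "f \<in> measurable M (SO_borel N)" and g: "g \<in> measurable M (SO_borel N)"
  shows "(\<lambda>x. f x * g x) \<in> measurable M (SO_borel N)"
proof -
  have c: "f x \<in> carrier (SO N)" "g x \<in> carrier (SO N)" if "x \<in> space M" for x
    using measurable_space[OF f that] measurable_space[OF g that] by auto
  show ?thesis
  proof (rule measurable_into_SO)
    fix i j assume ij: "i < N" "j < N"
    have "(\<lambda>x. \<Sum>k<N. f x $$ (i, k) * g x $$ (k, j)) \<in> borel_measurable M"
      using ij by (intro borel_measurable_sum borel_measurable_times measurable_compose[OF f] measurable_compose[OF g]
          measurable_SO_entry) auto
    then show "(\<lambda>x. (f x * g x) $$ (i, j)) \<in> borel_measurable M"
      by (rule measurable_cong[THEN iffD1, rotated])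
         (simp only: index_mult_mat_sum[OF SO_carrier_mat[OF c(1)] SO_carrier_mat[OF c(2)] ij])
  qed (use c in \<open>auto intro: SO_mult\<close>)
qed

lemma measurable_SO_transpose:
  assumes f: "f \<in> measurable M (SO_borel N)"
  shows "(\<lambda>x. transpose_mat (f x)) \<in> measurable M (SO_borel N)"
proof -
  have c: "f x \<in> carrier (SO N)" if "x \<in> space M" for x
    using measurable_space[OF f that] by auto
  show ?thesis
  proof (rule measurable_into_SO)
    fix i j assume ij: "i < N" "j < N"
    have "(\<lambda>x. f x $$ (j, i)) \<in> borel_measurable M"
      using ij by (intro measurable_compose[OF f] measurable_SO_entry) auto
    then show "(\<lambda>x. transpose_mat (f x) $$ (i, j)) \<in> borel_measurable M"
      by (rule measurable_cong[THEN iffD1, rotated]) (use c ij SO_carrier_mat in fastforce)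
  qed (use c in \<open>auto intro: SO_transpose\<close>)
qed

lemma bounded_meas_SO_entry: "i < N \<Longrightarrow> j < N \<Longrightarrow> bounded_meas (SO_borel N) (\<lambda>A. A $$ (i, j))"
  by (rule bounded_measI[OF measurable_SO_entry, of _ _ _ 1]) (auto intro: SO_entry_bound)

lemma bounded_meas_trace: "bounded_meas (SO_borel N) mat_trace"
proof -
  have "bounded_meas (SO_borel N) (\<lambda>A. \<Sum>i<N. A $$ (i, i))"
    by (auto intro: bounded_meas_SO_entry)
  then show ?thesis
    by (rule bounded_meas_cong[THEN iffD1, rotated]) (auto simp: mat_trace_def SO_iff)
qed

locale haar_SO =
  fixes N :: nat and \<mu> :: "real mat measure"
  assumes haar: "is_haar_SO N \<mu>"
begin

sublocale prob_space \<mu> using haar by (simp add: is_haar_SO_def)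

lemma space_haar [simp]: "space \<mu> = carrier (SO N)" and sets_haar: "sets \<mu> = sets (SO_borel N)"
  using haar by (auto simp: is_haar_SO_def)

lemma measurable_haar [simp]: "measurable \<mu> L = measurable (SO_borel N) L" "measurable L \<mu> = measurable L (SO_borel N)"
  by (rule measurable_cong_sets[OF sets_haar refl], rule measurable_cong_sets[OF refl sets_haar])

lemma bounded_meas_haar [simp]: "bounded_meas \<mu> f \<longleftrightarrow> bounded_meas (SO_borel N) f"
  by (simp add: bounded_meas_def)

lemma haar_integrable: "bounded_meas (SO_borel N) f \<Longrightarrow> integrable \<mu> f"
  using bounded_meas_integrable[OF finite_measure_axioms] by simp

lemma haar_left:
  fixes f :: "real mat \<Rightarrow> real"
  assumes "A \<in> carrier (SO N)" "f \<in> borel_measurable (SO_borel N)"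
  shows "(\<integral>B. f (A * B) \<partial>\<mu>) = (\<integral>B. f B \<partial>\<mu>)"
proof -
  have "(\<lambda>B. A * B) \<in> measurable (SO_borel N) (SO_borel N)"
    by (intro measurable_SO_mult measurable_const measurable_ident_sets[OF refl]) (simp add: assms(1))
  then have m: "(\<lambda>B. A * B) \<in> measurable \<mu> \<mu>" by (simp only: measurable_haar)
  have f: "f \<in> borel_measurable \<mu>" using assms(2) by (simp only: measurable_haar)
  have "distr \<mu> \<mu> (\<lambda>B. A * B) = \<mu>"
    using haar assms(1) unfolding is_haar_SO_def SO_simps by blast
  then show ?thesis using Bochner_Integration.integral_distr[OF m f] by metis
qed

text \<open>Integrate \<open>f (B\<^sup>T A)\<close> in both orders.\<close>

lemma haar_transpose:
  assumes "bounded_meas (SO_borel N) f"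
  shows "(\<integral>B. f (transpose_mat B) \<partial>\<mu>) = (\<integral>B. f B \<partial>\<mu>)"
proof -
  interpret P: pair_prob_space \<mu> \<mu> ..
  have S: "(\<lambda>x. fst x) \<in> measurable (\<mu> \<Otimes>\<^sub>M \<mu>) (SO_borel N)" "(\<lambda>x. snd x) \<in> measurable (\<mu> \<Otimes>\<^sub>M \<mu>) (SO_borel N)"
    using measurable_fst[of \<mu> \<mu>] measurable_snd[of \<mu> \<mu>] by (simp_all only: measurable_haar)
  have "bounded_meas (\<mu> \<Otimes>\<^sub>M \<mu>) (\<lambda>x. f (transpose_mat (snd x) * fst x))"
    by (rule bounded_meas_comp[OF assms]) (intro measurable_SO_mult measurable_SO_transpose S)
  then have "integrable (\<mu> \<Otimes>\<^sub>M \<mu>) (\<lambda>x. f (transpose_mat (snd x) * fst x))"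
    by (rule bounded_meas_integrable[OF P.finite_measure_axioms])
  then have "integrable (\<mu> \<Otimes>\<^sub>M \<mu>) (\<lambda>(A, B). f (transpose_mat B * A))"
    by (simp add: case_prod_unfold)
  from P.Fubini_integral[OF this]
  have "(\<integral>B. \<integral>A. f (transpose_mat B * A) \<partial>\<mu> \<partial>\<mu>) = (\<integral>A. \<integral>B. f (transpose_mat B * A) \<partial>\<mu> \<partial>\<mu>)" .
  also have "(\<integral>B. \<integral>A. f (transpose_mat B * A) \<partial>\<mu> \<partial>\<mu>) = (\<integral>B. \<integral>A. f A \<partial>\<mu> \<partial>\<mu>)"
    by (intro Bochner_Integration.integral_cong refl haar_left bounded_meas_measurable[OF assms]) (auto intro: SO_transpose)
  also have "(\<integral>A. \<integral>B. f (transpose_mat B * A) \<partial>\<mu> \<partial>\<mu>) = (\<integral>A. \<integral>B. f (transpose_mat B) \<partial>\<mu> \<partial>\<mu>)"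
  proof (rule Bochner_Integration.integral_cong[OF refl])
    fix A assume "A \<in> space \<mu>"
    then have A: "A \<in> carrier (SO N)" by simp
    have "(\<integral>B. f (transpose_mat B * A) \<partial>\<mu>) = (\<integral>B. f (transpose_mat (transpose_mat A * B)) \<partial>\<mu>)"
    proof (rule Bochner_Integration.integral_cong[OF refl])
      fix B assume "B \<in> space \<mu>"
      then have "transpose_mat (transpose_mat A * B) = transpose_mat B * A"
        using A Matrix.transpose_mult[of "transpose_mat A" N N B N] by (simp add: SO_iff)
      then show "f (transpose_mat B * A) = f (transpose_mat (transpose_mat A * B))" by simp
    qed
    also have "\<dots> = (\<integral>B. f (transpose_mat B) \<partial>\<mu>)"
      using haar_left[OF SO_transpose[OF A], of "\<lambda>B. f (transpose_mat B)"]
        measurable_compose[OF measurable_SO_transpose[OF measurable_ident_sets[OF refl]] bounded_meas_measurable[OF assms]]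
      by blast
    finally show "(\<integral>B. f (transpose_mat B * A) \<partial>\<mu>) = (\<integral>B. f (transpose_mat B) \<partial>\<mu>)" .
  qed
  finally show ?thesis using prob_space by simp
qed

text \<open>Transposition is inversion on SO(N) and preserves the measure, so it turns left
  invariance into right invariance.\<close>

lemma haar_right:
  assumes "A \<in> carrier (SO N)" "bounded_meas (SO_borel N) f"
  shows "(\<integral>B. f (B * A) \<partial>\<mu>) = (\<integral>B. f B \<partial>\<mu>)"
proof -
  have bt: "bounded_meas (SO_borel N) (\<lambda>B. f (transpose_mat B))"
    by (rule bounded_meas_comp[OF assms(2) measurable_SO_transpose[OF measurable_ident_sets[OF refl]]])
  have br: "bounded_meas (SO_borel N) (\<lambda>B. f (B * A))"
    by (intro bounded_meas_comp[OF assms(2)] measurable_SO_mult measurable_const measurable_ident_sets[OF refl])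
       (simp add: assms(1))
  have "(\<integral>B. f (B * A) \<partial>\<mu>) = (\<integral>B. f (transpose_mat B * A) \<partial>\<mu>)"
    by (rule haar_transpose[OF br, symmetric])
  also have "\<dots> = (\<integral>B. f (transpose_mat (transpose_mat A * B)) \<partial>\<mu>)"
  proof (rule Bochner_Integration.integral_cong[OF refl])
    fix B assume "B \<in> space \<mu>"
    then have "transpose_mat (transpose_mat A * B) = transpose_mat B * A"
      using assms(1) Matrix.transpose_mult[of "transpose_mat A" N N B N] by (simp add: SO_iff)
    then show "f (transpose_mat B * A) = f (transpose_mat (transpose_mat A * B))" by simp
  qed
  also have "\<dots> = (\<integral>B. f (transpose_mat B) \<partial>\<mu>)"
    using haar_left[OF SO_transpose[OF assms(1)] bounded_meas_measurable[OF bt]] .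
  also have "\<dots> = (\<integral>B. f B \<partial>\<mu>)" by (rule haar_transpose[OF assms(2)])
  finally show ?thesis .
qed

end

section \<open>Integration over lattice configurations\<close>

context haar_SO
begin

text \<open>In a walk that uses an edge once, the edge variable stands between two fixed group
  elements, transposed or not according to the direction of traversal.\<close>

lemma haar_two_sided:
  assumes "a \<in> carrier (SO N)" "b \<in> carrier (SO N)" "bounded_meas (SO_borel N) h"
  shows "(\<integral>y. h (a * y * b) \<partial>\<mu>) = (\<integral>y. h y \<partial>\<mu>)"
    and "(\<integral>y. h (a * transpose_mat y * b) \<partial>\<mu>) = (\<integral>y. h y \<partial>\<mu>)"
proof -
  have m: "bounded_meas (SO_borel N) (\<lambda>y. h (y * b))" "bounded_meas (SO_borel N) (\<lambda>y. h (a * y * b))"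
    by (intro bounded_meas_comp[OF assms(3)] measurable_SO_mult measurable_const measurable_ident_sets[OF refl];
        simp add: assms)+
  show 1: "(\<integral>y. h (a * y * b) \<partial>\<mu>) = (\<integral>y. h y \<partial>\<mu>)"
    using haar_left[OF assms(1) bounded_meas_measurable[OF m(1)]] haar_right[OF assms(2,3)] by simp
  show "(\<integral>y. h (a * transpose_mat y * b) \<partial>\<mu>) = (\<integral>y. h y \<partial>\<mu>)"
    using haar_transpose[OF m(2)] 1 by simp
qed

end

section \<open>Undirected edges, faces, and the product Haar measure on configurations\<close>

definition pos_edge :: "edge \<Rightarrow> edge" where
  "pos_edge e = (if e \<in> pos_edges then e else rev_edge e)"

lemma pos_edges_rev: "e \<in> edges \<Longrightarrow> rev_edge e \<in> pos_edges \<longleftrightarrow> e \<notin> pos_edges"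
  by (cases rule: edge_cases) (auto simp: pos_edges_def lex_less_def edges_def)

lemma pos_edge_rev [simp]: "e \<in> edges \<Longrightarrow> pos_edge (rev_edge e) = pos_edge e"
  using pos_edges_rev by (auto simp: pos_edge_def)

lemma pos_edge_eq_iff: "e \<in> edges \<Longrightarrow> e' \<in> edges \<Longrightarrow> pos_edge e = pos_edge e' \<longleftrightarrow> e = e' \<or> e = rev_edge e'"
  using pos_edges_rev[of e] pos_edges_rev[of e'] by (auto simp: pos_edge_def) (metis rev_edge_simps(4))

text \<open>The walk is clockwise: lexicographically, the second smallest vertex of a square is the
  upper left one. A face is thus enclosed with winding number 1 by the reversal of this
  walk.\<close>

definition face_walk :: "vertex \<Rightarrow> edge list" where
  "face_walk f = (let (a, b) = f in
     [((a, b), (a, b + 1)), ((a, b + 1), (a + 1, b + 1)), ((a + 1, b + 1), (a + 1, b)), ((a + 1, b), (a, b))])"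

definition face_edges :: "vertex \<Rightarrow> edge set" where
  "face_edges f = pos_edge ` set (face_walk f)"

abbreviation region_edges :: "vertex set \<Rightarrow> edge set" where
  "region_edges D \<equiv> \<Union>f\<in>D. face_edges f"

lemma face_edges_eq: "face_edges (a, b) =
  {((a, b), (a, b + 1)), ((a, b + 1), (a + 1, b + 1)), ((a + 1, b), (a + 1, b + 1)), ((a, b), (a + 1, b))}"
  by (auto simp: face_edges_def face_walk_def pos_edge_def pos_edges_def lex_less_def edges_def)

lemma face_walk_edges: "set (face_walk f) \<subseteq> edges"
  by (cases f) (auto simp: face_walk_def edges_def)

lemma pos_edge_in_face_edges:
  assumes "e \<in> edges" shows "pos_edge e \<in> face_edges f \<longleftrightarrow> f = left_face e \<or> f = right_face e"
  using assms
  by (cases rule: edge_cases; cases f)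
     (auto simp: face_edges_eq pos_edge_def pos_edges_def lex_less_def edges_def left_face_def)

definition rev_walk :: "edge list \<Rightarrow> edge list" where
  "rev_walk es = rev (map rev_edge es)"

locale lattice_SO = haar_SO +
  fixes E :: "edge set"
  assumes finE: "finite E" and posE: "E \<subseteq> pos_edges"
begin

abbreviation "PE \<equiv> PiM E (\<lambda>_. \<mu>)"

sublocale P: product_prob_space "\<lambda>_. \<mu>" E ..

lemma prob_space_PE: "prob_space PE" by (rule P.prob_space_axioms)

abbreviation "J f \<equiv> (\<integral>Q. f Q \<partial>PE)"

definition covered :: "edge list \<Rightarrow> bool" where
  "covered es \<longleftrightarrow> set es \<subseteq> edges \<and> pos_edge ` set es \<subseteq> E"

lemma covered_simps [simp]:
  "covered []" "covered (e # es) \<longleftrightarrow> e \<in> edges \<and> pos_edge e \<in> E \<and> covered es"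
  "covered (as @ bs) \<longleftrightarrow> covered as \<and> covered bs"
  by (auto simp: covered_def)

lemma space_PE: "Q \<in> space PE \<longleftrightarrow> (\<forall>e\<in>E. Q e \<in> carrier (SO N)) \<and> Q \<in> extensional E"
  by (auto simp: space_PiM PiE_def)

lemma space_PE_upd: "Q \<in> space PE \<Longrightarrow> e \<in> E \<Longrightarrow> y \<in> carrier (SO N) \<Longrightarrow> Q(e := y) \<in> space PE"
  by (auto simp: space_PE extensional_def)

lemma bounded_PE_integrable: "bounded_meas PE f \<Longrightarrow> integrable PE f"
  by (rule bounded_meas_integrable[OF prob_space.axioms(1)[OF prob_space_PE]])

lemma edge_val_carrier:
  assumes "Q \<in> space PE" "e \<in> edges" "pos_edge e \<in> E"
  shows "edge_val N Q e = (if e \<in> pos_edges then Q (pos_edge e) else transpose_mat (Q (pos_edge e)))"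
    "edge_val N Q e \<in> carrier (SO N)"
proof -
  have "Q (pos_edge e) \<in> carrier (SO N)" using assms by (auto simp: space_PE)
  then show "edge_val N Q e = (if e \<in> pos_edges then Q (pos_edge e) else transpose_mat (Q (pos_edge e)))"
    "edge_val N Q e \<in> carrier (SO N)"
    by (auto simp: edge_val_def pos_edge_def inv_SO SO_transpose)
qed

lemma edge_val_rev:
  assumes "Q \<in> space PE" "e \<in> edges" "pos_edge e \<in> E"
  shows "edge_val N Q (rev_edge e) = transpose_mat (edge_val N Q e)"
  using edge_val_carrier(1)[OF assms] edge_val_carrier(1)[of Q "rev_edge e"] pos_edges_rev assms by simp

lemma holonomy_simps [simp]:
  "holonomy N Q [] = 1\<^sub>m N" "holonomy N Q (e # es) = edge_val N Q e * holonomy N Q es"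
  by (simp_all add: holonomy_def)

lemma holonomy_carrier: "Q \<in> space PE \<Longrightarrow> covered es \<Longrightarrow> holonomy N Q es \<in> carrier (SO N)"
  by (induction es) (auto simp: SO_one intro: SO_mult edge_val_carrier(2))

lemma holonomy_append:
  assumes "Q \<in> space PE" "covered as" "covered bs"
  shows "holonomy N Q (as @ bs) = holonomy N Q as * holonomy N Q bs"
  using assms(2)
proof (induction as)
  case Nil
  then show ?case using SO_carrier_mat[OF holonomy_carrier[OF assms(1,3)]] by simp
next
  case (Cons e as)
  have "edge_val N Q e \<in> carrier_mat N N" "holonomy N Q as \<in> carrier_mat N N" "holonomy N Q bs \<in> carrier_mat N N"
    using Cons.prems assms by (auto intro!: SO_carrier_mat holonomy_carrier edge_val_carrier(2))
  then show ?case using Cons by (simp add: assoc_mult_mat[of _ N N _ N _ N])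
qed

lemma covered_rev_walk [simp]: "covered (rev_walk es) \<longleftrightarrow> covered es"
  unfolding rev_walk_def by (induction es) (simp_all, metis pos_edge_rev)

lemma holonomy_rev_walk:
  assumes "Q \<in> space PE" "covered es"
  shows "holonomy N Q (rev_walk es) = transpose_mat (holonomy N Q es)"
  using assms(2)
proof (induction es)
  case (Cons e es)
  have c: "covered (rev_walk es)" "covered [rev_edge e]" "e \<in> edges" "pos_edge e \<in> E" using Cons.prems by simp_all
  have m: "edge_val N Q e \<in> carrier_mat N N" "holonomy N Q es \<in> carrier_mat N N"
    using Cons.prems assms by (auto intro!: SO_carrier_mat holonomy_carrier edge_val_carrier(2))
  have "holonomy N Q (rev_walk (e # es)) = holonomy N Q (rev_walk es @ [rev_edge e])"
    by (simp add: rev_walk_def)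
  also have "\<dots> = transpose_mat (holonomy N Q es) * transpose_mat (edge_val N Q e)"
    using Cons m by (simp add: holonomy_append[OF assms(1) c(1,2)] edge_val_rev[OF assms(1) c(3,4)])
  finally show ?case using Matrix.transpose_mult[OF m] by simp
qed (simp add: rev_walk_def)

lemma trace_rotate:
  assumes "Q \<in> space PE" "covered as" "covered bs"
  shows "mat_trace (holonomy N Q (as @ bs)) = mat_trace (holonomy N Q (bs @ as))"
  unfolding holonomy_append[OF assms] holonomy_append[OF assms(1,3,2)]
  by (intro mat_trace_mult_comm[of _ N] SO_carrier_mat holonomy_carrier assms)

lemma trace_rev_walk:
  assumes "Q \<in> space PE" "covered es"
  shows "mat_trace (holonomy N Q (rev_walk es)) = mat_trace (holonomy N Q es)"
  unfolding holonomy_rev_walk[OF assms]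
  by (intro mat_trace_transpose[of _ N] SO_carrier_mat holonomy_carrier assms)

lemma holonomy_backtrack:
  assumes "Q \<in> space PE" "covered es"
  shows "holonomy N Q (es @ rev_walk es) = 1\<^sub>m N" "holonomy N Q (rev_walk es @ es) = 1\<^sub>m N"
  using holonomy_append[OF assms(1), of es "rev_walk es"] holonomy_append[OF assms(1), of "rev_walk es" es] assms
    SO_transpose_left[OF holonomy_carrier[OF assms]] SO_transpose_right[OF holonomy_carrier[OF assms]]
  by (simp_all add: holonomy_rev_walk)

lemma edge_val_upd: "e \<in> edges \<Longrightarrow> pos_edge e \<noteq> c \<Longrightarrow> edge_val N (Q(c := y)) e = edge_val N Q e"
  by (auto simp: edge_val_def pos_edge_def)

lemma holonomy_upd:
  "set es \<subseteq> edges \<Longrightarrow> c \<notin> pos_edge ` set es \<Longrightarrow> holonomy N (Q(c := y)) es = holonomy N Q es"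
proof (induction es)
  case (Cons e es)
  have "edge_val N (Q(c := y)) e = edge_val N Q e" using Cons.prems by (intro edge_val_upd) auto
  moreover have "holonomy N (Q(c := y)) es = holonomy N Q es" using Cons.prems by (intro Cons.IH) auto
  ultimately show ?case by (simp only: holonomy_simps)
qed simp

lemma measurable_holonomy:
  "covered es \<Longrightarrow> (\<lambda>Q. holonomy N Q es) \<in> measurable PE (SO_borel N)"
proof (induction es)
  case Nil
  then show ?case by (simp add: SO_one)
next
  case (Cons e es)
  then have c: "e \<in> edges" "pos_edge e \<in> E" by auto
  have q: "(\<lambda>Q. Q (pos_edge e)) \<in> measurable PE (SO_borel N)"
    using measurable_component_singleton[OF c(2), of "\<lambda>_. \<mu>"] by (simp only: measurable_haar)
  have "(\<lambda>Q. if e \<in> pos_edges then Q (pos_edge e) else transpose_mat (Q (pos_edge e))) \<in> measurable PE (SO_borel N)"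
    using q measurable_SO_transpose[OF q] by (cases "e \<in> pos_edges") simp_all
  then have "(\<lambda>Q. edge_val N Q e) \<in> measurable PE (SO_borel N)"
    by (rule measurable_cong[THEN iffD1, rotated]) (use edge_val_carrier(1)[OF _ c] in auto)
  then show ?case using Cons measurable_SO_mult by simp
qed

lemma bounded_holonomy:
  "bounded_meas (SO_borel N) h \<Longrightarrow> covered es \<Longrightarrow> bounded_meas PE (\<lambda>Q. h (holonomy N Q es))"
  by (rule bounded_meas_comp[OF _ measurable_holonomy])

lemma measurable_update:
  assumes "Q \<in> space PE" "e \<in> E" shows "(\<lambda>y. Q(e := y)) \<in> measurable (SO_borel N) PE"
proof (rule measurable_PiM_single')
  fix c assume "c \<in> E"
  then show "(\<lambda>y. (Q(e := y)) c) \<in> SO_borel N \<rightarrow>\<^sub>M \<mu>"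
    using assms(1) unfolding measurable_haar by (cases "c = e") (auto simp: space_PE)
next
  show "(\<lambda>y. Q(e := y)) \<in> space (SO_borel N) \<rightarrow> (\<Pi>\<^sub>E i\<in>E. space \<mu>)"
    using space_PE_upd[OF assms] unfolding space_PiM space_SO_borel by (rule Pi_I)
qed

text \<open>Fubini with one edge integrated innermost: to compare two integrals it is enough to
  compare the inner ones with all other edges frozen.\<close>

lemma integral_edge_cong:
  assumes "e \<in> E" "bounded_meas PE f" "bounded_meas PE g"
    and eq: "\<And>Q. Q \<in> space PE \<Longrightarrow> (\<integral>y. f (Q(e := y)) \<partial>\<mu>) = (\<integral>y. g (Q(e := y)) \<partial>\<mu>)"
  shows "J f = J g"
proof -
  have E: "insert e (E - {e}) = E" using assms(1) by auto
  have *: "J h = (\<integral>Q. \<integral>y. h (Q(e := y)) \<partial>\<mu> \<partial>PiM (E - {e}) (\<lambda>_. \<mu>))" if "bounded_meas PE h" for h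
    using P.product_integral_insert[of "E - {e}" e h] bounded_PE_integrable[OF that] finE unfolding E by auto
  show ?thesis unfolding *[OF assms(2)] *[OF assms(3)]
  proof (rule Bochner_Integration.integral_cong[OF refl])
    fix Q assume Q: "Q \<in> space (PiM (E - {e}) (\<lambda>_. \<mu>))"
    \<comment> \<open>The outer variable carries no group element at \<open>e\<close>; the identity
      is a placeholder that \<open>y\<close> overwrites.\<close>
    then have "Q(e := 1\<^sub>m N) \<in> space PE"
      using assms(1) SO_one by (auto simp: space_PiM PiE_def extensional_def)
    from eq[OF this] show "(\<integral>y. f (Q(e := y)) \<partial>\<mu>) = (\<integral>y. g (Q(e := y)) \<partial>\<mu>)" by simp
  qed
qed

lemma integral_single_edge:
  assumes "covered (as @ e # bs)" "pos_edge e \<notin> pos_edge ` (set as \<union> set bs)" "bounded_meas (SO_borel N) h"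
    and Q: "Q \<in> space PE"
  shows "(\<integral>y. h (holonomy N (Q(pos_edge e := y)) (as @ e # bs)) \<partial>\<mu>) = (\<integral>y. h y \<partial>\<mu>)"
proof -
  have c: "covered as" "covered bs" "e \<in> edges" "pos_edge e \<in> E" using assms(1) by auto
  let ?a = "holonomy N Q as" and ?b = "holonomy N Q bs"
  have ab: "?a \<in> carrier (SO N)" "?b \<in> carrier (SO N)" using holonomy_carrier[OF Q] c by auto
  have "holonomy N (Q(pos_edge e := y)) (as @ e # bs) = ?a * (if e \<in> pos_edges then y else transpose_mat y) * ?b"
    if y: "y \<in> carrier (SO N)" for y
  proof -
    have Qy: "Q(pos_edge e := y) \<in> space PE" using space_PE_upd[OF Q c(4) y] .
    have "holonomy N (Q(pos_edge e := y)) (as @ e # bs) =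
        holonomy N (Q(pos_edge e := y)) as * (edge_val N (Q(pos_edge e := y)) e * holonomy N (Q(pos_edge e := y)) bs)"
      using holonomy_append[OF Qy, of as "e # bs"] assms(1) by simp
    also have "holonomy N (Q(pos_edge e := y)) as = ?a"
      using c assms(2) by (intro holonomy_upd) (auto simp: covered_def)
    also have "holonomy N (Q(pos_edge e := y)) bs = ?b"
      using c assms(2) by (intro holonomy_upd) (auto simp: covered_def)
    also have "edge_val N (Q(pos_edge e := y)) e = (if e \<in> pos_edges then y else transpose_mat y)"
      using edge_val_carrier(1)[OF Qy c(3,4)] by simp
    finally have eq: "holonomy N (Q(pos_edge e := y)) (as @ e # bs) =
        ?a * ((if e \<in> pos_edges then y else transpose_mat y) * ?b)" .
    show ?thesis unfolding eq using ab[THEN SO_carrier_mat] SO_carrier_mat[OF y]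
      by (intro assoc_mult_mat[of _ N N _ N _ N, symmetric]) auto
  qed
  then have "(\<integral>y. h (holonomy N (Q(pos_edge e := y)) (as @ e # bs)) \<partial>\<mu>) =
      (\<integral>y. h (?a * (if e \<in> pos_edges then y else transpose_mat y) * ?b) \<partial>\<mu>)"
    by (intro Bochner_Integration.integral_cong refl) simp
  also have "\<dots> = (\<integral>y. h y \<partial>\<mu>)"
    using haar_two_sided[OF ab assms(3)] by (cases "e \<in> pos_edges") simp_all
  finally show ?thesis .
qed

text \<open>Independence as a function, at every configuration, rather than in the probabilistic
  sense: such a factor can be pulled out of an inner integral pointwise.\<close>

definition indep_of :: "edge set \<Rightarrow> ((edge \<Rightarrow> real mat) \<Rightarrow> real) \<Rightarrow> bool" where
  "indep_of K F \<longleftrightarrow> (\<forall>Q. \<forall>e\<in>K. \<forall>y. F (Q(e := y)) = F Q)"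

lemma indep_ofD: "indep_of K F \<Longrightarrow> e \<in> K \<Longrightarrow> F (Q(e := y)) = F Q"
  by (auto simp: indep_of_def)

lemma indep_of_mono: "indep_of K F \<Longrightarrow> K' \<subseteq> K \<Longrightarrow> indep_of K' F"
  by (auto simp: indep_of_def)

lemma indep_of_mult: "indep_of K F \<Longrightarrow> indep_of K G \<Longrightarrow> indep_of K (\<lambda>Q. F Q * G Q)"
  by (auto simp: indep_of_def)

lemma indep_of_prod: "(\<And>i. i \<in> I \<Longrightarrow> indep_of K (F i)) \<Longrightarrow> indep_of K (\<lambda>Q. \<Prod>i\<in>I. F i Q)"
  by (auto simp: indep_of_def intro!: prod.cong)

lemma indep_of_holonomy:
  "set es \<subseteq> edges \<Longrightarrow> K \<inter> pos_edge ` set es = {} \<Longrightarrow> indep_of K (\<lambda>Q. h (holonomy N Q es))"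
  unfolding indep_of_def by (metis disjoint_iff holonomy_upd)

subsection \<open>Gauge transformations\<close>

text \<open>A gauge transformation at the single vertex \<open>u\<close> that acts on the edges of
  \<open>K\<close> only. The restriction lets one piece of a split loop be rotated about the common
  vertex while everything on other edges stays fixed.\<close>

definition gauge :: "vertex \<Rightarrow> real mat \<Rightarrow> edge set \<Rightarrow> (edge \<Rightarrow> real mat) \<Rightarrow> edge \<Rightarrow> real mat" where
  "gauge u g K Q e = (if e \<in> K then
     (if fst e = u then g else 1\<^sub>m N) * Q e * transpose_mat (if snd e = u then g else 1\<^sub>m N) else Q e)"

lemma gauge_space:
  assumes "g \<in> carrier (SO N)" "K \<subseteq> E" "Q \<in> space PE"
  shows "gauge u g K Q \<in> space PE"
  using assms by (auto simp: space_PE gauge_def extensional_def intro!: SO_mult SO_transpose SO_one)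

lemma measurable_gauge:
  assumes "g \<in> carrier (SO N)" "K \<subseteq> E"
  shows "gauge u g K \<in> measurable PE PE"
proof -
  have "(\<lambda>Q e. gauge u g K Q e) \<in> measurable PE PE"
  proof (rule measurable_PiM_single')
    fix e assume e: "e \<in> E"
    have q: "(\<lambda>Q. Q e) \<in> measurable PE (SO_borel N)"
      using measurable_component_singleton[OF e, of "\<lambda>_. \<mu>"] by (simp only: measurable_haar)
    have "(\<lambda>Q. gauge u g K Q e) \<in> measurable PE (SO_borel N)"
      unfolding gauge_def using assms(1) SO_one
      by (cases "e \<in> K") (simp_all add: q measurable_SO_mult SO_transpose)
    then show "(\<lambda>Q. gauge u g K Q e) \<in> measurable PE \<mu>" by (simp only: measurable_haar)
  qed (use gauge_space[OF assms] in \<open>auto simp: space_PiM\<close>)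
  then show ?thesis .
qed

text \<open>The edges of \<open>K\<close> are transformed one at a time, each by a left and a right
  translation of its own Haar variable.\<close>

lemma integral_gauge:
  assumes "g \<in> carrier (SO N)" "K \<subseteq> E" "bounded_meas PE f"
  shows "J (\<lambda>Q. f (gauge u g K Q)) = J f"
proof -
  have "finite K" using assms(2) finE finite_subset by blast
  then show ?thesis using assms(2)
  proof (induction K)
    case empty
    then show ?case by (simp add: gauge_def)
  next
    case (insert e K)
    let ?a = "if fst e = u then g else 1\<^sub>m N" and ?b = "transpose_mat (if snd e = u then g else 1\<^sub>m N)"
    have ab: "?a \<in> carrier (SO N)" "?b \<in> carrier (SO N)" using assms(1) SO_one SO_transpose by auto
    have K: "K \<subseteq> E" "e \<in> E" using insert by auto
    have m: "bounded_meas PE (\<lambda>Q. f (gauge u g K Q))"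
      by (rule bounded_meas_comp[OF assms(3) measurable_gauge[OF assms(1) K(1)]])
    have m': "bounded_meas PE (\<lambda>Q. f (gauge u g (insert e K) Q))"
      by (rule bounded_meas_comp[OF assms(3) measurable_gauge[OF assms(1) insert.prems]])
    have ins: "gauge u g (insert e K) (Q(e := y)) = gauge u g K (Q(e := ?a * y * ?b))" for Q y
      using insert.hyps by (auto simp: gauge_def)
    have "J (\<lambda>Q. f (gauge u g (insert e K) Q)) = J (\<lambda>Q. f (gauge u g K Q))"
    proof (rule integral_edge_cong[OF K(2) m' m])
      fix Q assume Q: "Q \<in> space PE"
      from haar_two_sided(1)[OF ab bounded_meas_comp[OF m measurable_update[OF Q K(2)]]]
      show "(\<integral>y. f (gauge u g (insert e K) (Q(e := y))) \<partial>\<mu>) = (\<integral>y. f (gauge u g K (Q(e := y))) \<partial>\<mu>)"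
        unfolding ins .
    qed
    then show ?case using insert K by simp
  qed
qed

text \<open>The factors at interior vertices cancel between consecutive edges; those at the two ends
  of the path survive.\<close>

lemma holonomy_gauge:
  assumes g: "g \<in> carrier (SO N)" and K: "K \<subseteq> E" and Q: "Q \<in> space PE"
  shows "edge_path x es y \<Longrightarrow> pos_edge ` set es \<subseteq> K \<Longrightarrow> holonomy N (gauge u g K Q) es =
    (if x = u then g else 1\<^sub>m N) * holonomy N Q es * transpose_mat (if y = u then g else 1\<^sub>m N)"
proof (induction es arbitrary: x)
  case Nil
  then show ?case using g by (auto simp: SO_iff SO_transpose_right[OF g])
next
  case (Cons e es)
  define L where "L v = (if v = u then g else 1\<^sub>m N)" for v
  have Lc: "L v \<in> carrier (SO N)" for v using g SO_one by (simp add: L_def)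
  have e: "e \<in> edges" "pos_edge e \<in> K" "fst e = x" and p: "edge_path (snd e) es y" "pos_edge ` set es \<subseteq> K"
    using Cons.prems by auto
  have cov: "covered es" using p K edge_path_edges[OF p(1)] by (auto simp: covered_def)
  note Qg = gauge_space[OF g K Q, of u]
  have eE: "pos_edge e \<in> E" using e K by auto
  have ev: "edge_val N Q e \<in> carrier (SO N)" by (rule edge_val_carrier(2)[OF Q e(1) eE])
  have hc: "holonomy N Q es \<in> carrier (SO N)" by (rule holonomy_carrier[OF Q cov])
  have Qc: "Q (pos_edge e) \<in> carrier (SO N)" using Q eE by (simp add: space_PE)
  have "edge_val N (gauge u g K Q) e = L x * edge_val N Q e * transpose_mat (L (snd e))"
  proof (cases "e \<in> pos_edges")
    case True
    then show ?thesis using edge_val_carrier(1)[OF Qg e(1) eE] edge_val_carrier(1)[OF Q e(1) eE] e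
      by (simp add: gauge_def L_def pos_edge_def)
  next
    case False
    have pe: "pos_edge e = rev_edge e" using False by (simp add: pos_edge_def)
    have A: "L (snd e) * Q (rev_edge e) \<in> carrier_mat N N" "transpose_mat (L x) \<in> carrier_mat N N"
      "L (snd e) \<in> carrier_mat N N" "Q (rev_edge e) \<in> carrier_mat N N" "L x \<in> carrier_mat N N"
      using Lc[of "snd e"] Lc[of x] Qc unfolding pe by (auto dest!: SO_carrier_mat intro!: mult_carrier_mat)
    have "edge_val N (gauge u g K Q) e = transpose_mat (L (snd e) * Q (rev_edge e) * transpose_mat (L x))"
      using edge_val_carrier(1)[OF Qg e(1) eE] False e pe by (simp add: gauge_def L_def)
    also have "\<dots> = L x * (transpose_mat (Q (rev_edge e)) * transpose_mat (L (snd e)))"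
      unfolding Matrix.transpose_mult[OF A(1,2)] Matrix.transpose_mult[OF A(3,4)] by simp
    also have "\<dots> = L x * edge_val N Q e * transpose_mat (L (snd e))"
      using edge_val_carrier(1)[OF Q e(1) eE] False pe A by (simp add: assoc_mult_mat[of _ N N _ N _ N])
    finally show ?thesis .
  qed
  then have "holonomy N (gauge u g K Q) (e # es) =
      (L x * edge_val N Q e * transpose_mat (L (snd e))) * (L (snd e) * holonomy N Q es * transpose_mat (L y))"
    using Cons.IH[OF p] by (simp add: L_def)
  also have "\<dots> = L x * edge_val N Q e * (transpose_mat (L (snd e)) * L (snd e)) * (holonomy N Q es * transpose_mat (L y))"
    using Lc[THEN SO_carrier_mat] ev[THEN SO_carrier_mat] hc[THEN SO_carrier_mat]
    by (simp add: assoc_mult_mat[of _ N N _ N _ N] mult_carrier_mat[of _ N N _ N])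
  also have "\<dots> = L x * holonomy N Q (e # es) * transpose_mat (L y)"
    using Lc[THEN SO_carrier_mat] ev[THEN SO_carrier_mat] hc[THEN SO_carrier_mat]
    by (simp add: SO_transpose_left[OF Lc] assoc_mult_mat[of _ N N _ N _ N] mult_carrier_mat[of _ N N _ N])
  finally show ?case by (simp add: L_def)
qed

end

section \<open>Discs and their corners\<close>

text \<open>North then west and east then south are the two ways around a square from its upper
  right to its lower left vertex. The square lies to the left of the first and to the right of the
  second, so trading one for the other cuts it off a region on the left.\<close>

abbreviation (input) north_edge :: "int \<Rightarrow> int \<Rightarrow> edge" where "north_edge a b \<equiv> ((a + 1, b + 1), (a, b + 1))"
abbreviation (input) west_edge :: "int \<Rightarrow> int \<Rightarrow> edge" where "west_edge a b \<equiv> ((a, b + 1), (a, b))"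
abbreviation (input) east_edge :: "int \<Rightarrow> int \<Rightarrow> edge" where "east_edge a b \<equiv> ((a + 1, b + 1), (a + 1, b))"
abbreviation (input) south_edge :: "int \<Rightarrow> int \<Rightarrow> edge" where "south_edge a b \<equiv> ((a + 1, b), (a, b))"

text \<open>A counterclockwise circuit together with the faces it encloses; the back-and-forth
  circuits of length two go with the empty set.\<close>

definition disc :: "edge list \<Rightarrow> vertex set \<Rightarrow> bool" where
  "disc es D \<longleftrightarrow> circuit es \<and> (\<forall>f. wind es f = of_bool (f \<in> D))"

lemma disc_wind: "disc es D \<Longrightarrow> wind es f = of_bool (f \<in> D)"
  unfolding disc_def by blast

lemma discI: "circuit es \<Longrightarrow> (\<And>f. wind es f = of_bool (f \<in> D)) \<Longrightarrow> disc es D"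
  unfolding disc_def by blast

lemma disc_circuit: "disc es D \<Longrightarrow> circuit es" by (simp add: disc_def)

lemma circuit_length_2:
  assumes "circuit es" "length es = 2"
  obtains e where "e \<in> edges" "es = [e, rev_edge e]"
proof -
  obtain e e' where es: "es = [e, e']"
    using assms(2) by (auto simp: numeral_2_eq_2 length_Suc_conv)
  have "e \<in> edges" using circuit_edges[OF assms(1)] es by simp
  moreover have "fst e' = snd e" "snd e' = fst e" using assms(1) es by (simp_all add: circuit_def)
  then have "e' = rev_edge e" by (metis prod.collapse rev_edge_def)
  ultimately have "e \<in> edges" "e' = rev_edge e" .
  then show ?thesis using that es by blast
qed

lemma wind_circuit_length_2:
  assumes "circuit es" "length es = 2" shows "wind es f = 0"
proof -
  obtain e where e: "e \<in> edges" "es = [e, rev_edge e]" using circuit_length_2 assms by metis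
  from e(1) show ?thesis unfolding e(2)
    by (cases rule: edge_cases) (auto simp: crossing_def)
qed

lemma disc_finite: "disc es D \<Longrightarrow> finite D"
  using finite_wind_support[of "fst (hd es)" es] disc_circuit[of es D]
  by (simp add: disc_wind circuit_def)

lemma disc_rotate:
  assumes "disc (as @ bs) D" shows "disc (bs @ as) D"
proof (rule discI)
  show "circuit (bs @ as)" by (rule circuit_rotate[OF disc_circuit[OF assms]])
  show "wind (bs @ as) f = of_bool (f \<in> D)" for f using disc_wind[OF assms, of f] by simp
qed

text \<open>Winding numbers of a disc are 0 or 1, and the one on the right of an edge is one less
  than the one on the left.\<close>

lemma disc_left_faces:
  assumes "disc es D" "length es \<noteq> 2" "e \<in> set es"
  shows "left_face e \<in> D" "right_face e \<notin> D"
proof -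
  note c = disc_circuit[OF assms(1)] and w = disc_wind[OF assms(1)]
  obtain L where L: "L \<in> {0, 1}" "wind es (left_face e) = L \<and> wind es (right_face e) = L - 1"
    using discrete_Jordan[OF c assms(2)] assms(3) by metis
  then have "wind es (left_face e) = 1" "wind es (right_face e) = 0" using w[of "right_face e"] by (auto simp: of_bool_def split: if_splits)
  then show "left_face e \<in> D" "right_face e \<notin> D" using w by simp_all
qed

lemma disc_length_2: "disc es D \<Longrightarrow> length es = 2 \<longleftrightarrow> D = {}"
proof
  assume d: "disc es D" and "length es = 2"
  then have "wind es f = 0" for f using wind_circuit_length_2[OF disc_circuit[OF d]] by blast
  then have "f \<notin> D" for f using disc_wind[OF d, of f] by (simp split: if_splits)
  then show "D = {}" by blast
next
  assume d: "disc es D" and e: "D = {}"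
  have "es \<noteq> []" using disc_circuit[OF d] by (simp add: circuit_def)
  then have "hd es \<in> set es" by simp
  then show "length es = 2" using disc_left_faces(1)[OF d] e by blast
qed

lemma disc_edges:
  assumes "disc es D" "length es \<noteq> 2" shows "pos_edge ` set es \<subseteq> region_edges D"
proof
  fix c assume "c \<in> pos_edge ` set es"
  then obtain e where e: "e \<in> set es" "c = pos_edge e" by auto
  then have "e \<in> edges" using circuit_edges[OF disc_circuit[OF assms(1)]] by auto
  then show "c \<in> region_edges D"
    using disc_left_faces(1)[OF assms e(1)] e(2) pos_edge_in_face_edges by blast
qed

text \<open>The face is the leftmost one in the top row of \<open>D\<close>. Its upper and left
  edges border faces outside \<open>D\<close>, so the circuit uses both, and since only one edge
  leaves their common vertex they are consecutive.\<close>

lemma disc_corner: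
  assumes "disc es D" "D \<noteq> {}"
  obtains a b X as bs where "(a, b) \<in> D" "(a, b + 1) \<notin> D" "es = as @ bs"
    "bs @ as = north_edge a b # west_edge a b # X"
proof -
  note fin = disc_finite[OF assms(1)] and c = disc_circuit[OF assms(1)]
  define b where "b = Max (snd ` D)"
  have b1: "b \<in> snd ` D" "\<And>f. f \<in> D \<Longrightarrow> snd f \<le> b" using fin assms(2) by (auto simp: b_def intro!: Max_in)
  define R where "R = {x. (x, b) \<in> D}"
  have R: "finite R" "R \<noteq> {}"
  proof -
    have "R \<subseteq> fst ` D" by (force simp: R_def)
    then show "finite R" using fin by (rule finite_surj[rotated])
    show "R \<noteq> {}" using b1(1) by (auto simp: R_def)
  qed
  define a where "a = Min R"
  have a: "(a, b) \<in> D" using Min_in[OF R] by (simp add: R_def a_def)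
  have a': "(a - 1, b) \<notin> D" using Min_le[OF R(1), of "a - 1"] by (auto simp: R_def a_def)
  have b': "(a, b + 1) \<notin> D" using b1(2)[of "(a, b + 1)"] by auto
  have p: "edge_path (fst (hd es)) es (fst (hd es))" using c by (simp add: circuit_def)
  note w = disc_wind[OF assms(1)]
  have 1: "north_edge a b \<in> set es"
    using wind_vertical[OF edge_path_edges[OF p], of a b] a b' by (intro flow_pos_imp_mem) (simp add: w)
  have 2: "west_edge a b \<in> set es"
    using wind_horizontal[OF p, of a b] a a' by (intro flow_pos_imp_mem) (simp add: w)
  obtain as bs where ab: "es = as @ north_edge a b # bs" "circuit (north_edge a b # bs @ as)"
    using circuit_rotate_to[OF c 1] by metis
  obtain h X where X: "bs @ as = h # X" "fst h = (a, b + 1)"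
    using ab(2) by (cases "bs @ as") (auto simp: circuit_def)
  have "h \<in> set (north_edge a b # bs @ as)"
    "west_edge a b \<in> set (north_edge a b # bs @ as)"
    using 2 by (simp add: X(1), simp add: ab(1)) blast
  then have "h = west_edge a b" using X(2) circuit_out_unique[OF ab(2)] by simp
  then show ?thesis using that[OF a b' ab(1)] X(1) by simp
qed

context
  fixes a b :: int and D :: "vertex set" and X :: "edge list"
  assumes D: "disc (north_edge a b # west_edge a b # X) D" and p: "(a, b) \<in> D"
begin

lemma corner_edges:
  "{east_edge a b, south_edge a b, ((a, b), (a + 1, b)), ((a + 1, b), (a + 1, b + 1))} \<subseteq> edges"
  by (auto simp: edges_def)

lemma corner_path: "edge_path (a, b) X (a + 1, b + 1)" and corner_X: "set X \<subseteq> edges"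
proof -
  show "edge_path (a, b) X (a + 1, b + 1)" using D by (auto simp: disc_def circuit_def)
  then show "set X \<subseteq> edges" by (rule edge_path_edges)
qed

lemma corner_distinct: "distinct (map fst X)" "(a + 1, b + 1) \<notin> fst ` set X" "(a, b + 1) \<notin> fst ` set X"
  using D by (auto simp: disc_def circuit_def)

text \<open>The two ways around the square differ by its boundary, which winds around this face
  alone.\<close>

lemma corner_wind:
  "wind (east_edge a b # south_edge a b # X) f = of_bool (f \<in> D - {(a, b)})"
proof -
  have "wind (north_edge a b # west_edge a b # X) f = of_bool (f \<in> D)"
    by (rule disc_wind[OF D])
  then show ?thesis using p by (cases f) (auto simp: crossing_def split: if_splits)
qed

lemma corner_length: "length (north_edge a b # west_edge a b # X) \<noteq> 2"
  using disc_length_2[OF D] p by blast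

text \<open>Meeting the edge again in the same direction would revisit its starting vertex; in the
  opposite direction it would be a backtrack, possible only in length two. So this edge variable can
  be averaged out.\<close>

lemma corner_edge_fresh: "pos_edge (north_edge a b) \<notin> pos_edge ` set X"
proof
  let ?e = "north_edge a b" and ?es = "north_edge a b # west_edge a b # X"
  assume "pos_edge ?e \<in> pos_edge ` set X"
  then obtain c where c: "c \<in> set X" "pos_edge c = pos_edge ?e" by auto
  have "?e \<in> edges" "c \<in> edges" using c(1) corner_X by (auto simp: edges_def)
  then have "c = ?e \<or> c = rev_edge ?e" using c(2) pos_edge_eq_iff by metis
  moreover have "c \<noteq> ?e" using corner_distinct(2) c(1) by force
  ultimately have "rev_edge ?e \<in> set ?es" using c(1) by auto
  then show False using circuit_backtrack[OF disc_circuit[OF D], of ?e] corner_length by simp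
qed

lemma corner_disc:
  assumes "(a + 1, b) \<notin> fst ` set X"
  shows "disc (east_edge a b # south_edge a b # X) (D - {(a, b)})"
proof (rule discI; (rule corner_wind circuit_ConsI)?)
  show "edge_path (fst (east_edge a b)) (east_edge a b # south_edge a b # X)
      (fst (east_edge a b))"
    using corner_path corner_edges by simp
  show "distinct (map fst (east_edge a b # south_edge a b # X))"
    using corner_distinct assms by simp
qed

text \<open>The rerouted path meets the lower right vertex (a + 1, b) twice and is cut there. The
  two parts have no other vertex in common, so they cannot traverse an edge in opposite
  directions.\<close>

lemma corner_split:
  assumes "(a + 1, b) \<in> fst ` set X"
  obtains X1 X2 :: "edge list" where "X = X1 @ X2" "circuit (south_edge a b # X1)" "circuit (east_edge a b # X2)"
    "\<And>f. wind (south_edge a b # X1) f + wind (east_edge a b # X2) f = of_bool (f \<in> D - {(a, b)})"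
    "\<And>e. e \<in> set (south_edge a b # X1) \<Longrightarrow> rev_edge e \<notin> set (east_edge a b # X2)"
proof -
  from assms obtain e where e: "(a + 1, b) = fst e" "e \<in> set X" by (rule imageE)
  from split_list[OF e(2)] e(1) obtain X1 X2 where X: "X = X1 @ e # X2" "fst e = (a + 1, b)" by metis
  have path: "edge_path (a, b) X1 (a + 1, b)" "edge_path (a + 1, b) (e # X2) (a + 1, b + 1)"
    using corner_path X by (auto simp: edge_path_append)
  have d: "distinct (map fst X1)" "distinct (map fst (e # X2))" "(a + 1, b) \<notin> fst ` set X1"
     "(a + 1, b + 1) \<notin> fst ` set (e # X2)" "fst ` set X1 \<inter> fst ` set (e # X2) = {}"
    using corner_distinct X by auto
  have 1: "circuit (south_edge a b # X1)"
    using path d corner_edges by (intro circuit_ConsI) auto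
  have 2: "circuit (east_edge a b # e # X2)"
    using path d corner_edges by (intro circuit_ConsI) auto
  have "wind (south_edge a b # X1) f + wind (east_edge a b # e # X2) f = of_bool (f \<in> D - {(a, b)})" for f
    using corner_wind[of f] X by simp
  moreover have "rev_edge c \<notin> set (east_edge a b # e # X2)" if c: "c \<in> set (south_edge a b # X1)" for c
  proof
    assume r: "rev_edge c \<in> set (east_edge a b # e # X2)"
    obtain h X1' where h: "X1 = h # X1'" "fst h = (a, b)" using path(1) by (cases X1) auto
    show False
    proof (cases "c = south_edge a b")
      case True
      then have "((a, b), (a + 1, b)) \<in> set (e # X2)" using r by simp
      then have "(a, b) \<in> fst ` set (e # X2)" by (rule image_eqI[rotated]) simp
      then show False using d(5) h by auto
    next
      case False
      then have cX: "c \<in> set X1" using c by simp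
      show False
      proof (cases "rev_edge c = east_edge a b")
        case True
        then have "fst c = (a + 1, b)" by (metis rev_edge_simps(3) snd_conv)
        then show False using cX d(3) by force
      next
        case False
        then have "rev_edge c \<in> set X" "c \<in> set X" using r cX X by auto
        then show False
          using circuit_backtrack[OF disc_circuit[OF D], of c] corner_length by simp
      qed
    qed
  qed
  ultimately show ?thesis by (rule that[OF X(1) 1 2])
qed

text \<open>The removed square lies to the right of both pieces. Their winding numbers there are
  each 0 or -1 and add up to 0, so both pieces run counterclockwise. An edge between the two regions
  would be traversed by the pieces in opposite directions, against \<open>nr\<close>; hence the
  regions do not even share an edge.\<close>

lemma corner_split_discs:
  assumes c1: "circuit (south_edge a b # X1)" and c2: "circuit (east_edge a b # X2)"
    and w: "\<And>f. wind (south_edge a b # X1) f + wind (east_edge a b # X2) f = of_bool (f \<in> D - {(a, b)})"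
    and nr: "\<And>e. e \<in> set (south_edge a b # X1) \<Longrightarrow> rev_edge e \<notin> set (east_edge a b # X2)"
    and l: "length (south_edge a b # X1) \<noteq> 2" "length (east_edge a b # X2) \<noteq> 2"
  obtains D1 D2 where "disc (south_edge a b # X1) D1" "disc (east_edge a b # X2) D2"
    "D1 \<union> D2 = D - {(a, b)}" "D1 \<inter> D2 = {}" "region_edges D1 \<inter> region_edges D2 = {}"
proof -
  let ?l1 = "south_edge a b # X1" and ?l2 = "east_edge a b # X2"
  obtain L1 where L1: "L1 \<in> {0, 1}" "\<And>e. e \<in> set ?l1 \<Longrightarrow> wind ?l1 (left_face e) = L1 \<and> wind ?l1 (right_face e) = L1 - 1"
    "\<And>f. wind ?l1 f \<in> {L1, L1 - 1}" using discrete_Jordan[OF c1 l(1)] by metis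
  obtain L2 where L2: "L2 \<in> {0, 1}" "\<And>e. e \<in> set ?l2 \<Longrightarrow> wind ?l2 (left_face e) = L2 \<and> wind ?l2 (right_face e) = L2 - 1"
    "\<And>f. wind ?l2 f \<in> {L2, L2 - 1}" using discrete_Jordan[OF c2 l(2)] by metis
  have "wind ?l1 (a, b) = L1 - 1" "wind ?l2 (a, b) = L2 - 1"
    using L1(2)[of "south_edge a b"] L2(2)[of "east_edge a b"] by (auto simp: left_face_def)
  then have L: "L1 = 1" "L2 = 1" using w[of "(a, b)"] L1(1) L2(1) by auto
  define D1 where "D1 = {f. wind ?l1 f = 1}"
  define D2 where "D2 = {f. wind ?l2 f = 1}"
  have w1: "wind ?l1 f = of_bool (f \<in> D1)" for f using L1(3)[of f] L by (auto simp: D1_def)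
  have w2: "wind ?l2 f = of_bool (f \<in> D2)" for f using L2(3)[of f] L by (auto simp: D2_def)
  have sum: "of_bool (f \<in> D1) + of_bool (f \<in> D2) = (of_bool (f \<in> D - {(a, b)}) :: int)" for f
    using w[of f] w1[of f] w2[of f] by presburger
  have un: "D1 \<union> D2 = D - {(a, b)}"
  proof (intro Set.set_eqI)
    fix f show "f \<in> D1 \<union> D2 \<longleftrightarrow> f \<in> D - {(a, b)}" using sum[of f] by (auto split: if_splits simp: of_bool_def)
  qed
  have disj: "D1 \<inter> D2 = {}" using sum by (fastforce simp: of_bool_def split: if_splits)
  have ne: False if "e \<in> edges" "left_face e \<in> D1" "right_face e \<in> D2" for e
  proof -
    have n: "right_face e \<notin> D1" "left_face e \<notin> D2" using that disj by auto
    have "flow ?l1 e = 1" using circuit_wind_left_right[OF c1 that(1)] w1 that n by simp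
    then have 1: "e \<in> set ?l1" by (intro flow_pos_imp_mem) simp
    have "flow ?l2 e = -1" using circuit_wind_left_right[OF c2 that(1)] w2 that n by simp
    then have "rev_edge e \<in> set ?l2" using flow_rev[OF that(1)] by (intro flow_pos_imp_mem) simp
    then show False using nr[OF 1] by simp
  qed
  have "region_edges D1 \<inter> region_edges D2 = {}"
  proof (rule ccontr)
    assume "\<not> ?thesis"
    then obtain c f1 f2 where c: "f1 \<in> D1" "f2 \<in> D2" "c \<in> face_edges f1" "c \<in> face_edges f2" by auto
    from c(3) obtain e where e: "c = pos_edge e" "e \<in> set (face_walk f1)"
      unfolding face_edges_def by (rule imageE)
    from e(2) have eE: "e \<in> edges" using face_walk_edges by (rule rev_subsetD)
    have "f1 \<noteq> f2" using c disj by auto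
    moreover have "f1 = left_face e \<or> f1 = right_face e" "f2 = left_face e \<or> f2 = right_face e"
      using c e(1) pos_edge_in_face_edges[OF eE] by blast+
    ultimately show False using ne[OF eE] ne[of "rev_edge e"] eE c by auto
  qed
  with un disj show ?thesis using that[OF discI[OF c1 w1] discI[OF c2 w2]] by blast
qed

end

text \<open>Suppose no face of \<open>R - D\<close> borders the complement of \<open>R\<close>. Then
  the boundary of \<open>R - D\<close> lies on the circuit, and \<open>enclosed_faces\<close> puts
  \<open>R - D\<close> on one side of each circuit edge. But the top edge of \<open>R\<close> would
  be a circuit edge with \<open>D\<close> on its left and the complement of \<open>R\<close> on its
  right.\<close>

lemma peelable_outer_face:
  assumes "disc es D" "length es \<noteq> 2" "finite R" "D \<subset> R"
  obtains f c where "f \<in> R - D" "c \<in> face_edges f" "\<And>f'. f' \<in> R \<Longrightarrow> c \<in> face_edges f' \<Longrightarrow> f' = f"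
proof -
  note c = disc_circuit[OF assms(1)] and w = disc_wind[OF assms(1)]
  have "\<exists>e\<in>edges. left_face e \<in> R - D \<and> right_face e \<notin> R"
  proof (rule ccontr)
    assume no: "\<not> ?thesis"
    have bd: "e \<in> set es \<or> rev_edge e \<in> set es"
      if "e \<in> edges" "left_face e \<in> R - D" "right_face e \<notin> R - D" for e
    proof -
      have "flow es e \<noteq> 0" using circuit_wind_left_right[OF c that(1)] w no that by auto
      then show ?thesis using flow_notin by blast
    qed
    have fin: "finite (R - D)" "R - D \<noteq> {}" using assms by auto
    obtain e where e: "e \<in> edges" "left_face e \<in> R" "right_face e \<notin> R"
      using finite_faces_boundary[OF assms(3)] assms(4) by blast
    then have "left_face e \<in> D" "right_face e \<notin> D" using no assms(4) by auto
    then have "flow es e = 1" using circuit_wind_left_right[OF c e(1)] w by simp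
    then have "e \<in> set es" by (intro flow_pos_imp_mem) simp
    from enclosed_faces[OF c assms(2) fin bd this] \<open>left_face e \<in> D\<close> e(3) show False by auto
  qed
  then obtain e where e: "e \<in> edges" "left_face e \<in> R - D" "right_face e \<notin> R" by blast
  show ?thesis
    by (rule that[OF e(2), of "pos_edge e"]) (use e pos_edge_in_face_edges in auto)
qed

section \<open>Peeling off plaquettes\<close>

locale lattice_wilson = lattice_SO +
  fixes \<beta> :: real
  assumes N3: "3 \<le> N"
begin

definition weight :: "real mat \<Rightarrow> real" where
  "weight A = exp (real N * \<beta> * mat_trace A)"

definition Z :: real where "Z = (\<integral>A. weight A \<partial>\<mu>)"

definition plaq_mean :: real where "plaq_mean = (\<integral>A. weight A * mat_trace A \<partial>\<mu>) / (real N * Z)"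

lemma bounded_weight: "bounded_meas (SO_borel N) weight"
  unfolding weight_def by (intro bounded_meas_exp bounded_meas_mult bounded_meas_const bounded_meas_trace)

lemma Z_pos: "Z > 0"
proof -
  have "exp (- (real N * \<bar>\<beta>\<bar> * real N)) \<le> weight A" if "A \<in> carrier (SO N)" for A
  proof -
    have "- (real N * \<beta> * mat_trace A) \<le> real N * \<bar>\<beta>\<bar> * \<bar>mat_trace A\<bar>"
      using abs_ge_minus_self[of "real N * \<beta> * mat_trace A"] by (simp add: abs_mult)
    also have "\<dots> \<le> real N * \<bar>\<beta>\<bar> * real N"
      by (intro mult_left_mono SO_trace_bound that) auto
    finally show ?thesis by (simp add: weight_def)
  qed
  then have "exp (- (real N * \<bar>\<beta>\<bar> * real N)) \<le> Z"
    unfolding Z_def by (intro integral_ge_const haar_integrable bounded_weight) auto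
  then show ?thesis using exp_gt_zero less_le_trans by blast
qed

lemma bounded_weight_entry: "i < N \<Longrightarrow> j < N \<Longrightarrow> bounded_meas (SO_borel N) (\<lambda>A. weight A * A $$ (i, j))"
  by (intro bounded_meas_mult bounded_weight bounded_meas_SO_entry)

text \<open>The weight is invariant under conjugation, so the averaged matrix commutes with all
  rotations and is a multiple of the identity; its trace gives the multiple.\<close>

lemma integral_weight_entry:
  assumes ij: "i < N" "j < N"
  shows "(\<integral>A. weight A * A $$ (i, j) \<partial>\<mu>) = (if i = j then plaq_mean * Z else 0)"
proof -
  define M where "M = Matrix.mat N N (\<lambda>(i, j). \<integral>A. weight A * A $$ (i, j) \<partial>\<mu>)"
  have Mc: "M \<in> carrier_mat N N" by (simp add: M_def)
  have "g * M = M * g" if g: "g \<in> carrier (SO N)" for g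
  proof (rule eq_matI)
    have gc: "g \<in> carrier_mat N N" by (rule SO_carrier_mat[OF g])
    fix i j assume "i < dim_row (M * g)" "j < dim_col (M * g)"
    then have ij: "i < N" "j < N" using Mc gc by auto
    have "(g * M) $$ (i, j) = (\<Sum>k<N. g $$ (i, k) * (\<integral>A. weight A * A $$ (k, j) \<partial>\<mu>))"
      using ij by (simp add: index_mult_mat_sum[OF gc Mc] del: index_mult_mat(1)) (simp add: M_def)
    also have "\<dots> = (\<integral>A. (\<Sum>k<N. g $$ (i, k) * (weight A * A $$ (k, j))) \<partial>\<mu>)"
      using ij by (subst Bochner_Integration.integral_sum) (auto intro!: haar_integrable bounded_weight_entry)
    also have "\<dots> = (\<integral>A. weight A * (g * A) $$ (i, j) \<partial>\<mu>)"
      using ij by (intro Bochner_Integration.integral_cong refl)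
        (simp add: index_mult_mat_sum[OF gc SO_carrier_mat] sum_distrib_left mult_ac del: index_mult_mat(1))
    \<comment> \<open>Write g A as (g A g^T) g. Substituting A for g A g^T then moves g from the
      left to the right.\<close>
    also have "\<dots> = (\<integral>A. weight (g * A * transpose_mat g) * (g * A * transpose_mat g * g) $$ (i, j) \<partial>\<mu>)"
    proof (intro Bochner_Integration.integral_cong refl)
      fix A assume "A \<in> space \<mu>"
      then have A: "A \<in> carrier_mat N N" by (simp add: SO_carrier_mat)
      have "g * A * transpose_mat g * g = g * A"
        using A gc by (simp add: assoc_mult_mat[of _ N N _ N _ N] SO_transpose_left[OF g])
      moreover have "mat_trace (g * A * transpose_mat g) = mat_trace (transpose_mat g * (g * A))"
        using A gc by (intro mat_trace_mult_comm[of _ N]) auto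
      moreover have "transpose_mat g * (g * A) = A"
        using A gc by (simp add: assoc_mult_mat[of _ N N _ N _ N, symmetric] SO_transpose_left[OF g])
      ultimately show "weight A * (g * A) $$ (i, j) =
          weight (g * A * transpose_mat g) * (g * A * transpose_mat g * g) $$ (i, j)"
        by (simp add: weight_def)
    qed
    also have "\<dots> = (\<integral>A. weight A * (A * g) $$ (i, j) \<partial>\<mu>)"
    proof (rule haar_two_sided(1)[OF g SO_transpose[OF g], of "\<lambda>A. weight A * (A * g) $$ (i, j)"])
      show "bounded_meas (SO_borel N) (\<lambda>A. weight A * (A * g) $$ (i, j))"
        using ij by (intro bounded_meas_mult bounded_weight bounded_meas_comp[OF bounded_meas_SO_entry]
            measurable_SO_mult measurable_const measurable_ident_sets[OF refl]) (auto simp: g)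
    qed
    also have "\<dots> = (\<integral>A. (\<Sum>k<N. (weight A * A $$ (i, k)) * g $$ (k, j)) \<partial>\<mu>)"
      using ij by (intro Bochner_Integration.integral_cong refl)
        (simp add: index_mult_mat_sum[OF SO_carrier_mat gc] sum_distrib_left mult_ac del: index_mult_mat(1))
    also have "\<dots> = (\<Sum>k<N. (\<integral>A. weight A * A $$ (i, k) \<partial>\<mu>) * g $$ (k, j))"
      using ij by (subst Bochner_Integration.integral_sum) (auto intro!: haar_integrable bounded_weight_entry)
    also have "\<dots> = (M * g) $$ (i, j)"
      using ij by (simp add: index_mult_mat_sum[OF Mc gc] del: index_mult_mat(1)) (simp add: M_def)
    finally show "(g * M) $$ (i, j) = (M * g) $$ (i, j)" .
  qed (use Mc SO_carrier_mat[OF g] in auto)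
  from SO_commuting_scalar[OF N3 Mc this ij]
  have *: "real N * (\<integral>A. weight A * A $$ (i, j) \<partial>\<mu>) = (if i = j then mat_trace M else 0)"
    using ij by (simp add: M_def)
  have "mat_trace M = (\<integral>A. (\<Sum>k<N. weight A * A $$ (k, k)) \<partial>\<mu>)"
    by (subst Bochner_Integration.integral_sum) (auto simp: mat_trace_def M_def intro!: haar_integrable bounded_weight_entry)
  also have "\<dots> = (\<integral>A. weight A * mat_trace A \<partial>\<mu>)"
    by (intro Bochner_Integration.integral_cong refl) (auto simp: mat_trace_def sum_distrib_left dest!: SO_carrier_mat)
  also have "\<dots> = real N * (plaq_mean * Z)" using Z_pos N3 by (simp add: plaq_mean_def)
  finally show ?thesis using * N3 by (simp split: if_splits)
qed

definition plaq_weight :: "vertex \<Rightarrow> (edge \<Rightarrow> real mat) \<Rightarrow> real" where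
  "plaq_weight f Q = weight (holonomy N Q (face_walk f))"

definition face_weights :: "vertex set \<Rightarrow> (edge \<Rightarrow> real mat) \<Rightarrow> real" where
  "face_weights D Q = (\<Prod>f\<in>D. plaq_weight f Q)"

lemma covered_face_walk: "face_edges f \<subseteq> E \<Longrightarrow> covered (face_walk f)"
  using face_walk_edges by (simp add: covered_def face_edges_def)

lemma bounded_plaq_weight: "face_edges f \<subseteq> E \<Longrightarrow> bounded_meas PE (plaq_weight f)"
  unfolding plaq_weight_def[abs_def] by (intro bounded_holonomy bounded_weight covered_face_walk)

lemma bounded_face_weights: "region_edges D \<subseteq> E \<Longrightarrow> bounded_meas PE (face_weights D)"
  unfolding face_weights_def[abs_def] by (intro bounded_meas_prod bounded_plaq_weight) auto

lemma indep_of_plaq_weight: "K \<inter> face_edges f = {} \<Longrightarrow> indep_of K (plaq_weight f)"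
  unfolding plaq_weight_def[abs_def] face_edges_def by (intro indep_of_holonomy face_walk_edges)

lemma indep_of_face_weights: "K \<inter> region_edges D = {} \<Longrightarrow> indep_of K (face_weights D)"
  unfolding face_weights_def[abs_def] by (intro indep_of_prod indep_of_plaq_weight) auto

lemma face_walk_split:
  assumes "c \<in> face_edges f"
  obtains as e bs where "face_walk f = as @ e # bs" "c = pos_edge e" "c \<notin> pos_edge ` (set as \<union> set bs)"
proof -
  from assms obtain e where e: "c = pos_edge e" "e \<in> set (face_walk f)" unfolding face_edges_def by (rule imageE)
  from split_list[OF e(2)] obtain as bs where ab: "face_walk f = as @ e # bs" by metis
  have "distinct (map pos_edge (face_walk f))"
    by (cases f) (auto simp: face_walk_def pos_edge_def pos_edges_def lex_less_def edges_def)
  then have "c \<notin> pos_edge ` (set as \<union> set bs)" unfolding ab e(1) by auto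
  then show ?thesis using that ab e by blast
qed

text \<open>All other factors are free of the edge \<open>c\<close>, which the plaquette contains
  once; integrating over it makes the plaquette holonomy Haar distributed.\<close>

lemma peel_plaquette:
  assumes f: "face_edges f \<subseteq> E" and c: "c \<in> face_edges f" and h: "bounded_meas (SO_borel N) h"
    and g: "bounded_meas PE g" "indep_of {c} g"
  shows "J (\<lambda>Q. h (holonomy N Q (face_walk f)) * g Q) = (\<integral>A. h A \<partial>\<mu>) * J g"
proof -
  obtain as e bs where w: "face_walk f = as @ e # bs" "c = pos_edge e" "c \<notin> pos_edge ` (set as \<union> set bs)"
    using face_walk_split[OF c] by metis
  have "J (\<lambda>Q. h (holonomy N Q (face_walk f)) * g Q) = J (\<lambda>Q. (\<integral>A. h A \<partial>\<mu>) * g Q)"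
  proof (rule integral_edge_cong)
    show "c \<in> E" using f c by blast
    show "bounded_meas PE (\<lambda>Q. h (holonomy N Q (face_walk f)) * g Q)"
      by (intro bounded_meas_mult bounded_holonomy h g covered_face_walk f)
    show "bounded_meas PE (\<lambda>Q. (\<integral>A. h A \<partial>\<mu>) * g Q)" by (intro bounded_meas_mult bounded_meas_const g)
    fix Q assume Q: "Q \<in> space PE"
    have gc: "g (Q(c := y)) = g Q" for y using indep_ofD[OF g(2) singletonI] .
    have "(\<integral>y. h (holonomy N (Q(c := y)) (face_walk f)) \<partial>\<mu>) = (\<integral>A. h A \<partial>\<mu>)"
      using integral_single_edge[OF _ _ h Q, of as e bs] covered_face_walk[OF f] w by simp
    then show "(\<integral>y. h (holonomy N (Q(c := y)) (face_walk f)) * g (Q(c := y)) \<partial>\<mu>) =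
        (\<integral>y. (\<integral>A. h A \<partial>\<mu>) * g (Q(c := y)) \<partial>\<mu>)"
      unfolding gc using prob_space by simp
  qed
  then show ?thesis by simp
qed

lemma mat_trace_mult:
  "A \<in> carrier_mat N N \<Longrightarrow> B \<in> carrier_mat N N \<Longrightarrow> mat_trace (A * B) = (\<Sum>i<N. \<Sum>j<N. A $$ (i, j) * B $$ (j, i))"
  by (simp add: mat_trace_def index_mult_mat_sum del: index_mult_mat(1))

text \<open>The loop through north and west factors into the boundary of the plaquette, started at
  the north edge, and the loop rerouted through east and south. Only the first factor contains the
  north edge, and its weighted average over that edge is a scalar matrix.\<close>

lemma corner_peel:
  fixes a b :: int and X :: "edge list"
  defines "e \<equiv> north_edge a b"
  defines "R \<equiv> east_edge a b # south_edge a b # X"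
  assumes f: "face_edges (a, b) \<subseteq> E" and X: "covered X" "pos_edge e \<notin> pos_edge ` set X"
    and g: "bounded_meas PE g" "indep_of {pos_edge e} g"
  shows "J (\<lambda>Q. plaq_weight (a, b) Q * (mat_trace (holonomy N Q (e # west_edge a b # X)) * g Q)) =
    plaq_mean * Z * J (\<lambda>Q. mat_trace (holonomy N Q R) * g Q)"
proof -
  define C where "C = [west_edge a b, ((a, b), (a + 1, b)), ((a + 1, b), (a + 1, b + 1))]"
  have edgs: "e \<in> edges" "set C \<subseteq> edges" "east_edge a b \<in> edges" "south_edge a b \<in> edges"
    by (auto simp: e_def C_def edges_def)
  have pe: "pos_edge ` set C = {((a, b), (a, b + 1)), ((a, b), (a + 1, b)), ((a + 1, b), (a + 1, b + 1))}"
    "pos_edge e = ((a, b + 1), (a + 1, b + 1))"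
    "pos_edge (east_edge a b) = ((a + 1, b), (a + 1, b + 1))" "pos_edge (south_edge a b) = ((a, b), (a + 1, b))"
    by (auto simp: C_def e_def pos_edge_def pos_edges_def lex_less_def edges_def)
  have C: "covered (e # C)" and R: "covered R" and eE: "pos_edge e \<in> E"
    using edgs pe f X(1) by (auto simp: covered_def face_edges_eq R_def)
  have fresh: "pos_edge e \<notin> pos_edge ` (set [] \<union> set C)" "pos_edge e \<notin> pos_edge ` set R"
    using X(2) by (auto simp: pe R_def)
  \<comment> \<open>The plaquette runs clockwise and \<open>e # C\<close> counterclockwise; reversal
    transposes the holonomy, which the trace does not see.\<close>
  have trC: "mat_trace (holonomy N Q (face_walk (a, b))) = mat_trace (holonomy N Q (e # C))" if Q: "Q \<in> space PE" for Q
  proof -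
    have cov: "covered (face_walk (a, b))" by (rule covered_face_walk[OF f])
    define as bs where "as = [((a, b), (a + 1, b)), ((a + 1, b), (a + 1, b + 1))]" and "bs = [e, west_edge a b]"
    have ab: "rev_walk (face_walk (a, b)) = as @ bs" "e # C = bs @ as"
      by (simp_all add: rev_walk_def face_walk_def as_def bs_def e_def C_def)
    have "covered as" "covered bs" using C unfolding ab(2) by auto
    then show ?thesis using trace_rev_walk[OF Q cov] trace_rotate[OF Q, of as bs] ab by simp
  qed
  have hol: "holonomy N Q (e # west_edge a b # X) = holonomy N Q (e # C) * holonomy N Q R" if Q: "Q \<in> space PE" for Q
  proof -
    define l where "l = [((a, b), (a + 1, b)), ((a + 1, b), (a + 1, b + 1))]"
    have rl: "rev_walk l = [east_edge a b, south_edge a b]" by (simp add: l_def rev_walk_def)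
    have eq: "e # C = [e, west_edge a b] @ l" "R = rev_walk l @ X" by (simp_all add: C_def R_def l_def rl[unfolded l_def])
    have cv: "covered l" "covered (rev_walk l)" "covered [e, west_edge a b]" using C unfolding eq by auto
    let ?h = "holonomy N Q"
    have "?h (e # C) * ?h R = (?h [e, west_edge a b] * ?h l) * (?h (rev_walk l) * ?h X)"
      unfolding eq holonomy_append[OF Q cv(3,1)] holonomy_append[OF Q cv(2) X(1)] ..
    also have "\<dots> = ?h [e, west_edge a b] * (?h l * ?h (rev_walk l)) * ?h X"
      using cv X(1) by (simp only: assoc_mult_mat[of _ N N _ N _ N] mult_carrier_mat[of _ N N _ N]
            holonomy_carrier[OF Q, THEN SO_carrier_mat])
    also have "?h l * ?h (rev_walk l) = 1\<^sub>m N"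
      using holonomy_append[OF Q cv(1,2)] holonomy_backtrack(1)[OF Q cv(1)] by simp
    also have "?h [e, west_edge a b] * 1\<^sub>m N * ?h X = ?h ([e, west_edge a b] @ X)"
      using holonomy_append[OF Q cv(3) X(1)] right_mult_one_mat[OF SO_carrier_mat[OF holonomy_carrier[OF Q cv(3)]]] by simp
    finally show ?thesis by simp
  qed
  \<comment> \<open>In matrix entries the integrand separates into factors that contain the edge
    variable and factors free of it.\<close>
  define F where "F Q = (\<Sum>i<N. \<Sum>j<N. (weight (holonomy N Q (e # C)) * holonomy N Q (e # C) $$ (i, j)) *
      (holonomy N Q R $$ (j, i) * g Q))" for Q
  have FE: "plaq_weight (a, b) Q * (mat_trace (holonomy N Q (e # west_edge a b # X)) * g Q) = F Q"
    if Q: "Q \<in> space PE" for Q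
  proof -
    have "weight (holonomy N Q (face_walk (a, b))) = weight (holonomy N Q (e # C))"
      using trC[OF Q] by (simp add: weight_def)
    then show ?thesis
      unfolding F_def plaq_weight_def hol[OF Q]
        mat_trace_mult[OF SO_carrier_mat[OF holonomy_carrier[OF Q C]] SO_carrier_mat[OF holonomy_carrier[OF Q R]]]
      by (simp only: sum_distrib_left sum_distrib_right mult_ac)
  qed
  have entry: "bounded_meas PE (\<lambda>Q. weight (holonomy N Q (e # C)) * holonomy N Q (e # C) $$ (i, j))"
    "bounded_meas PE (\<lambda>Q. holonomy N Q R $$ (j, i))" if "i < N" "j < N" for i j
    using bounded_holonomy[OF bounded_weight_entry[OF that] C] bounded_holonomy[OF bounded_meas_SO_entry[OF that(2,1)] R] by simp_all
  have bF: "bounded_meas PE F"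
    unfolding F_def[abs_def] by (intro bounded_meas_sum bounded_meas_mult entry g(1)) auto
  have "J (\<lambda>Q. plaq_weight (a, b) Q * (mat_trace (holonomy N Q (e # west_edge a b # X)) * g Q)) = J F"
    by (intro Bochner_Integration.integral_cong refl FE)
  also have "\<dots> = J (\<lambda>Q. plaq_mean * Z * (mat_trace (holonomy N Q R) * g Q))"
  proof (rule integral_edge_cong[OF eE bF])
    show "bounded_meas PE (\<lambda>Q. plaq_mean * Z * (mat_trace (holonomy N Q R) * g Q))"
      by (intro bounded_meas_mult bounded_meas_const bounded_holonomy bounded_meas_trace R g)
    fix Q assume Q: "Q \<in> space PE"
    have Rc: "holonomy N (Q(pos_edge e := y)) R = holonomy N Q R" for y
      using R fresh by (intro holonomy_upd) (auto simp: covered_def)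
    have gc: "g (Q(pos_edge e := y)) = g Q" for y using indep_ofD[OF g(2)] by simp
    have sing: "(\<integral>y. weight (holonomy N (Q(pos_edge e := y)) (e # C)) * holonomy N (Q(pos_edge e := y)) (e # C) $$ (i, j) \<partial>\<mu>) =
        (if i = j then plaq_mean * Z else 0)" if "i < N" "j < N" for i j
      using integral_single_edge[OF _ _ bounded_weight_entry[OF that] Q, of "[]" e C] C fresh(1)
        integral_weight_entry[OF that] by simp
    have meas: "(\<lambda>y. Q(pos_edge e := y)) \<in> measurable (SO_borel N) PE"
      by (rule measurable_update[OF Q eE])
    have "(\<integral>y. F (Q(pos_edge e := y)) \<partial>\<mu>) = (\<Sum>i<N. \<Sum>j<N.
       (\<integral>y. weight (holonomy N (Q(pos_edge e := y)) (e # C)) * holonomy N (Q(pos_edge e := y)) (e # C) $$ (i, j) \<partial>\<mu>) *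
      (holonomy N Q R $$ (j, i) * g Q))"
      unfolding F_def Rc gc
      by (subst Bochner_Integration.integral_sum, (intro haar_integrable bounded_meas_sum bounded_meas_mult bounded_meas_const
             bounded_meas_comp[OF entry(1) meas]; simp), intro sum.cong refl,
          subst Bochner_Integration.integral_sum, (intro haar_integrable bounded_meas_mult bounded_meas_const
             bounded_meas_comp[OF entry(1) meas]; simp), simp)
    also have "\<dots> = (\<Sum>i<N. \<Sum>j<N. (if i = j then plaq_mean * Z else 0) * (holonomy N Q R $$ (j, i) * g Q))"
      by (intro sum.cong refl) (simp only: sing lessThan_iff)
    also have "\<dots> = (\<Sum>i<N. plaq_mean * Z * (holonomy N Q R $$ (i, i) * g Q))"
      by (intro sum.cong refl) (simp add: if_distrib[of "\<lambda>x. x * _"] cong: if_cong)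
    also have "\<dots> = plaq_mean * Z * (mat_trace (holonomy N Q R) * g Q)"
      using SO_carrier_mat[OF holonomy_carrier[OF Q R]] by (simp add: mat_trace_def sum_distrib_left sum_distrib_right mult_ac)
    also have "\<dots> = (\<integral>y. plaq_mean * Z * (mat_trace (holonomy N (Q(pos_edge e := y)) R) * g (Q(pos_edge e := y))) \<partial>\<mu>)"
      unfolding Rc gc using prob_space by simp
    finally show "(\<integral>y. F (Q(pos_edge e := y)) \<partial>\<mu>) =
      (\<integral>y. plaq_mean * Z * (mat_trace (holonomy N (Q(pos_edge e := y)) R) * g (Q(pos_edge e := y))) \<partial>\<mu>)" .
  qed
  finally show ?thesis by simp
qed

end

section \<open>Averages of closed holonomies over a region, and the disc formula\<close>

lemma index_mult_mat_triple:
  fixes A B C :: "real mat"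
  assumes "A \<in> carrier_mat n n" "B \<in> carrier_mat n n" "C \<in> carrier_mat n n" "i < n" "j < n"
  shows "(A * B * C) $$ (i, j) = (\<Sum>l<n. \<Sum>k<n. A $$ (i, k) * B $$ (k, l) * C $$ (l, j))"
proof -
  have "(A * B * C) $$ (i, j) = (\<Sum>l<n. (A * B) $$ (i, l) * C $$ (l, j))"
    by (rule index_mult_mat_sum) (use assms in auto)
  also have "\<dots> = (\<Sum>l<n. \<Sum>k<n. A $$ (i, k) * B $$ (k, l) * C $$ (l, j))"
    using assms by (intro sum.cong refl)
      (simp add: index_mult_mat_sum[OF assms(1,2)] sum_distrib_right del: index_mult_mat(1))
  finally show ?thesis .
qed

lemma mat_trace_eq: "A \<in> carrier_mat n n \<Longrightarrow> mat_trace A = (\<Sum>i<n. A $$ (i, i))"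
  by (simp add: mat_trace_def)

context lattice_wilson
begin

lemma indep_of_agree:
  assumes "finite K" "indep_of K F" "\<And>e. e \<notin> K \<Longrightarrow> Q e = Q' e"
  shows "F Q = F Q'"
  using assms
proof (induction K arbitrary: Q)
  case empty
  then have "Q = Q'" by blast
  then show ?case by simp
next
  case (insert e K)
  have "F (Q(e := Q' e)) = F Q" using insert.prems(1) by (rule indep_ofD) simp
  moreover have "F (Q(e := Q' e)) = F Q'"
  proof (rule insert.IH)
    show "indep_of K F" using insert.prems(1) by (rule indep_of_mono) blast
    show "(Q(e := Q' e)) c = Q' c" if "c \<notin> K" for c using insert.prems(2)[of c] that by (cases "c = e") auto
  qed
  ultimately show ?case by simp
qed

text \<open>A gauge transformation at the base point \<open>x\<close>, on the edges of the region,
  preserves the face weights and \<open>F\<close> and conjugates the holonomy. The matrix of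
  averaged entries therefore commutes with SO(N) and is scalar. This is what separates two closed
  walks that meet in a vertex.\<close>

lemma integral_closed_walk_entry:
  assumes K: "region_edges D \<subseteq> E" and path: "edge_path x es x"
    and es: "pos_edge ` set es \<subseteq> region_edges D"
    and F: "bounded_meas PE F" "indep_of (region_edges D) F" and ij: "i < N" "j < N"
  shows "real N * J (\<lambda>Q. face_weights D Q * (holonomy N Q es $$ (i, j) * F Q)) =
    (if i = j then J (\<lambda>Q. face_weights D Q * (mat_trace (holonomy N Q es) * F Q)) else 0)"
proof -
  let ?K = "region_edges D"
  have finK: "finite ?K" by (rule finite_subset[OF K finE])
  have cov: "covered es" using es K edge_path_edges[OF path] by (auto simp: covered_def)
  have hc: "holonomy N Q es \<in> carrier_mat N N" if "Q \<in> space PE" for Q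
    by (rule SO_carrier_mat[OF holonomy_carrier[OF that cov]])
  define G where "G i j Q = face_weights D Q * (holonomy N Q es $$ (i, j) * F Q)" for i j Q
  have bG: "bounded_meas PE (G i j)" if "i < N" "j < N" for i j
    unfolding G_def[abs_def]
    by (intro bounded_meas_mult bounded_face_weights K F bounded_holonomy[OF bounded_meas_SO_entry[OF that] cov])
  define M where "M = Matrix.mat N N (\<lambda>(i, j). J (G i j))"
  have Mc: "M \<in> carrier_mat N N" by (simp add: M_def)
  have "g * M = M * g" if g: "g \<in> carrier (SO N)" for g
  proof -
    have gc: "g \<in> carrier_mat N N" "transpose_mat g \<in> carrier_mat N N" using SO_carrier_mat[OF g] by auto
    have W: "face_weights D (gauge x g ?K Q) = face_weights D Q" if Q: "Q \<in> space PE" for Q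
      unfolding face_weights_def
    proof (rule prod.cong[OF refl])
      fix f assume f: "f \<in> D"
      have fE: "covered (face_walk f)" using K f by (intro covered_face_walk) auto
      have p: "edge_path f (face_walk f) f" by (cases f) (auto simp: face_walk_def edges_def)
      let ?L = "if f = x then g else 1\<^sub>m N"
      have L: "?L \<in> carrier (SO N)" using g SO_one by auto
      note Lc = SO_carrier_mat[OF L]
      have H: "holonomy N Q (face_walk f) \<in> carrier_mat N N" by (rule SO_carrier_mat[OF holonomy_carrier[OF Q fE]])
      have "holonomy N (gauge x g ?K Q) (face_walk f) = ?L * holonomy N Q (face_walk f) * transpose_mat ?L"
        using f by (intro holonomy_gauge[OF g K Q p]) (auto simp: face_edges_def)
      moreover have "mat_trace (?L * holonomy N Q (face_walk f) * transpose_mat ?L) =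
          mat_trace (transpose_mat ?L * (?L * holonomy N Q (face_walk f)))"
        by (rule mat_trace_mult_comm[of _ N]) (use Lc H in \<open>auto simp del: if_split\<close>)
      moreover have "transpose_mat ?L * (?L * holonomy N Q (face_walk f)) = holonomy N Q (face_walk f)"
        using Lc H by (subst assoc_mult_mat[of _ N N _ N _ N, symmetric])
          (simp_all add: SO_transpose_left[OF L] del: if_split)
      ultimately show "plaq_weight f (gauge x g ?K Q) = plaq_weight f Q"
        by (simp only: plaq_weight_def weight_def)
    qed
    have FQ: "F (gauge x g ?K Q) = F Q" for Q
      by (rule indep_of_agree[OF finK F(2)]) (simp add: gauge_def)
    have MG: "J (G i j) = (g * M * transpose_mat g) $$ (i, j)" if ij: "i < N" "j < N" for i j
    proof -
      have "J (G i j) = J (\<lambda>Q. G i j (gauge x g ?K Q))"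
        by (rule integral_gauge[OF g K bG[OF ij], symmetric])
      also have "\<dots> = J (\<lambda>Q. \<Sum>l<N. \<Sum>k<N. g $$ (i, k) * transpose_mat g $$ (l, j) * G k l Q)"
      proof (rule Bochner_Integration.integral_cong[OF refl])
        fix Q assume Q: "Q \<in> space PE"
        have "holonomy N (gauge x g ?K Q) es = g * holonomy N Q es * transpose_mat g"
          using holonomy_gauge[OF g K Q path es, of x] by simp
        then have "G i j (gauge x g ?K Q) = face_weights D Q * ((g * holonomy N Q es * transpose_mat g) $$ (i, j) * F Q)"
          unfolding G_def W[OF Q] FQ by simp
        then show "G i j (gauge x g ?K Q) = (\<Sum>l<N. \<Sum>k<N. g $$ (i, k) * transpose_mat g $$ (l, j) * G k l Q)"
          unfolding index_mult_mat_triple[OF gc(1) hc[OF Q] gc(2) ij] G_def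
          by (simp only: sum_distrib_left sum_distrib_right mult_ac)
      qed
      also have "\<dots> = (\<Sum>l<N. J (\<lambda>Q. \<Sum>k<N. g $$ (i, k) * transpose_mat g $$ (l, j) * G k l Q))"
        by (rule Bochner_Integration.integral_sum)
           (intro bounded_PE_integrable bounded_meas_sum bounded_meas_mult bounded_meas_const bG; simp)
      also have "\<dots> = (\<Sum>l<N. \<Sum>k<N. J (\<lambda>Q. g $$ (i, k) * transpose_mat g $$ (l, j) * G k l Q))"
        by (intro sum.cong refl Bochner_Integration.integral_sum)
           (intro bounded_PE_integrable bounded_meas_mult bounded_meas_const bG; simp)
      also have "\<dots> = (\<Sum>l<N. \<Sum>k<N. g $$ (i, k) * M $$ (k, l) * transpose_mat g $$ (l, j))"
        by (intro sum.cong refl) (simp add: M_def mult_ac)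
      also have "\<dots> = (g * M * transpose_mat g) $$ (i, j)"
        by (rule index_mult_mat_triple[OF gc(1) Mc gc(2) ij, symmetric])
      finally show ?thesis .
    qed
    have "M = g * M * transpose_mat g"
    proof (rule eq_matI)
      fix i j assume "i < dim_row (g * M * transpose_mat g)" "j < dim_col (g * M * transpose_mat g)"
      then have "i < N" "j < N" using gc by auto
      then show "M $$ (i, j) = (g * M * transpose_mat g) $$ (i, j)" using MG by (simp add: M_def)
    qed (use gc Mc in auto)
    then have "M * g = g * M * transpose_mat g * g" by simp
    also have "\<dots> = g * M"
      using gc Mc by (simp add: assoc_mult_mat[of _ N N _ N _ N] mult_carrier_mat[of _ N N _ N] SO_transpose_left[OF g])
    finally show ?thesis by simp
  qed
  from SO_commuting_scalar[OF N3 Mc this ij]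
  have *: "real N * J (G i j) = (if i = j then mat_trace M else 0)" using ij by (simp add: M_def)
  have "mat_trace M = (\<Sum>k<N. J (G k k))" by (simp add: mat_trace_def M_def)
  also have "\<dots> = J (\<lambda>Q. \<Sum>k<N. G k k Q)"
    by (rule Bochner_Integration.integral_sum[symmetric]) (intro bounded_PE_integrable bG; simp)
  also have "\<dots> = J (\<lambda>Q. face_weights D Q * (mat_trace (holonomy N Q es) * F Q))"
    by (rule Bochner_Integration.integral_cong[OF refl])
       (simp only: G_def mat_trace_eq[OF hc] sum_distrib_left sum_distrib_right)
  finally show ?thesis using * unfolding G_def by simp
qed

text \<open>The arbitrary \<open>F\<close> makes the induction close: after a split, the holonomy
  entries and weights of the second piece are absorbed into the \<open>F\<close> of the first, and
  the second piece is treated next.\<close>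

theorem integral_disc:
  assumes "disc es D" "region_edges D \<subseteq> E" "covered es"
    and "bounded_meas PE F" "indep_of (region_edges D) F"
  shows "J (\<lambda>Q. face_weights D Q * (mat_trace (holonomy N Q es) * F Q)) = real N * (plaq_mean * Z) ^ card D * J F"
  using assms
proof (induction "card D" arbitrary: es D F rule: less_induct)
  case less
  note disc = \<open>disc es D\<close> and K = \<open>(region_edges D) \<subseteq> E\<close> and cov = \<open>covered es\<close> and F = less.prems(4,5)
  have finD: "finite D" by (rule disc_finite[OF disc])
  show ?case
  proof (cases "D = {}")
    case True
    then have "length es = 2" using disc_length_2[OF disc] by simp
    then obtain e where e: "e \<in> edges" "es = [e, rev_edge e]" using circuit_length_2[OF disc_circuit[OF disc]] by metis
    have "es = [e] @ rev_walk [e]" by (simp add: e rev_walk_def)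
    then have "holonomy N Q es = 1\<^sub>m N" if "Q \<in> space PE" for Q
      using holonomy_backtrack(1)[OF that, of "[e]"] cov e by simp
    then have "J (\<lambda>Q. face_weights D Q * (mat_trace (holonomy N Q es) * F Q)) = J (\<lambda>Q. real N * F Q)"
      by (intro Bochner_Integration.integral_cong refl) (simp add: True face_weights_def)
    then show ?thesis using True by simp
  next
    case False
    obtain a b X as bs where c: "(a, b) \<in> D" "(a, b + 1) \<notin> D" "es = as @ bs"
      "bs @ as = north_edge a b # west_edge a b # X"
      by (rule disc_corner[OF disc False])
    define e v where "e = north_edge a b" and "v = west_edge a b"
    define r d where "r = east_edge a b" and "d = south_edge a b"
    define D' where "D' = D - {(a, b)}"
    have D: "D = insert (a, b) D'" "(a, b) \<notin> D'" "finite D'" "card D = Suc (card D')"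
      unfolding D'_def using c(1) finD by (blast, blast, blast, simp only: card.remove)
    have ba: "bs @ as = e # v # X" unfolding e_def v_def by (rule c(4))
    have disc': "disc (e # v # X) D" using disc_rotate[of as bs D] disc unfolding c(3) ba by blast
    have covX: "covered X" "covered as" "covered bs"
      using cov arg_cong[OF ba, of covered] unfolding c(3) covered_simps by blast+
    have KD': "region_edges D' \<subseteq> E" and fE: "face_edges (a, b) \<subseteq> E" using K D(1) by auto
    have covrd: "covered [r]" "covered [d]"
      using fE unfolding face_edges_eq
      by (auto simp: r_def d_def edges_def pos_edge_def pos_edges_def lex_less_def)
    have pe: "pos_edge e \<in> face_edges (a, b)"
      by (auto simp: face_edges_eq e_def edges_def pos_edge_def pos_edges_def lex_less_def)
    have pe': "pos_edge e \<notin> face_edges f" if "f \<in> D'" for f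
    proof -
      have "e \<in> edges" "left_face e = (a, b)" "right_face e = (a, b + 1)" by (auto simp: e_def edges_def left_face_def)
      then show ?thesis using pos_edge_in_face_edges that c(2) D by auto
    qed
    have F': "indep_of (region_edges D') F" "indep_of {pos_edge e} F"
      using F(2) by (rule indep_of_mono; use D(1) pe in auto)+
    define g where "g Q = face_weights D' Q * F Q" for Q
    have bg: "bounded_meas PE g" "indep_of {pos_edge e} g"
      unfolding g_def[abs_def] using pe'
      by (intro bounded_meas_mult bounded_face_weights KD' F indep_of_mult indep_of_face_weights F'; auto)+
    let ?t = "\<lambda>l Q. mat_trace (holonomy N Q l)"
    have "J (\<lambda>Q. face_weights D Q * (?t es Q * F Q)) = J (\<lambda>Q. plaq_weight (a, b) Q * (?t (e # v # X) Q * g Q))"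
    proof (rule Bochner_Integration.integral_cong[OF refl])
      fix Q assume Q: "Q \<in> space PE"
      have "?t es Q = ?t (e # v # X) Q"
        using trace_rotate[OF Q covX(2,3)] unfolding c(3) ba .
      then show "face_weights D Q * (?t es Q * F Q) = plaq_weight (a, b) Q * (?t (e # v # X) Q * g Q)"
        unfolding g_def face_weights_def D(1) prod.insert[OF D(3,2)] by simp
    qed
    also have "\<dots> = plaq_mean * Z * J (\<lambda>Q. ?t (r # d # X) Q * g Q)"
      by (rule corner_peel[OF fE covX(1), folded e_def v_def r_def d_def, OF _ bg])
         (rule corner_edge_fresh[OF disc'[unfolded e_def v_def] c(1), folded e_def])
    also have "J (\<lambda>Q. ?t (r # d # X) Q * g Q) = J (\<lambda>Q. face_weights D' Q * (?t (r # d # X) Q * F Q))"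
      by (simp add: g_def mult_ac)
    also have "\<dots> = real N * (plaq_mean * Z) ^ card D' * J F"
    \<comment> \<open>Whether the remaining loop already visits the lower right vertex decides if
      the rerouted loop is still a circuit.\<close>
    proof (cases "(a + 1, b) \<in> fst ` set X")
      case False
      then have "disc (r # d # X) D'"
        unfolding r_def d_def D'_def by (rule corner_disc[OF disc'[unfolded e_def v_def] c(1)])
      then show ?thesis
        using less.hyps[of D' "r # d # X" F] D KD' covrd covX F F' by simp
    next
      case True
      obtain X1 X2 where X: "X = X1 @ X2" "circuit (d # X1)" "circuit (r # X2)"
        "\<And>f. wind (d # X1) f + wind (r # X2) f = of_bool (f \<in> D')"
        "\<And>e. e \<in> set (d # X1) \<Longrightarrow> rev_edge e \<notin> set (r # X2)"
      proof (rule corner_split[OF disc'[unfolded e_def v_def] c(1) True, folded r_def d_def D'_def])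
        fix X1 X2
        assume "X = X1 @ X2" "circuit (d # X1)" "circuit (r # X2)"
          and "\<And>f. wind (d # X1) f + wind (r # X2) f = of_bool (f \<in> D')"
          and "\<And>e. e \<in> set (d # X1) \<Longrightarrow> rev_edge e \<notin> set (r # X2)"
        then show thesis by (rule that)
      qed
      have covs: "covered (d # X1)" "covered (r # X2)" "covered X1" "covered X2" "covered (X2 @ [r])"
        using covrd covX X(1) by auto
      have deg: "holonomy N Q l = 1\<^sub>m N" if l: "circuit l" "length l = 2" "covered l" and Q: "Q \<in> space PE" for l Q
      proof -
        obtain e where e: "e \<in> edges" "l = [e, rev_edge e]" using circuit_length_2[OF l(1,2)] by metis
        then have "l = [e] @ rev_walk [e]" by (simp add: rev_walk_def)
        then show ?thesis using holonomy_backtrack(1)[OF Q, of "[e]"] l(3) e by simp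
      qed
      \<comment> \<open>Rotating \<open>r\<close> to the end bases both pieces at their common
        vertex (a + 1, b).\<close>
      have tr: "?t (r # d # X) Q = mat_trace (holonomy N Q (d # X1) * holonomy N Q (X2 @ [r]))" if Q: "Q \<in> space PE" for Q
        using trace_rotate[OF Q, of "[r]" "d # X"] covs covrd X(1) covX holonomy_append[OF Q covs(1,5)] by simp
      have tr2: "?t (X2 @ [r]) Q = ?t (r # X2) Q" if Q: "Q \<in> space PE" for Q
        using trace_rotate[OF Q, of X2 "[r]"] covs covrd by simp
      note hc = holonomy_carrier[THEN SO_carrier_mat]
      \<comment> \<open>A piece of length two runs back and forth along one edge: its holonomy is
        trivial, and the other piece encloses all of \<open>D'\<close>.\<close>
      consider "length (d # X1) = 2" | "length (d # X1) \<noteq> 2" "length (r # X2) = 2" | "length (d # X1) \<noteq> 2" "length (r # X2) \<noteq> 2"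
        by blast
      then show ?thesis
      proof cases
        case 1
        have "disc (r # X2) D'"
          using X(4) wind_circuit_length_2[OF X(2) 1] by (intro discI X(3)) simp
        moreover have "?t (r # d # X) Q = ?t (r # X2) Q" if Q: "Q \<in> space PE" for Q
          using tr[OF Q] tr2[OF Q] deg[OF X(2) 1 covs(1) Q] left_mult_one_mat[OF hc[OF Q covs(5)]] by simp
        then have "J (\<lambda>Q. face_weights D' Q * (?t (r # d # X) Q * F Q)) = J (\<lambda>Q. face_weights D' Q * (?t (r # X2) Q * F Q))"
          by (intro Bochner_Integration.integral_cong refl) simp
        ultimately show ?thesis using less.hyps[of D' "r # X2" F] D KD' covs F F' by simp
      next
        case 2
        have "disc (d # X1) D'"
          using X(4) wind_circuit_length_2[OF X(3) 2(2)] by (intro discI X(2)) simp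
        moreover have "?t (r # d # X) Q = ?t (d # X1) Q" if Q: "Q \<in> space PE" for Q
        proof -
          have "circuit (X2 @ [r])" using circuit_rotate[of "[r]" X2] X(3) by simp
          then have "holonomy N Q (X2 @ [r]) = 1\<^sub>m N" using deg[of "X2 @ [r]" Q] 2(2) covs(5) Q by simp
          then show ?thesis using tr[OF Q] right_mult_one_mat[OF hc[OF Q covs(1)]] by simp
        qed
        then have "J (\<lambda>Q. face_weights D' Q * (?t (r # d # X) Q * F Q)) = J (\<lambda>Q. face_weights D' Q * (?t (d # X1) Q * F Q))"
          by (intro Bochner_Integration.integral_cong refl) simp
        ultimately show ?thesis using less.hyps[of D' "d # X1" F] D KD' covs F F' by simp
      next
        case 3
        obtain D1 D2 where discs: "disc (d # X1) D1" "disc (r # X2) D2" "D1 \<union> D2 = D'" "D1 \<inter> D2 = {}"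
          "region_edges D1 \<inter> region_edges D2 = {}"
          by (rule corner_split_discs[OF disc'[unfolded e_def v_def] c(1), folded r_def d_def D'_def, OF X(2-5) 3])
        have fin: "finite D1" "finite D2" using disc_finite discs by auto
        have KD: "region_edges D1 \<subseteq> E" "region_edges D2 \<subseteq> E" using KD' discs(3) by blast+
        have card: "card D' = card D1 + card D2" using card_Un_disjoint[OF fin discs(4)] discs(3) by simp
        have lt: "card D1 < card D" "card D2 < card D" using card D(4) by simp_all
        have disc2: "disc (X2 @ [r]) D2" using disc_rotate[of "[r]" X2 D2] discs(2) by simp
        have edges1: "pos_edge ` set (d # X1) \<subseteq> region_edges D1" by (rule disc_edges[OF discs(1) 3(1)])
        have edges2: "pos_edge ` set (X2 @ [r]) \<subseteq> region_edges D2" using disc_edges[OF disc2] 3(2) by simp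
        have F12: "indep_of (region_edges D1) F" "indep_of (region_edges D2) F"
          using F'(1) by (rule indep_of_mono; use discs(3) in blast)+
        have path1: "edge_path (a + 1, b) (d # X1) (a + 1, b)" using X(2) by (simp add: circuit_def d_def)
        \<comment> \<open>Everything that belongs to the second piece, with the entry indices
          transposed as the trace of a product requires.\<close>
        define G where "G i j Q = face_weights D2 Q * (holonomy N Q (X2 @ [r]) $$ (j, i) * F Q)" for i j Q
        have bG: "bounded_meas PE (G i j)" if "i < N" "j < N" for i j
          unfolding G_def[abs_def]
          by (intro bounded_meas_mult bounded_face_weights KD F bounded_holonomy[OF bounded_meas_SO_entry[OF that(2,1)] covs(5)])
        have dis: "region_edges D1 \<inter> pos_edge ` set (X2 @ [r]) = {}" using discs(5) edges2 by blast
        have ed: "set (X2 @ [r]) \<subseteq> edges" using covs(5) unfolding covered_def by blast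
        have iG: "indep_of (region_edges D1) (G i j)" for i j
          unfolding G_def[abs_def]
          by (intro indep_of_mult indep_of_face_weights F12 indep_of_holonomy[where h = "\<lambda>A. A $$ (j, i)"] ed dis discs(5))
        have bH: "bounded_meas PE (\<lambda>Q. face_weights D1 Q * (holonomy N Q (d # X1) $$ (i, j) * G i j Q))"
          if "i < N" "j < N" for i j
          by (intro bounded_meas_mult bounded_face_weights KD bG that
              bounded_holonomy[OF bounded_meas_SO_entry[OF that] covs(1)])
        have "J (\<lambda>Q. face_weights D' Q * (?t (r # d # X) Q * F Q)) =
          J (\<lambda>Q. \<Sum>i<N. \<Sum>j<N. face_weights D1 Q * (holonomy N Q (d # X1) $$ (i, j) * G i j Q))"
        proof (rule Bochner_Integration.integral_cong[OF refl])
          fix Q assume Q: "Q \<in> space PE"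
          have "face_weights D' Q = face_weights D1 Q * face_weights D2 Q"
            unfolding face_weights_def discs(3)[symmetric] by (rule prod.union_disjoint[OF fin discs(4)])
          then show "face_weights D' Q * (?t (r # d # X) Q * F Q) =
              (\<Sum>i<N. \<Sum>j<N. face_weights D1 Q * (holonomy N Q (d # X1) $$ (i, j) * G i j Q))"
            unfolding tr[OF Q] mat_trace_mult[OF hc[OF Q covs(1)] hc[OF Q covs(5)]] G_def
            by (simp only: sum_distrib_left sum_distrib_right mult_ac)
        qed
        also have "\<dots> = (\<Sum>i<N. J (\<lambda>Q. \<Sum>j<N. face_weights D1 Q * (holonomy N Q (d # X1) $$ (i, j) * G i j Q)))"
          by (rule Bochner_Integration.integral_sum) (intro bounded_PE_integrable bounded_meas_sum bH; simp)
        also have "\<dots> = (\<Sum>i<N. \<Sum>j<N. J (\<lambda>Q. face_weights D1 Q * (holonomy N Q (d # X1) $$ (i, j) * G i j Q)))"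
          by (intro sum.cong refl Bochner_Integration.integral_sum) (intro bounded_PE_integrable bH; simp)
        \<comment> \<open>The averaged holonomy of the first piece is scalar, so the diagonal terms
          survive, and they reassemble the trace of the second piece.\<close>
        also have "\<dots> = (\<Sum>i<N. \<Sum>j<N. if i = j then (plaq_mean * Z) ^ card D1 * J (G i i) else 0)"
        proof (intro sum.cong refl)
          fix i j assume "i \<in> {..<N}" "j \<in> {..<N}"
          then have ij: "i < N" "j < N" by auto
          have "real N * J (\<lambda>Q. face_weights D1 Q * (holonomy N Q (d # X1) $$ (i, j) * G i j Q)) =
             (if i = j then real N * (plaq_mean * Z) ^ card D1 * J (G i j) else 0)"
            unfolding integral_closed_walk_entry[OF KD(1) path1 edges1 bG[OF ij] iG ij]
              less.hyps[OF lt(1) discs(1) KD(1) covs(1) bG[OF ij] iG] ..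
          then show "J (\<lambda>Q. face_weights D1 Q * (holonomy N Q (d # X1) $$ (i, j) * G i j Q)) =
              (if i = j then (plaq_mean * Z) ^ card D1 * J (G i i) else 0)" using N3 by (auto split: if_splits)
        qed
        also have "\<dots> = (plaq_mean * Z) ^ card D1 * (\<Sum>i<N. J (G i i))"
          by (simp add: sum_distrib_left)
        also have "(\<Sum>i<N. J (G i i)) = J (\<lambda>Q. \<Sum>i<N. G i i Q)"
          by (rule Bochner_Integration.integral_sum[symmetric]) (intro bounded_PE_integrable bG; simp)
        also have "\<dots> = J (\<lambda>Q. face_weights D2 Q * (?t (X2 @ [r]) Q * F Q))"
          by (rule Bochner_Integration.integral_cong[OF refl])
             (simp only: G_def mat_trace_eq[OF hc[OF _ covs(5)]] sum_distrib_left sum_distrib_right)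
        also have "\<dots> = real N * (plaq_mean * Z) ^ card D2 * J F"
          by (rule less.hyps[OF lt(2) disc2 KD(2) covs(5) F(1) F12(2)])
        finally show ?thesis by (simp add: card power_add)
      qed
    qed
    finally show ?thesis by (simp add: D(4))
  qed
qed

text \<open>The faces outside the disc are removed one at a time; each has an edge that no other
  remaining face contains, and this edge does not lie on the loop.\<close>

lemma integral_outer_faces:
  assumes "disc es D" "D \<noteq> {}" "finite R" "D \<subseteq> R" "region_edges R \<subseteq> E"
    and g: "bounded_meas PE g" "indep_of (E - region_edges D) g"
  shows "J (\<lambda>Q. face_weights R Q * g Q) = Z ^ card (R - D) * J (\<lambda>Q. face_weights D Q * g Q)"
  using assms(3-5)
proof (induction "card (R - D)" arbitrary: R)
  case 0
  then have "R = D" by auto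
  then show ?case by simp
next
  case (Suc n)
  then have "D \<subset> R" by auto
  moreover have "length es \<noteq> 2" using disc_length_2[OF assms(1)] assms(2) by simp
  ultimately obtain f c where f: "f \<in> R - D" "c \<in> face_edges f" "\<And>f'. f' \<in> R \<Longrightarrow> c \<in> face_edges f' \<Longrightarrow> f' = f"
    using peelable_outer_face[OF assms(1)] Suc.prems(1) by metis
  define R' where "R' = R - {f}"
  have R: "R = insert f R'" "f \<notin> R'" "finite R'" "D \<subseteq> R'" "R - D = insert f (R' - D)"
    using f(1) Suc.prems by (auto simp: R'_def)
  have card: "card (R - D) = Suc (card (R' - D))" using R by simp
  have cE: "c \<in> E" using f(1,2) Suc.prems(3) by blast
  have cR: "{c} \<inter> region_edges R' = {}" using f(3) R(1,2) by blast
  have fE: "face_edges f \<subseteq> E" "region_edges R' \<subseteq> E" using Suc.prems(3) R(1) by blast+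
  have cD: "{c} \<subseteq> E - region_edges D" using cE cR R(4) by blast
  have "J (\<lambda>Q. face_weights R Q * g Q) = J (\<lambda>Q. weight (holonomy N Q (face_walk f)) * (face_weights R' Q * g Q))"
    unfolding face_weights_def R(1) prod.insert[OF R(3,2)] by (simp add: plaq_weight_def mult.assoc)
  also have "\<dots> = Z * J (\<lambda>Q. face_weights R' Q * g Q)"
    unfolding Z_def
  proof (rule peel_plaquette[OF fE(1) f(2) bounded_weight])
    show "bounded_meas PE (\<lambda>Q. face_weights R' Q * g Q)" by (intro bounded_meas_mult bounded_face_weights fE g)
    show "indep_of {c} (\<lambda>Q. face_weights R' Q * g Q)"
      by (intro indep_of_mult indep_of_face_weights indep_of_mono[OF g(2)] cR cD)
  qed
  also have "J (\<lambda>Q. face_weights R' Q * g Q) = Z ^ card (R' - D) * J (\<lambda>Q. face_weights D Q * g Q)"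
    using Suc.hyps(1)[of R'] Suc.hyps(2) card R fE by simp
  finally show ?case by (simp add: card)
qed

end

section \<open>Uniqueness of the solution of the limiting loop equations\<close>

text \<open>A contraction argument in the supremum norm with weights 4^(-n). Since \<open>w\<close>
  and \<open>v\<close> are bounded by 1, the difference of the quadratic terms is linear in
  \<open>d\<close> with bounded coefficients; the weights make the convolution small at the price of
  a factor 4 in the shift to n + 1, which the bound 1/10 on beta absorbs.\<close>

lemma loop_equations_unique:
  fixes w :: "nat \<Rightarrow> real"
  assumes w0: "w 0 = 1" and bound: "\<And>n. \<bar>w n\<bar> \<le> 1" and \<beta>: "\<bar>\<beta>\<bar> \<le> 1/10"
    and eq: "\<And>n. n \<ge> 1 \<Longrightarrow> (\<Sum>m<n. w m * w (n - m)) = \<beta> * (w (n - 1) - w (n + 1))"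
  shows "w 1 = \<beta>"
proof -
  \<comment> \<open>The expected solution: for n = 2 the square of \<open>v 1\<close> matches beta
    times \<open>v 1\<close>, and for larger n both sides vanish.\<close>
  define v :: "nat \<Rightarrow> real" where "v n = (if n = 0 then 1 else if n = 1 then \<beta> else 0)" for n
  define d where "d n = w n - v n" for n
  define a where "a n = \<bar>d n\<bar> * (1/4) ^ n" for n
  have split: "(\<Sum>m<n. h m) = h 0 + (\<Sum>m=1..<n. h m)" if "n \<ge> 1" for h :: "nat \<Rightarrow> real" and n
    using sum.atLeast_Suc_lessThan[of 0 n h] that by (simp add: atLeast0LessThan)
  have veq: "v n + (\<Sum>m=1..<n. v m * v (n - m)) = \<beta> * (v (n - 1) - v (n + 1))" if n: "n \<ge> 1" for n
  proof -
    consider "n = 1" | "n = 2" | "n \<ge> 3" using n by linarith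
    then show ?thesis
    proof cases
      case 3
      then have "(\<Sum>m=1..<n. v m * v (n - m)) = 0" by (intro sum.neutral) (auto simp: v_def)
      then show ?thesis using 3 by (simp add: v_def)
    next
      case 2
      have "{1..<2::nat} = {1}" by auto
      then show ?thesis using 2 by (simp add: v_def)
    qed (auto simp: v_def)
  qed
  have deq: "d n = - (\<Sum>m=1..<n. d m * w (n - m) + v m * d (n - m)) + \<beta> * (d (n - 1) - d (n + 1))" if n: "n \<ge> 1" for n
  proof -
    have "w n + (\<Sum>m=1..<n. w m * w (n - m)) = \<beta> * (w (n - 1) - w (n + 1))"
      using eq[OF n] split[OF n, of "\<lambda>m. w m * w (n - m)"] w0 by simp
    moreover have "(\<Sum>m=1..<n. d m * w (n - m) + v m * d (n - m)) =
        (\<Sum>m=1..<n. w m * w (n - m)) - (\<Sum>m=1..<n. v m * v (n - m))"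
      unfolding sum_subtractf[symmetric] by (intro sum.cong refl) (simp add: d_def algebra_simps)
    ultimately show ?thesis using veq[OF n] by (simp add: d_def algebra_simps)
  qed
  have vb: "\<bar>v n\<bar> \<le> 1" for n using \<beta> by (simp add: v_def)
  have dle: "\<bar>d n\<bar> \<le> 2" for n using bound[of n] vb[of n] by (simp add: d_def)
  have a2: "a n \<le> 2" for n
  proof -
    have "a n \<le> 2 * 1" unfolding a_def using dle by (intro mult_mono) (auto intro: power_le_one)
    then show ?thesis by simp
  qed
  define M where "M = (SUP n. a n)"
  have bdd: "bdd_above (range a)" using a2 by (intro bdd_aboveI[of _ 2]) auto
  have aM: "a n \<le> M" for n unfolding M_def by (rule cSUP_upper[OF UNIV_I bdd])
  have a0: "a n \<ge> 0" for n by (simp add: a_def)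
  then have M0: "M \<ge> 0" using aM[of 0] order_trans by blast
  have step: "a n \<le> 4/5 * M" for n
  proof (cases "n = 0")
    case True
    then show ?thesis using M0 w0 by (simp add: a_def d_def v_def)
  next
    case False
    then have n: "n \<ge> 1" by simp
    have pw: "(1/4::real) ^ n = (1/4) ^ m * (1/4) ^ (n - m)" if "m \<in> {1..<n}" for m
      using that by (simp flip: power_add)
    have "\<bar>d n\<bar> \<le> (\<Sum>m=1..<n. \<bar>d m\<bar> * \<bar>w (n - m)\<bar> + \<bar>v m\<bar> * \<bar>d (n - m)\<bar>) + \<bar>\<beta>\<bar> * (\<bar>d (n - 1)\<bar> + \<bar>d (n + 1)\<bar>)"
    proof -
      have "\<bar>d n\<bar> \<le> \<bar>\<Sum>m=1..<n. d m * w (n - m) + v m * d (n - m)\<bar> + \<bar>\<beta> * (d (n - 1) - d (n + 1))\<bar>"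
        unfolding deq[OF n] by linarith
      also have "\<bar>\<Sum>m=1..<n. d m * w (n - m) + v m * d (n - m)\<bar> \<le> (\<Sum>m=1..<n. \<bar>d m\<bar> * \<bar>w (n - m)\<bar> + \<bar>v m\<bar> * \<bar>d (n - m)\<bar>)"
        by (rule order_trans[OF sum_abs]) (intro sum_mono order_trans[OF abs_triangle_ineq], simp add: abs_mult)
      also have "\<bar>\<beta> * (d (n - 1) - d (n + 1))\<bar> \<le> \<bar>\<beta>\<bar> * (\<bar>d (n - 1)\<bar> + \<bar>d (n + 1)\<bar>)"
        unfolding abs_mult by (intro mult_left_mono) auto
      finally show ?thesis by simp
    qed
    then have "a n \<le> ((\<Sum>m=1..<n. \<bar>d m\<bar> * \<bar>w (n - m)\<bar> + \<bar>v m\<bar> * \<bar>d (n - m)\<bar>) + \<bar>\<beta>\<bar> * (\<bar>d (n - 1)\<bar> + \<bar>d (n + 1)\<bar>)) * (1/4) ^ n"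
      unfolding a_def by (intro mult_right_mono) auto
    also have "\<dots> = (\<Sum>m=1..<n. a m * (\<bar>w (n - m)\<bar> * (1/4) ^ (n - m)) + (\<bar>v m\<bar> * (1/4) ^ m) * a (n - m)) +
        \<bar>\<beta>\<bar> * (a (n - 1) / 4 + 4 * a (n + 1))"
    proof -
      have "(\<Sum>m=1..<n. \<bar>d m\<bar> * \<bar>w (n - m)\<bar> + \<bar>v m\<bar> * \<bar>d (n - m)\<bar>) * (1/4) ^ n =
          (\<Sum>m=1..<n. a m * (\<bar>w (n - m)\<bar> * (1/4) ^ (n - m)) + (\<bar>v m\<bar> * (1/4) ^ m) * a (n - m))"
        unfolding sum_distrib_right by (intro sum.cong refl) (simp add: pw a_def algebra_simps)
      moreover have "(\<bar>d (n - 1)\<bar> + \<bar>d (n + 1)\<bar>) * (1/4) ^ n = a (n - 1) / 4 + 4 * a (n + 1)"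
        using n by (cases n) (simp_all add: a_def algebra_simps)
      ultimately show ?thesis by (simp add: distrib_right mult.assoc)
    qed
    also have "\<dots> \<le> (\<Sum>m=1..<n. M * (1 * (1/4) ^ (n - m)) + (\<bar>v m\<bar> * (1/4) ^ m) * M) + 1/10 * (M / 4 + 4 * M)"
    proof (intro add_mono sum_mono mult_mono)
    qed (use aM a0 M0 bound \<beta> in \<open>auto intro: divide_right_mono\<close>)
    also have "\<dots> = M * ((\<Sum>m=1..<n. (1/4) ^ (n - m)) + (\<Sum>m=1..<n. \<bar>v m\<bar> * (1/4) ^ m) + 17/40)"
      by (simp add: sum.distrib sum_distrib_left algebra_simps)
    \<comment> \<open>In order: the geometric series of 4^(-m) from m = 1, the single nonzero term
      \<open>v 1\<close>, and the two shifts with (1/4 + 4)/10. The total is 47/60, just below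
      4/5.\<close>
    also have "\<dots> \<le> M * (1/3 + 1/40 + 17/40)"
    proof (intro mult_left_mono add_mono M0 order_refl)
      have "(\<Sum>m=1..<n. (1/4::real) ^ (n - m)) = (\<Sum>m=1..<n. (1/4) ^ m)"
        by (rule sum.reindex_bij_witness[of _ "\<lambda>m. n - m" "\<lambda>m. n - m"]) auto
      also have "\<dots> \<le> 1/3"
      proof -
        have "3 * (\<Sum>m=1..<n. (1/4::real) ^ m) = 1 - 4 * (1/4) ^ n"
          using n by (induction n rule: nat_induct_at_least) (simp_all add: algebra_simps)
        moreover have "(1/4::real) ^ n \<ge> 0" by simp
        ultimately show ?thesis by linarith
      qed
      finally show "(\<Sum>m=1..<n. (1/4::real) ^ (n - m)) \<le> 1/3" .
      have "(\<Sum>m=1..<n. \<bar>v m\<bar> * (1/4) ^ m) = (\<Sum>m=1..<n. if m = 1 then \<bar>\<beta>\<bar> / 4 else 0)"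
        by (intro sum.cong) (auto simp: v_def)
      also have "\<dots> \<le> 1/40" using \<beta> by (simp add: sum.delta)
      finally show "(\<Sum>m=1..<n. \<bar>v m\<bar> * (1/4) ^ m) \<le> 1/40" .
    qed
    also have "\<dots> \<le> 4/5 * M" using M0 by simp
    finally show ?thesis .
  qed
  have "M \<le> 4/5 * M" unfolding M_def[of] by (rule cSUP_least) (use step M_def in auto)
  then have "M = 0" using M0 by simp
  then have "a 1 = 0" using aM[of 1] a0[of 1] by simp
  then show ?thesis by (simp add: a_def d_def v_def)
qed

section \<open>Schwinger-Dyson equations for a single plaquette variable\<close>

lemma pow_mat_SO: "A \<in> carrier (SO N) \<Longrightarrow> A ^\<^sub>m n \<in> carrier (SO N)"
  by (induction n) (auto simp: SO_one SO_carrier_mat dest: SO_carrier_mat intro: SO_mult)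

lemma measurable_pow_mat:
  "f \<in> measurable M (SO_borel N) \<Longrightarrow> (\<lambda>x. f x ^\<^sub>m n) \<in> measurable M (SO_borel N)"
proof (induction n)
  case 0
  have "(\<lambda>x. 1\<^sub>m N) \<in> measurable M (SO_borel N)" by (simp add: SO_one)
  then show ?case
  proof (rule measurable_cong[THEN iffD1, rotated])
    fix x assume "x \<in> space M"
    then have "f x \<in> carrier (SO N)" using measurable_space[OF 0] by simp
    then show "1\<^sub>m N = f x ^\<^sub>m 0" by (auto dest: SO_carrier_mat)
  qed
next
  case (Suc n)
  then show ?case by (simp add: measurable_SO_mult)
qed

lemma bounded_meas_pow_entry:
  "i < N \<Longrightarrow> j < N \<Longrightarrow> bounded_meas (SO_borel N) (\<lambda>A. (A ^\<^sub>m n) $$ (i, j))"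
  by (rule bounded_meas_comp[OF bounded_meas_SO_entry measurable_pow_mat[OF measurable_ident_sets[OF refl]]])

lemma bounded_meas_pow_trace: "bounded_meas (SO_borel N) (\<lambda>A. mat_trace (A ^\<^sub>m n))"
  by (rule bounded_meas_comp[OF bounded_meas_trace measurable_pow_mat[OF measurable_ident_sets[OF refl]]])

lemma pow_mat_mult_right: "A \<in> carrier_mat N N \<Longrightarrow> A ^\<^sub>m m * A = A ^\<^sub>m Suc m"
  by simp

lemma SO_row_norm:
  assumes "A \<in> carrier (SO N)" "i < N" shows "(\<Sum>k<N. (A $$ (i, k))\<^sup>2) = 1"
  using SO_column_norm[OF SO_transpose[OF assms(1)] assms(2)] SO_carrier_mat[OF assms(1)] assms(2) by simp

lemma plane_rot_dim [simp]: "dim_row (plane_rot N i j t) = N" "dim_col (plane_rot N i j t) = N"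
  by (simp_all add: plane_rot_def)

context haar_SO
begin

text \<open>By left invariance all difference quotients along the rotation have integral 0, and
  dominated convergence passes this to the derivative.\<close>

lemma integral_rot_derivative:
  assumes ij: "i < N" "j < N" "i \<noteq> j"
    and f: "bounded_meas (SO_borel N) f" and f': "bounded_meas (SO_borel N) f'"
    and deriv: "\<And>A. A \<in> carrier (SO N) \<Longrightarrow> ((\<lambda>t. f (plane_rot N i j t * A)) has_real_derivative f' A) (at 0)"
  shows "(\<integral>A. f' A \<partial>\<mu>) = 0"
proof -
  let ?r = "plane_rot N i j"
  note rc = plane_rot_SO[OF ij]
  obtain C where C: "\<And>A. A \<in> carrier (SO N) \<Longrightarrow> \<bar>f' A\<bar> \<le> C" using f' by (auto simp: bounded_meas_def)
  have one: "?r 0 * A = A" if "A \<in> carrier (SO N)" for A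
    using SO_carrier_mat[OF that] by (simp add: plane_rot_zero)
  have der: "((\<lambda>t. f (?r t * A)) has_real_derivative f' (?r t * A)) (at t)" if A: "A \<in> carrier (SO N)" for A t
  proof -
    have "(\<lambda>s. f (?r s * (?r t * A))) = (\<lambda>s. f (?r (s + t) * A))"
      using SO_carrier_mat[OF A] by (simp add: plane_rot_add[OF ij, symmetric] assoc_mult_mat[of _ N N _ N _ N])
    then have "((\<lambda>s. f (?r (s + t) * A)) has_real_derivative f' (?r t * A)) (at 0)"
      using deriv[OF SO_mult[OF rc A], of t] by simp
    then show ?thesis using DERIV_shift[of "\<lambda>s. f (?r s * A)" _ 0 t] by simp
  qed
  define s where "s n = 1 / (real n + 1)" for n :: nat
  have s0: "s n > 0" for n by (simp add: s_def)
  define q where "q n A = (f (?r (s n) * A) - f A) / s n" for n A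
  have mq: "bounded_meas (SO_borel N) (q n)" for n
  proof -
    have "bounded_meas (SO_borel N) (\<lambda>A. (f (?r (s n) * A) - f A) * (1 / s n))"
      by (intro bounded_meas_mult bounded_meas_diff bounded_meas_const f bounded_meas_comp[OF f]
          measurable_SO_mult measurable_const measurable_ident_sets[OF refl]) (simp add: rc)
    then show ?thesis by (simp add: q_def[abs_def])
  qed
  have q0: "(\<integral>A. q n A \<partial>\<mu>) = 0" for n
  proof -
    have "bounded_meas (SO_borel N) (\<lambda>A. f (?r (s n) * A))"
      by (intro bounded_meas_comp[OF f] measurable_SO_mult measurable_const measurable_ident_sets[OF refl]) (simp add: rc)
    then show ?thesis unfolding q_def
      using haar_left[OF rc bounded_meas_measurable[OF f]] haar_integrable f by simp
  qed
  have lim: "(\<lambda>n. q n A) \<longlonglongrightarrow> f' A" if A: "A \<in> carrier (SO N)" for A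
  proof -
    have "s \<longlonglongrightarrow> 0"
      using LIMSEQ_inverse_real_of_nat by (simp add: s_def[abs_def] inverse_eq_divide add.commute)
    then have "filterlim s (at 0) sequentially"
      unfolding filterlim_at using s0 by (auto simp: less_imp_neq[THEN not_sym])
    moreover have "((\<lambda>h. (f (?r h * A) - f A) / h) \<longlongrightarrow> f' A) (at 0)"
      using deriv[OF A] one[OF A] by (simp add: DERIV_def)
    ultimately show ?thesis unfolding q_def by (rule filterlim_compose[rotated])
  qed
  \<comment> \<open>By the mean value theorem: the rotations form a one-parameter group, so the
    derivative at any angle is \<open>f'\<close> at a rotated matrix.\<close>
  have bd: "\<bar>q n A\<bar> \<le> C" if A: "A \<in> carrier (SO N)" for n A
  proof -
    obtain z where "f (?r (s n) * A) - f (?r 0 * A) = (s n - 0) * f' (?r z * A)"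
      using MVT2[OF s0, of n "\<lambda>t. f (?r t * A)" "\<lambda>t. f' (?r t * A)"] der[OF A] by auto
    then have "q n A = f' (?r z * A)" using one[OF A] s0[of n] by (simp add: q_def)
    then show ?thesis using C[OF SO_mult[OF rc A]] by simp
  qed
  have "(\<lambda>n. \<integral>A. q n A \<partial>\<mu>) \<longlonglongrightarrow> (\<integral>A. f' A \<partial>\<mu>)"
  proof (rule integral_dominated_convergence[where w = "\<lambda>_. C"])
    show "AE A in \<mu>. (\<lambda>n. q n A) \<longlonglongrightarrow> f' A" using lim by (intro AE_I2) simp
    show "AE A in \<mu>. norm (q n A) \<le> C" for n using bd by (intro AE_I2) simp
  qed (use f' mq in \<open>simp_all add: bounded_meas_measurable\<close>)
  then show ?thesis by (simp add: q0 LIMSEQ_const_iff)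
qed

text \<open>The product rule: the generator of the rotation, with entries 1 at (i, j) and -1 at (j,
  i), is inserted before each of the n factors in turn.\<close>

lemma rot_pow_derivative:
  assumes ij: "i < N" "j < N" "i \<noteq> j" and A: "A \<in> carrier_mat N N" and ab: "a < N" "b < N"
  shows "((\<lambda>t. ((plane_rot N i j t * A) ^\<^sub>m n) $$ (a, b)) has_real_derivative
    (\<Sum>m<n. (A ^\<^sub>m m) $$ (a, i) * (A ^\<^sub>m (n - m)) $$ (j, b) - (A ^\<^sub>m m) $$ (a, j) * (A ^\<^sub>m (n - m)) $$ (i, b))) (at 0)"
  using ab
proof (induction n arbitrary: a b)
  case 0
  then show ?case by simp
next
  case (Suc n)
  let ?B = "\<lambda>t. plane_rot N i j t * A"
  let ?T = "\<lambda>n m c. (A ^\<^sub>m m) $$ (a, i) * (A ^\<^sub>m (n - m)) $$ (j, c) - (A ^\<^sub>m m) $$ (a, j) * (A ^\<^sub>m (n - m)) $$ (i, c)"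
  let ?D = "\<lambda>k. (if k = i then A $$ (j, b) else 0) - (if k = j then A $$ (i, b) else 0)"
  have Bc: "?B t \<in> carrier_mat N N" for t by (rule mult_carrier_mat[OF plane_rot_carrier A])
  have B0: "?B 0 = A" using A by (simp add: plane_rot_zero)
  have entry: "((\<lambda>t. ?B t $$ (k, b)) has_real_derivative ?D k) (at 0)"
    if "k < N" for k
  proof -
    have "(\<lambda>t. ?B t $$ (k, b)) = (\<lambda>t. if k = i then cos t * A $$ (i, b) + sin t * A $$ (j, b)
     else if k = j then - sin t * A $$ (i, b) + cos t * A $$ (j, b) else A $$ (k, b))"
      using plane_rot_mult_entry[OF A ij that Suc.prems(2)] by simp
    then show ?thesis using ij(3) by (auto intro!: derivative_eq_intros)
  qed
  have pc: "A ^\<^sub>m m \<in> carrier_mat N N" "?B t ^\<^sub>m m \<in> carrier_mat N N" for m t using A Bc by auto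
  have "((\<lambda>t. \<Sum>k<N. (?B t ^\<^sub>m n) $$ (a, k) * ?B t $$ (k, b)) has_real_derivative
     (\<Sum>k<N. (\<Sum>m<n. ?T n m k) * A $$ (k, b) +
       ?D k * (A ^\<^sub>m n) $$ (a, k))) (at 0)"
  proof (intro DERIV_sum)
    fix k assume "k \<in> {..<N}"
    then have k: "k < N" by simp
    show "((\<lambda>t. (?B t ^\<^sub>m n) $$ (a, k) * ?B t $$ (k, b)) has_real_derivative
      (\<Sum>m<n. ?T n m k) * A $$ (k, b) +
       ?D k * (A ^\<^sub>m n) $$ (a, k)) (at 0)"
      using DERIV_mult[OF Suc.IH[OF Suc.prems(1) k] entry[OF k]] unfolding B0 .
  qed
  moreover have "(\<lambda>t. (?B t ^\<^sub>m Suc n) $$ (a, b)) = (\<lambda>t. \<Sum>k<N. (?B t ^\<^sub>m n) $$ (a, k) * ?B t $$ (k, b))"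
    using index_mult_mat_sum[OF pc(2) Bc Suc.prems] by simp
  moreover have "(\<Sum>k<N. (\<Sum>m<n. ?T n m k) * A $$ (k, b) +
       ?D k * (A ^\<^sub>m n) $$ (a, k)) =
     (\<Sum>m<Suc n. ?T (Suc n) m b)"
  proof -
    have P: "(A ^\<^sub>m (Suc n - m)) $$ (c, b) = (\<Sum>k<N. (A ^\<^sub>m (n - m)) $$ (c, k) * A $$ (k, b))" if "m < n" "c < N" for m c
      using index_mult_mat_sum[OF pc(1) A that(2) Suc.prems(2)] that(1) by (simp add: Suc_diff_le)
    have "(\<Sum>k<N. (\<Sum>m<n. ?T n m k) * A $$ (k, b)) =
      (\<Sum>m<n. \<Sum>k<N. (?T n m k) * A $$ (k, b))"
      unfolding sum_distrib_right by (rule sum.swap)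
    also have "\<dots> = (\<Sum>m<n. ?T (Suc n) m b)"
      using ij by (intro sum.cong refl) (simp add: P left_diff_distrib right_diff_distrib sum_subtractf sum_distrib_left mult_ac del: pow_mat.simps)
    finally have 1: "(\<Sum>k<N. (\<Sum>m<n. ?T n m k) * A $$ (k, b)) =
      (\<Sum>m<n. ?T (Suc n) m b)" .
    have 2: "(\<Sum>k<N. ?D k * (A ^\<^sub>m n) $$ (a, k)) =
      (A ^\<^sub>m n) $$ (a, i) * A $$ (j, b) - (A ^\<^sub>m n) $$ (a, j) * A $$ (i, b)"
    proof -
      have "(\<Sum>k<N. ?D k * (A ^\<^sub>m n) $$ (a, k)) =
        (\<Sum>k<N. (if k = i then A $$ (j, b) * (A ^\<^sub>m n) $$ (a, k) else 0) - (if k = j then A $$ (i, b) * (A ^\<^sub>m n) $$ (a, k) else 0))"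
        by (intro sum.cong) (auto simp: left_diff_distrib)
      then show ?thesis using ij by (simp add: sum_subtractf)
    qed
    have A1: "A ^\<^sub>m 1 = A" using A by simp
    show ?thesis unfolding sum.distrib 1 2 using A1 by simp
  qed
  ultimately show ?case by simp
qed

text \<open>The function differentiated for the pair (i, j) is the weight times the component of A^n
  along the generator of rotations in that plane. After summation over pairs, the derivative of the
  power gives products of traces and traces of A^m times a transposed power; that of the weight
  gives traces of A^n A^T and A^n A, hence of A^(n-1) and A^(n+1).\<close>

theorem schwinger_dyson:
  assumes n: "n \<ge> 1"
  shows "(\<Sum>m<n. \<integral>A. exp (real N * \<beta> * mat_trace A) *
        ((\<Sum>i<N. \<Sum>j<N. (A ^\<^sub>m m) $$ (i, j) * (A ^\<^sub>m (n - m)) $$ (i, j)) - mat_trace (A ^\<^sub>m m) * mat_trace (A ^\<^sub>m (n - m))) \<partial>\<mu>) +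
     real N * \<beta> * (\<integral>A. exp (real N * \<beta> * mat_trace A) * (mat_trace (A ^\<^sub>m (n - 1)) - mat_trace (A ^\<^sub>m (n + 1))) \<partial>\<mu>) = 0"
proof -
  let ?w = "\<lambda>A. exp (real N * \<beta> * mat_trace A)"
  define P where "P A m a b = (A ^\<^sub>m m) $$ (a, b)" for A :: "real mat" and m a b
  define D where "D i j A = (\<Sum>m<n. P A m j i * P A (n - m) j i - P A m j j * P A (n - m) i i) -
      (\<Sum>m<n. P A m i i * P A (n - m) j j - P A m i j * P A (n - m) i j)" for i j A
  define T where "T i j A = real N * \<beta> * ((P A n j i - P A n i j) * (P A 1 j i - P A 1 i j))" for i j A
  have bw: "bounded_meas (SO_borel N) ?w"
    by (intro bounded_meas_exp bounded_meas_mult bounded_meas_const bounded_meas_trace)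
  have bP: "bounded_meas (SO_borel N) (\<lambda>A. P A m a b)" if "a < N" "b < N" for m a b
    unfolding P_def by (rule bounded_meas_pow_entry[OF that])
  have bDT: "bounded_meas (SO_borel N) (\<lambda>A. ?w A * (D i j A + T i j A))" if "i < N" "j < N" for i j
    unfolding D_def T_def
    by (intro bounded_meas_mult bw bounded_meas_add bounded_meas_diff bounded_meas_sum bounded_meas_const bP that)
  \<comment> \<open>Diagonal pairs contribute 0, so that the sums may run over all pairs of
    indices.\<close>
  have zero: "(\<integral>A. ?w A * (D i j A + T i j A) \<partial>\<mu>) = 0" if ij: "i < N" "j < N" for i j
  proof (cases "i = j")
    case True
    then have "D i j A + T i j A = 0" for A by (simp add: D_def T_def)
    then show ?thesis by simp
  next
    case False
    show ?thesis
    proof (rule integral_rot_derivative[OF ij False, where f = "\<lambda>A. ?w A * (P A n j i - P A n i j)"])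
      show "bounded_meas (SO_borel N) (\<lambda>A. ?w A * (P A n j i - P A n i j))"
        by (intro bounded_meas_mult bw bounded_meas_diff bP ij)
      show "bounded_meas (SO_borel N) (\<lambda>A. ?w A * (D i j A + T i j A))" by (rule bDT[OF ij])
      fix A assume "A \<in> carrier (SO N)"
      then have A: "A \<in> carrier_mat N N" by (rule SO_carrier_mat)
      let ?B = "\<lambda>t. plane_rot N i j t * A"
      let ?s = "\<Sum>k<N. (\<Sum>m<1. (A ^\<^sub>m m) $$ (k, i) * (A ^\<^sub>m (1 - m)) $$ (j, k) - (A ^\<^sub>m m) $$ (k, j) * (A ^\<^sub>m (1 - m)) $$ (i, k))"
      have B0: "?B 0 = A" using A by (simp add: plane_rot_zero)
      have A1: "P A 1 a b = A $$ (a, b)" for a b using A by (simp add: P_def)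
      have "((\<lambda>t. \<Sum>k<N. (?B t ^\<^sub>m 1) $$ (k, k)) has_real_derivative
          ?s) (at 0)"
        by (intro DERIV_sum rot_pow_derivative ij False A) auto
      moreover have "(\<lambda>t. \<Sum>k<N. (?B t ^\<^sub>m 1) $$ (k, k)) = (\<lambda>t. mat_trace (?B t))"
        using A by (simp add: mat_trace_def)
      moreover have "?s =
          A $$ (j, i) - A $$ (i, j)"
      proof -
        have "?s =
          (\<Sum>k<N. (if k = i then A $$ (j, k) else 0) - (if k = j then A $$ (i, k) else 0))"
          using A ij by (intro sum.cong) auto
        then show ?thesis using ij by (simp add: sum_subtractf)
      qed
      ultimately have tr: "((\<lambda>t. mat_trace (?B t)) has_real_derivative A $$ (j, i) - A $$ (i, j)) (at 0)" by simp
      have w: "((\<lambda>t. ?w (?B t)) has_real_derivative ?w A * (real N * \<beta> * (A $$ (j, i) - A $$ (i, j)))) (at 0)"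
        using DERIV_fun_exp[OF DERIV_cmult[OF tr, of "real N * \<beta>"]] unfolding B0 .
      have pw: "((\<lambda>t. P (?B t) n j i - P (?B t) n i j) has_real_derivative D i j A) (at 0)"
        unfolding P_def D_def by (intro DERIV_diff rot_pow_derivative ij False A)
      show "((\<lambda>t. ?w (?B t) * (P (?B t) n j i - P (?B t) n i j)) has_real_derivative ?w A * (D i j A + T i j A)) (at 0)"
        by (rule DERIV_cong[OF DERIV_mult[OF w pw]]) (unfold B0 T_def A1, simp add: algebra_simps)
    qed
  qed
  define S where "S A m = (\<Sum>i<N. \<Sum>j<N. P A m i j * P A (n - m) i j)" for A m
  have pt: "(\<Sum>i<N. \<Sum>j<N. D i j A + T i j A) =
      2 * ((\<Sum>m<n. S A m - mat_trace (A ^\<^sub>m m) * mat_trace (A ^\<^sub>m (n - m))) +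
       real N * \<beta> * (mat_trace (A ^\<^sub>m (n - 1)) - mat_trace (A ^\<^sub>m (n + 1))))" if A: "A \<in> carrier (SO N)" for A
  proof -
    note Ac = SO_carrier_mat[OF A]
    have pc: "A ^\<^sub>m m \<in> carrier_mat N N" for m using Ac by simp
    have tr: "mat_trace (A ^\<^sub>m m) = (\<Sum>i<N. P A m i i)" for m
      using pc[of m] Ac by (simp add: mat_trace_def P_def)
    have D1: "(\<Sum>i<N. \<Sum>j<N. P A m j i * P A (n - m) j i) = S A m" for m
      unfolding S_def by (rule sum.swap)
    have D2: "(\<Sum>i<N. \<Sum>j<N. P A m j j * P A (n - m) i i) = mat_trace (A ^\<^sub>m m) * mat_trace (A ^\<^sub>m (n - m))" for m
      unfolding tr sum_product by (rule sum.swap)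
    have D3: "(\<Sum>i<N. \<Sum>j<N. P A m i i * P A (n - m) j j) = mat_trace (A ^\<^sub>m m) * mat_trace (A ^\<^sub>m (n - m))" for m
      unfolding tr sum_product ..
    have D4: "(\<Sum>i<N. \<Sum>j<N. P A m i j * P A (n - m) i j) = S A m" for m
      unfolding S_def ..
    have DD: "(\<Sum>i<N. \<Sum>j<N. D i j A) = 2 * (\<Sum>m<n. S A m - mat_trace (A ^\<^sub>m m) * mat_trace (A ^\<^sub>m (n - m)))"
    proof -
      have sw: "(\<Sum>i<N. \<Sum>j<N. \<Sum>m<n. h i j m) = (\<Sum>m<n. \<Sum>i<N. \<Sum>j<N. h i j m)" for h :: "nat \<Rightarrow> nat \<Rightarrow> nat \<Rightarrow> real"
      proof -
        have "(\<Sum>i<N. \<Sum>j<N. \<Sum>m<n. h i j m) = (\<Sum>i<N. \<Sum>m<n. \<Sum>j<N. h i j m)"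
          by (intro sum.cong refl sum.swap)
        then show ?thesis by (subst (asm) (2) sum.swap)
      qed
      show ?thesis unfolding D_def sum_subtractf sw D1 D2 D3 D4 by simp
    qed
    have TT: "(\<Sum>i<N. \<Sum>j<N. T i j A) = 2 * (real N * \<beta> * (mat_trace (A ^\<^sub>m (n - 1)) - mat_trace (A ^\<^sub>m (n + 1))))"
    proof -
      have A1: "P A 1 a b = A $$ (a, b)" for a b using Ac by (simp add: P_def)
      have n1: "A ^\<^sub>m n = A ^\<^sub>m (n - 1) * A" using n pow_mat_mult_right[OF Ac, of "n - 1"] by simp
      have X: "(\<Sum>i<N. \<Sum>j<N. P A n i j * P A 1 i j) = mat_trace (A ^\<^sub>m (n - 1))"
      proof -
        have "A ^\<^sub>m n * transpose_mat A = A ^\<^sub>m (n - 1)"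
          unfolding n1 using pc[of "n - 1"] Ac by (simp add: assoc_mult_mat[of _ N N _ N _ N] SO_transpose_right[OF A])
        moreover have "mat_trace (A ^\<^sub>m n * transpose_mat A) = (\<Sum>i<N. \<Sum>j<N. P A n i j * P A 1 i j)"
          unfolding A1 using Ac pc[of n] by (simp add: mat_trace_def P_def index_mult_mat_sum[of _ N] del: index_mult_mat(1))
        ultimately show ?thesis by simp
      qed
      have Y: "(\<Sum>i<N. \<Sum>j<N. P A n i j * P A 1 j i) = mat_trace (A ^\<^sub>m (n + 1))"
        unfolding A1 using Ac pc[of n] by (simp add: mat_trace_def P_def index_mult_mat_sum[of _ N] del: index_mult_mat(1))
      have X': "(\<Sum>i<N. \<Sum>j<N. P A n j i * P A 1 j i) = mat_trace (A ^\<^sub>m (n - 1))"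
        unfolding X[symmetric] by (rule sum.swap)
      have Y': "(\<Sum>i<N. \<Sum>j<N. P A n j i * P A 1 i j) = mat_trace (A ^\<^sub>m (n + 1))"
        unfolding Y[symmetric] by (rule sum.swap)
      have "(\<Sum>i<N. \<Sum>j<N. (P A n j i - P A n i j) * (P A 1 j i - P A 1 i j)) =
         2 * (mat_trace (A ^\<^sub>m (n - 1)) - mat_trace (A ^\<^sub>m (n + 1)))"
        unfolding left_diff_distrib right_diff_distrib sum_subtractf X X' Y Y' by simp
      then show ?thesis unfolding T_def sum_distrib_left[symmetric] by simp
    qed
    show ?thesis unfolding sum.distrib DD TT by simp
  qed
  have "0 = (\<Sum>i<N. \<Sum>j<N. \<integral>A. ?w A * (D i j A + T i j A) \<partial>\<mu>)" using zero by simp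
  also have "\<dots> = (\<Sum>i<N. \<integral>A. (\<Sum>j<N. ?w A * (D i j A + T i j A)) \<partial>\<mu>)"
    by (intro sum.cong refl Bochner_Integration.integral_sum[symmetric]) (intro haar_integrable bDT; simp)
  also have "\<dots> = (\<integral>A. (\<Sum>i<N. \<Sum>j<N. ?w A * (D i j A + T i j A)) \<partial>\<mu>)"
    by (intro Bochner_Integration.integral_sum[symmetric]) (intro haar_integrable bounded_meas_sum bDT; simp)
  also have "\<dots> = (\<integral>A. 2 * ((\<Sum>m<n. ?w A * (S A m - mat_trace (A ^\<^sub>m m) * mat_trace (A ^\<^sub>m (n - m)))) +
      real N * \<beta> * (?w A * (mat_trace (A ^\<^sub>m (n - 1)) - mat_trace (A ^\<^sub>m (n + 1))))) \<partial>\<mu>)"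
  proof (rule Bochner_Integration.integral_cong[OF refl])
    fix A assume "A \<in> space \<mu>"
    then have A: "A \<in> carrier (SO N)" by simp
    have "(\<Sum>i<N. \<Sum>j<N. ?w A * (D i j A + T i j A)) = ?w A * (\<Sum>i<N. \<Sum>j<N. D i j A + T i j A)"
      by (simp only: sum_distrib_left)
    then show "(\<Sum>i<N. \<Sum>j<N. ?w A * (D i j A + T i j A)) =
      2 * ((\<Sum>m<n. ?w A * (S A m - mat_trace (A ^\<^sub>m m) * mat_trace (A ^\<^sub>m (n - m)))) +
      real N * \<beta> * (?w A * (mat_trace (A ^\<^sub>m (n - 1)) - mat_trace (A ^\<^sub>m (n + 1)))))"
      unfolding pt[OF A] sum_distrib_left[symmetric] by (simp only: distrib_left mult_ac)
  qed
  also have "\<dots> = 2 * ((\<Sum>m<n. \<integral>A. ?w A * (S A m - mat_trace (A ^\<^sub>m m) * mat_trace (A ^\<^sub>m (n - m))) \<partial>\<mu>) +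
      real N * \<beta> * (\<integral>A. ?w A * (mat_trace (A ^\<^sub>m (n - 1)) - mat_trace (A ^\<^sub>m (n + 1))) \<partial>\<mu>))"
  proof -
    have b1: "bounded_meas (SO_borel N) (\<lambda>A. ?w A * (S A m - mat_trace (A ^\<^sub>m m) * mat_trace (A ^\<^sub>m (n - m))))" for m
      unfolding S_def by (intro bounded_meas_mult bw bounded_meas_diff bounded_meas_sum bP bounded_meas_pow_trace; simp)
    have b2: "bounded_meas (SO_borel N) (\<lambda>A. ?w A * (mat_trace (A ^\<^sub>m (n - 1)) - mat_trace (A ^\<^sub>m (n + 1))))"
      by (intro bounded_meas_mult bw bounded_meas_diff bounded_meas_pow_trace)
    show ?thesis
      using haar_integrable[OF b1] haar_integrable[OF b2]
      by (simp add: Bochner_Integration.integral_sum del: pow_mat.simps)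
  qed
  finally show ?thesis unfolding S_def P_def by simp
qed

end

section \<open>Gibbs measures in boxes\<close>

definition faces_in :: "vertex set \<Rightarrow> vertex set" where
  "faces_in \<Lambda> = {f. unit_square_vertices f \<subseteq> \<Lambda>}"

lemma pos_plaquette_face_walk: "pos_plaquette (face_walk (a, b))"
proof -
  define p where "p = face_walk (a, b)"
  have p: "p = [((a, b), (a, b + 1)), ((a, b + 1), (a + 1, b + 1)), ((a + 1, b + 1), (a + 1, b)), ((a + 1, b), (a, b))]"
    by (simp add: p_def face_walk_def)
  have "closed_walk p"
    unfolding closed_walk_def
  proof (intro conjI allI impI)
    show "p \<noteq> []" "set p \<subseteq> edges" using face_walk_edges[of "(a, b)"] by (simp_all add: p_def face_walk_def)
    fix i assume "i < length p"
    then consider "i = 0" | "i = 1" | "i = 2" | "i = 3" by (simp add: p) linarith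
    then show "snd (p ! i) = fst (p ! (Suc i mod length p))" by cases (simp_all add: p)
  qed
  moreover have "set (map fst p) = unit_square_vertices (a, b)" by (auto simp: p unit_square_vertices_def)
  moreover have "length p = 4" "distinct p" by (simp_all add: p)
  ultimately have "is_plaquette p" unfolding is_plaquette_def by blast
  moreover have "\<forall>v\<in>set (map fst p) - {fst (p ! 0)}. lex_less (fst (p ! 0)) v"
    "\<forall>v\<in>set (map fst p) - {fst (p ! 0), fst (p ! 1)}. lex_less (fst (p ! 1)) v"
    by (simp_all add: p lex_less_def)
  ultimately show ?thesis unfolding pos_plaquette_def p_def by blast
qed

text \<open>The orientation condition forces the walk to start at the lower left vertex and to go to
  the upper left one. The lower right vertex is not adjacent to the latter, which leaves one order
  for the rest.\<close>

lemma pos_plaquette_eq_face_walk: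
  assumes "pos_plaquette p" obtains f where "p = face_walk f"
proof -
  have cw: "closed_walk p" and len: "length p = 4" and ex: "\<exists>x. set (map fst p) = unit_square_vertices x"
    and m0: "\<And>v. v \<in> set (map fst p) - {fst (p ! 0)} \<Longrightarrow> lex_less (fst (p ! 0)) v"
    and m1: "\<And>v. v \<in> set (map fst p) - {fst (p ! 0), fst (p ! 1)} \<Longrightarrow> lex_less (fst (p ! 1)) v"
    using assms by (auto simp: pos_plaquette_def is_plaquette_def)
  obtain x where V: "set (map fst p) = unit_square_vertices x" using ex by blast
  obtain a b where x: "x = (a, b)" by force
  obtain e0 e1 e2 e3 where p: "p = [e0, e1, e2, e3]"
    using len by (auto simp: numeral_eq_Suc length_Suc_conv)
  have E: "e0 \<in> edges" "e1 \<in> edges" "e2 \<in> edges" "e3 \<in> edges" using cw by (auto simp: closed_walk_def p)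
  have S: "snd e0 = fst e1" "snd e1 = fst e2" "snd e2 = fst e3" "snd e3 = fst e0"
  proof -
    have c: "\<And>i. i < 4 \<Longrightarrow> snd (p ! i) = fst (p ! (Suc i mod 4))" using cw len by (simp add: closed_walk_def)
    show "snd e0 = fst e1" "snd e1 = fst e2" "snd e2 = fst e3" "snd e3 = fst e0"
      using c[of 0] c[of 1] c[of 2] c[of 3] by (simp_all add: p)
  qed
  have V': "{fst e0, fst e1, fst e2, fst e3} = {(a, b), (a + 1, b), (a, b + 1), (a + 1, b + 1)}"
    using V by (simp add: p x unit_square_vertices_def)
  have "card {(a, b), (a + 1, b), (a, b + 1), (a + 1, b + 1)} = 4" by simp
  then have "card {fst e0, fst e1, fst e2, fst e3} = 4" unfolding V' .
  then have d: "distinct [fst e0, fst e1, fst e2, fst e3]"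
    by (intro card_distinct) simp
  have p01: "fst (p ! 0) = fst e0" "fst (p ! 1) = fst e1" by (simp_all add: p)
  have v0: "fst e0 = (a, b)"
  proof (rule ccontr)
    assume n: "fst e0 \<noteq> (a, b)"
    have "(a, b) \<in> set (map fst p)" unfolding V x by (simp add: unit_square_vertices_def)
    then have "(a, b) \<in> set (map fst p) - {fst e0}" using n by (metis DiffI singletonD)
    then have "lex_less (fst e0) (a, b)" using m0[of "(a, b)"] unfolding p01 by blast
    moreover have "fst e0 \<in> {(a, b), (a + 1, b), (a, b + 1), (a + 1, b + 1)}" unfolding V'[symmetric] by simp
    ultimately show False by (elim insertE emptyE; simp add: lex_less_def)
  qed
  have v1: "fst e1 = (a, b + 1)"
  proof (rule ccontr)
    assume n: "fst e1 \<noteq> (a, b + 1)"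
    have "(a, b + 1) \<in> set (map fst p)" unfolding V x by (simp add: unit_square_vertices_def)
    moreover have "(a, b + 1) \<notin> {fst e0, fst e1}" using n v0 by auto
    ultimately have "lex_less (fst e1) (a, b + 1)" using m1[of "(a, b + 1)"] unfolding p01 by blast
    moreover have "fst e1 \<in> {(a, b), (a + 1, b), (a, b + 1), (a + 1, b + 1)}" unfolding V'[symmetric] by simp
    moreover have "fst e1 \<noteq> (a, b)" using d v0 by auto
    ultimately show False by (elim insertE emptyE; simp add: lex_less_def)
  qed
  have "fst e2 \<in> {(a, b), (a + 1, b), (a, b + 1), (a + 1, b + 1)}" "fst e3 \<in> {(a, b), (a + 1, b), (a, b + 1), (a + 1, b + 1)}"
    unfolding V'[symmetric] by simp_all
  moreover have "fst e2 \<noteq> (a + 1, b)" using E(2) S(2) v1 by (cases e1) (auto simp: edges_def)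
  ultimately have "fst e2 = (a + 1, b + 1)" "fst e3 = (a + 1, b)" using d v0 v1 by auto
  then have "p = face_walk (a, b)" using v0 v1 S by (simp add: p face_walk_def prod_eq_iff)
  then show ?thesis by (rule that)
qed

lemma pos_plaquettes_in_eq: "pos_plaquettes_in \<Lambda> = face_walk ` faces_in \<Lambda>"
proof -
  have 1: "(\<forall>e\<in>set (face_walk f). fst e \<in> \<Lambda> \<and> snd e \<in> \<Lambda>) \<longleftrightarrow> f \<in> faces_in \<Lambda>" for f
    by (cases f) (auto simp: face_walk_def faces_in_def unit_square_vertices_def)
  show ?thesis
  proof (intro subset_antisym subsetI)
    fix p assume "p \<in> pos_plaquettes_in \<Lambda>"
    then have p: "pos_plaquette p" "\<forall>e\<in>set p. fst e \<in> \<Lambda> \<and> snd e \<in> \<Lambda>"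
      unfolding pos_plaquettes_in_def by blast+
    obtain f where f: "p = face_walk f" by (rule pos_plaquette_eq_face_walk[OF p(1)])
    then have "f \<in> faces_in \<Lambda>" using p(2) 1[of f] by blast
    then show "p \<in> face_walk ` faces_in \<Lambda>" unfolding f by (rule imageI)
  next
    fix p assume "p \<in> face_walk ` faces_in \<Lambda>"
    then obtain f where f: "p = face_walk f" "f \<in> faces_in \<Lambda>" by (rule imageE)
    have "pos_plaquette p" unfolding f(1) using pos_plaquette_face_walk[of "fst f" "snd f"] by simp
    moreover have "\<forall>e\<in>set p. fst e \<in> \<Lambda> \<and> snd e \<in> \<Lambda>" unfolding f(1) using 1[of f] f(2) by blast
    ultimately show "p \<in> pos_plaquettes_in \<Lambda>" unfolding pos_plaquettes_in_def by blast
  qed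
qed

lemma inj_face_walk: "inj face_walk"
proof (rule injI)
  fix f g assume eq: "face_walk f = face_walk g"
  have "fst (hd (face_walk f)) = f" for f by (cases f) (simp add: face_walk_def)
  then show "f = g" using arg_cong[OF eq, of "\<lambda>p. fst (hd p)"] by simp
qed

lemma finite_faces_in:
  assumes "finite \<Lambda>" shows "finite (faces_in \<Lambda>)"
  by (rule finite_subset[OF _ assms]) (auto simp: faces_in_def unit_square_vertices_def)

lemma faces_in_edges: "region_edges (faces_in \<Lambda>) \<subseteq> pos_edges_in \<Lambda>"
proof -
  have "face_edges (a, b) \<subseteq> pos_edges_in \<Lambda>" if "(a, b) \<in> faces_in \<Lambda>" for a b
    using that unfolding face_edges_eq
    by (auto simp: faces_in_def unit_square_vertices_def pos_edges_in_def pos_edges_def edges_def lex_less_def)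
  then show ?thesis by fastforce
qed

lemma finite_pos_edges_in: "finite \<Lambda> \<Longrightarrow> finite (pos_edges_in \<Lambda>)"
  by (rule finite_subset[of _ "\<Lambda> \<times> \<Lambda>"]) (auto simp: pos_edges_in_def)

lemma face_boundary_disc: "disc (rev_walk (face_walk f)) {f}"
proof (rule discI)
  obtain a b where f: "f = (a, b)" by force
  have eq: "rev_walk (face_walk f) = [((a, b), (a + 1, b)), ((a + 1, b), (a + 1, b + 1)), ((a + 1, b + 1), (a, b + 1)), ((a, b + 1), (a, b))]"
    by (simp add: f rev_walk_def face_walk_def)
  show "circuit (rev_walk (face_walk f))" unfolding eq by (auto simp: circuit_def edges_def)
  show "wind (rev_walk (face_walk f)) g = of_bool (g \<in> {f})" for g
    unfolding eq unfolding f by (cases g) (auto simp: crossing_def)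
qed

section \<open>Exact expectations at finite matrix size\<close>

context lattice_wilson
begin

text \<open>A single face is a disc, so all other faces are peeled off, and what remains is an
  integral over one group element with its weight.\<close>

lemma integral_face_weights:
  assumes "finite R" "region_edges R \<subseteq> E" "f \<in> R" and h: "bounded_meas (SO_borel N) h"
  shows "J (\<lambda>Q. face_weights R Q * h (holonomy N Q (face_walk f))) = Z ^ (card R - 1) * (\<integral>A. weight A * h A \<partial>\<mu>)"
proof -
  have fE: "face_edges f \<subseteq> E" using assms by blast
  have ind: "indep_of (E - region_edges {f}) (\<lambda>Q. h (holonomy N Q (face_walk f)))"
    by (intro indep_of_holonomy face_walk_edges) (auto simp: face_edges_def)
  have "J (\<lambda>Q. face_weights R Q * h (holonomy N Q (face_walk f))) =
      Z ^ card (R - {f}) * J (\<lambda>Q. face_weights {f} Q * h (holonomy N Q (face_walk f)))"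
    by (rule integral_outer_faces[OF face_boundary_disc _ assms(1) _ assms(2) bounded_holonomy[OF h covered_face_walk[OF fE]] ind])
       (use assms(3) in auto)
  also have "J (\<lambda>Q. face_weights {f} Q * h (holonomy N Q (face_walk f))) =
      J (\<lambda>Q. (weight (holonomy N Q (face_walk f)) * h (holonomy N Q (face_walk f))) * 1)"
    by (simp add: face_weights_def plaq_weight_def)
  also have "\<dots> = (\<integral>A. weight A * h A \<partial>\<mu>) * J (\<lambda>Q. 1)"
  proof -
    obtain c where c: "c \<in> face_edges f" by (cases f) (auto simp: face_edges_eq)
    show ?thesis
      by (rule peel_plaquette[OF fE c bounded_meas_mult[OF bounded_weight h] bounded_meas_const]) (simp add: indep_of_def)
  qed
  finally show ?thesis using assms(1,3) prob_space.prob_space[OF prob_space_PE] by simp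
qed

lemma integral_face_weights_1:
  assumes "finite R" "region_edges R \<subseteq> E" "R \<noteq> {}"
  shows "J (face_weights R) = Z ^ card R"
proof -
  obtain f where f: "f \<in> R" using assms(3) by blast
  have "card R \<noteq> 0" using assms by simp
  then show ?thesis
    using integral_face_weights[OF assms(1,2) f, of "\<lambda>_. 1"] Z_def by (cases "card R") (auto simp: bounded_meas_const)
qed

lemma integral_gibbs:
  assumes H: "H N = \<mu>" and E: "E = pos_edges_in \<Lambda>" and \<Lambda>: "finite \<Lambda>" "faces_in \<Lambda> \<noteq> {}" and X: "bounded_meas PE X"
  shows "(\<integral>Q. X Q \<partial>gibbs H \<Lambda> N \<beta>) = J (\<lambda>Q. face_weights (faces_in \<Lambda>) Q * X Q) / Z ^ card (faces_in \<Lambda>)"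
proof -
  have fin: "finite (faces_in \<Lambda>)" by (rule finite_faces_in[OF \<Lambda>(1)])
  have sub: "region_edges (faces_in \<Lambda>) \<subseteq> E" unfolding E by (rule faces_in_edges)
  have PEeq: "product_haar H \<Lambda> N = PE" by (simp add: product_haar_def H E)
  have bw: "boltzmann \<Lambda> N \<beta> Q = face_weights (faces_in \<Lambda>) Q" for Q
    unfolding boltzmann_def pos_plaquettes_in_eq sum.reindex[OF inj_on_subset[OF inj_face_walk subset_UNIV]] o_def
      sum_distrib_left exp_sum[OF fin] face_weights_def plaq_weight_def weight_def ..
  have pf: "partition_fun H \<Lambda> N \<beta> = Z ^ card (faces_in \<Lambda>)"
    unfolding partition_fun_def PEeq bw by (rule integral_face_weights_1[OF fin sub \<Lambda>(2)])
  note bm = bounded_meas_measurable[OF bounded_face_weights[OF sub]]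
  have "(\<integral>Q. X Q \<partial>gibbs H \<Lambda> N \<beta>) = J (\<lambda>Q. (face_weights (faces_in \<Lambda>) Q / Z ^ card (faces_in \<Lambda>)) *\<^sub>R X Q)"
    unfolding gibbs_def PEeq bw pf
  proof (rule integral_density)
    show "X \<in> borel_measurable PE" by (rule bounded_meas_measurable[OF X])
    show "(\<lambda>Q. face_weights (faces_in \<Lambda>) Q / Z ^ card (faces_in \<Lambda>)) \<in> borel_measurable PE" using bm by simp
    show "AE Q in PE. 0 \<le> face_weights (faces_in \<Lambda>) Q / Z ^ card (faces_in \<Lambda>)"
      using Z_pos by (intro AE_I2 divide_nonneg_nonneg) (auto simp: face_weights_def plaq_weight_def weight_def intro: prod_nonneg)
  qed
  also have "\<dots> = J (\<lambda>Q. (face_weights (faces_in \<Lambda>) Q * X Q) / Z ^ card (faces_in \<Lambda>))"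
    by simp
  finally show ?thesis by simp
qed

text \<open>The faces outside the disc give a power of \<open>Z\<close>, the disc a power of
  \<open>plaq_mean * Z\<close>; the partition function cancels every \<open>Z\<close>, and with it
  the dependence on the volume.\<close>

theorem wilson_expect_disc:
  assumes H: "H N = \<mu>" and E: "E = pos_edges_in \<Lambda>" and \<Lambda>: "finite \<Lambda>"
    and es: "disc es D" "D \<noteq> {}" "D \<subseteq> faces_in \<Lambda>"
  shows "wilson_expect H \<Lambda> N \<beta> es / real N = plaq_mean ^ card D"
proof -
  have fin: "finite (faces_in \<Lambda>)" by (rule finite_faces_in[OF \<Lambda>])
  have sub: "region_edges (faces_in \<Lambda>) \<subseteq> E" unfolding E by (rule faces_in_edges)
  have subD: "region_edges D \<subseteq> E" using sub es(3) by blast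
  have l: "length es \<noteq> 2" using disc_length_2[OF es(1)] es(2) by simp
  have ee: "set es \<subseteq> edges" by (rule circuit_edges[OF disc_circuit[OF es(1)]])
  have pe: "pos_edge ` set es \<subseteq> region_edges D" by (rule disc_edges[OF es(1) l])
  have cov: "covered es" using ee pe subD by (auto simp: covered_def)
  have bX: "bounded_meas PE (\<lambda>Q. mat_trace (holonomy N Q es))" by (rule bounded_holonomy[OF bounded_meas_trace cov])
  have ind: "indep_of (E - region_edges D) (\<lambda>Q. mat_trace (holonomy N Q es))"
    by (rule indep_of_holonomy[OF ee]) (use pe in blast)
  have ne: "faces_in \<Lambda> \<noteq> {}" using es by auto
  have "wilson_expect H \<Lambda> N \<beta> es = J (\<lambda>Q. face_weights (faces_in \<Lambda>) Q * mat_trace (holonomy N Q es)) / Z ^ card (faces_in \<Lambda>)"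
    unfolding wilson_expect_def wilson_def by (rule integral_gibbs[where H = H and \<Lambda> = \<Lambda>, OF H E \<Lambda> ne bX])
  also have "J (\<lambda>Q. face_weights (faces_in \<Lambda>) Q * mat_trace (holonomy N Q es)) =
      Z ^ card (faces_in \<Lambda> - D) * J (\<lambda>Q. face_weights D Q * mat_trace (holonomy N Q es))"
    by (rule integral_outer_faces[OF es(1,2) fin es(3) sub bX ind])
  also have "J (\<lambda>Q. face_weights D Q * mat_trace (holonomy N Q es)) = real N * (plaq_mean * Z) ^ card D"
    using integral_disc[OF es(1) subD cov bounded_meas_const[of PE 1]] prob_space.prob_space[OF prob_space_PE]
    by (simp add: indep_of_def)
  also have "Z ^ card (faces_in \<Lambda> - D) * (real N * (plaq_mean * Z) ^ card D) = real N * plaq_mean ^ card D * Z ^ card (faces_in \<Lambda>)"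
  proof -
    have "card (faces_in \<Lambda>) = card (faces_in \<Lambda> - D) + card D"
      using card_mono[OF fin es(3)] card_Diff_subset[OF disc_finite[OF es(1)] es(3)] by simp
    then show ?thesis by (simp add: power_add power_mult_distrib)
  qed
  finally show ?thesis using Z_pos N3 by simp
qed

definition plaq_expect :: "(real mat \<Rightarrow> real) \<Rightarrow> real" where
  "plaq_expect h = (\<integral>A. weight A * h A \<partial>\<mu>) / Z"

lemma gibbs_plaquette:
  assumes H: "H N = \<mu>" and E: "E = pos_edges_in \<Lambda>" and \<Lambda>: "finite \<Lambda>" "f \<in> faces_in \<Lambda>"
    and h: "bounded_meas (SO_borel N) h"
  shows "(\<integral>Q. h (holonomy N Q (face_walk f)) \<partial>gibbs H \<Lambda> N \<beta>) = plaq_expect h"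
proof -
  have fin: "finite (faces_in \<Lambda>)" by (rule finite_faces_in[OF \<Lambda>(1)])
  have sub: "region_edges (faces_in \<Lambda>) \<subseteq> E" unfolding E by (rule faces_in_edges)
  have fE: "face_edges f \<subseteq> E" using sub \<Lambda>(2) by blast
  have ne: "faces_in \<Lambda> \<noteq> {}" using \<Lambda> by auto
  have "card (faces_in \<Lambda>) = Suc (card (faces_in \<Lambda>) - 1)" using fin ne by (simp add: card_gt_0_iff)
  then have "Z ^ card (faces_in \<Lambda>) = Z * Z ^ (card (faces_in \<Lambda>) - 1)" by (metis power_Suc)
  then show ?thesis
    unfolding integral_gibbs[where H = H and \<Lambda> = \<Lambda>, OF H E \<Lambda>(1) ne bounded_holonomy[OF h covered_face_walk[OF fE]]]
      integral_face_weights[OF fin sub \<Lambda>(2) h] plaq_expect_def using Z_pos by simp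
qed

lemma plaq_expect_bound:
  assumes h: "bounded_meas (SO_borel N) h" and "\<And>A. A \<in> carrier (SO N) \<Longrightarrow> \<bar>h A\<bar> \<le> C"
  shows "\<bar>plaq_expect h\<bar> \<le> C"
proof -
  have w: "weight A > 0" for A by (simp add: weight_def)
  have "\<bar>\<integral>A. weight A * h A \<partial>\<mu>\<bar> \<le> (\<integral>A. \<bar>weight A * h A\<bar> \<partial>\<mu>)" by (rule integral_abs_bound)
  also have "\<dots> \<le> (\<integral>A. weight A * C \<partial>\<mu>)"
    using assms(2) w by (intro integral_mono haar_integrable integrable_abs bounded_meas_mult bounded_weight h bounded_meas_const)
      (auto simp: abs_mult less_imp_le intro!: mult_left_mono)
  also have "\<dots> = Z * C" by (simp add: Z_def)
  finally show ?thesis using Z_pos by (simp add: plaq_expect_def field_simps)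
qed

lemma plaq_expect_linear:
  assumes "bounded_meas (SO_borel N) h" "bounded_meas (SO_borel N) h'"
  shows "plaq_expect (\<lambda>A. h A - h' A) = plaq_expect h - plaq_expect h'"
  using haar_integrable[OF bounded_meas_mult[OF bounded_weight assms(1)]]
    haar_integrable[OF bounded_meas_mult[OF bounded_weight assms(2)]]
  by (simp add: plaq_expect_def right_diff_distrib diff_divide_distrib)

lemma holonomy_power:
  assumes Q: "Q \<in> space PE" and p: "covered p"
  shows "holonomy N Q (concat (replicate n p)) = holonomy N Q p ^\<^sub>m n"
proof (induction n)
  case 0
  then show ?case using SO_carrier_mat[OF holonomy_carrier[OF Q p]] by simp
next
  case (Suc n)
  have c: "covered (concat (replicate n p))" using p by (induction n) simp_all
  have "concat (replicate (Suc n) p) = concat (replicate n p) @ p"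
    by (induction n) simp_all
  then show ?case using holonomy_append[OF Q c p] Suc by simp
qed

definition pow_corr :: "nat \<Rightarrow> nat \<Rightarrow> real" where
  "pow_corr m n = plaq_expect (\<lambda>A. mat_trace (A ^\<^sub>m m) * mat_trace (A ^\<^sub>m n))"

definition pow_mean :: "nat \<Rightarrow> real" where
  "pow_mean n = plaq_expect (\<lambda>A. mat_trace (A ^\<^sub>m n))"

lemma gibbs_cong_space:
  assumes "H N = \<mu>" "E = pos_edges_in \<Lambda>" "\<And>Q. Q \<in> space PE \<Longrightarrow> X Q = Y Q"
  shows "(\<integral>Q. X Q \<partial>gibbs H \<Lambda> N \<beta>) = (\<integral>Q. Y Q \<partial>gibbs H \<Lambda> N \<beta>)"
  by (rule Bochner_Integration.integral_cong[OF refl])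
     (use assms in \<open>simp add: gibbs_def product_haar_def\<close>)

lemma wilson_expect_power:
  assumes H: "H N = \<mu>" and E: "E = pos_edges_in \<Lambda>" and \<Lambda>: "finite \<Lambda>" "f \<in> faces_in \<Lambda>"
  shows "wilson_expect H \<Lambda> N \<beta> (concat (replicate n (face_walk f))) = pow_mean n"
    "(\<integral>Q. prod_list (map (wilson N Q) [concat (replicate m (face_walk f)), concat (replicate n (face_walk f))]) \<partial>gibbs H \<Lambda> N \<beta>) =
      pow_corr m n"
proof -
  have cov: "covered (face_walk f)" using faces_in_edges[of \<Lambda>] \<Lambda>(2) by (intro covered_face_walk) (auto simp: E)
  have w: "wilson N Q (concat (replicate n (face_walk f))) = mat_trace (holonomy N Q (face_walk f) ^\<^sub>m n)"
    if "Q \<in> space PE" for Q n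
    unfolding wilson_def holonomy_power[OF that cov] ..
  show "wilson_expect H \<Lambda> N \<beta> (concat (replicate n (face_walk f))) = pow_mean n"
    unfolding wilson_expect_def pow_mean_def gibbs_plaquette[where H = H and \<Lambda> = \<Lambda>, OF H E \<Lambda> bounded_meas_pow_trace, symmetric]
    by (rule gibbs_cong_space[where H = H and \<Lambda> = \<Lambda>, OF H E w])
  show "(\<integral>Q. prod_list (map (wilson N Q) [concat (replicate m (face_walk f)), concat (replicate n (face_walk f))]) \<partial>gibbs H \<Lambda> N \<beta>) =
      pow_corr m n"
    unfolding pow_corr_def gibbs_plaquette[where H = H and \<Lambda> = \<Lambda>, OF H E \<Lambda> bounded_meas_mult[OF bounded_meas_pow_trace bounded_meas_pow_trace], symmetric]
    by (rule gibbs_cong_space[where H = H and \<Lambda> = \<Lambda>, OF H E]) (simp add: w)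
qed

lemma pow_mean_0: "pow_mean 0 = real N"
proof -
  have "(\<integral>A. weight A * mat_trace (A ^\<^sub>m 0) \<partial>\<mu>) = (\<integral>A. weight A * real N \<partial>\<mu>)"
    by (intro Bochner_Integration.integral_cong refl) (auto dest!: SO_carrier_mat)
  then show ?thesis using Z_pos by (simp add: pow_mean_def plaq_expect_def Z_def[symmetric] del: pow_mat.simps)
qed

lemma pow_corr_0: "pow_corr 0 n = real N * pow_mean n"
proof -
  have "(\<integral>A. weight A * (mat_trace (A ^\<^sub>m 0) * mat_trace (A ^\<^sub>m n)) \<partial>\<mu>) = (\<integral>A. real N * (weight A * mat_trace (A ^\<^sub>m n)) \<partial>\<mu>)"
    by (intro Bochner_Integration.integral_cong refl) (auto dest!: SO_carrier_mat)
  then show ?thesis by (simp add: pow_corr_def pow_mean_def plaq_expect_def del: pow_mat.simps)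
qed

lemma pow_mean_bound: "\<bar>pow_mean n\<bar> \<le> real N"
  unfolding pow_mean_def by (intro plaq_expect_bound bounded_meas_pow_trace SO_trace_bound pow_mat_SO)

lemma pow_mean_1: "pow_mean 1 = real N * plaq_mean"
proof -
  have "(\<integral>A. weight A * mat_trace (A ^\<^sub>m 1) \<partial>\<mu>) = (\<integral>A. weight A * mat_trace A \<partial>\<mu>)"
    by (intro Bochner_Integration.integral_cong refl) (auto dest!: SO_carrier_mat)
  then show ?thesis using N3 by (simp add: pow_mean_def plaq_expect_def plaq_mean_def del: pow_mat.simps)
qed

text \<open>The first sum in the Schwinger-Dyson equation is of lower order in \<open>N\<close>.\<close>

lemma loop_equation_bound:
  assumes n: "n \<ge> 1"
  shows "\<bar>real N * \<beta> * (pow_mean (n - 1) - pow_mean (n + 1)) - (\<Sum>m<n. pow_corr m (n - m))\<bar> \<le> real n * real N"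
proof -
  define S where "S m A = (\<Sum>i<N. \<Sum>j<N. (A ^\<^sub>m m) $$ (i, j) * (A ^\<^sub>m (n - m)) $$ (i, j))" for m and A :: "real mat"
  have bS: "bounded_meas (SO_borel N) (S m)" for m
    unfolding S_def[abs_def] by (intro bounded_meas_sum bounded_meas_mult bounded_meas_pow_entry) auto
  \<comment> \<open>Arithmetic-geometric mean together with the squared Frobenius norm N of an
    orthogonal matrix. Bounding entry by entry would give N^2, which does not disappear in the
    limit.\<close>
  have Sb: "\<bar>S m A\<bar> \<le> real N" if A: "A \<in> carrier (SO N)" for m A
  proof -
    have "\<bar>S m A\<bar> \<le> (\<Sum>i<N. \<Sum>j<N. \<bar>(A ^\<^sub>m m) $$ (i, j) * (A ^\<^sub>m (n - m)) $$ (i, j)\<bar>)"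
      unfolding S_def by (intro order_trans[OF sum_abs] sum_mono order_refl)
    also have "\<dots> \<le> (\<Sum>i<N. \<Sum>j<N. (((A ^\<^sub>m m) $$ (i, j))\<^sup>2 + ((A ^\<^sub>m (n - m)) $$ (i, j))\<^sup>2) / 2)"
    proof (intro sum_mono)
      show "\<bar>x * y\<bar> \<le> (x\<^sup>2 + y\<^sup>2) / 2" for x y :: real
        using sum_squares_bound[of "\<bar>x\<bar>" "\<bar>y\<bar>"] by (simp add: abs_mult)
    qed
    also have "\<dots> = ((\<Sum>i<N. \<Sum>j<N. ((A ^\<^sub>m m) $$ (i, j))\<^sup>2) + (\<Sum>i<N. \<Sum>j<N. ((A ^\<^sub>m (n - m)) $$ (i, j))\<^sup>2)) / 2"
      by (simp add: sum.distrib sum_divide_distrib[symmetric])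
    also have "\<dots> = real N" by (simp add: SO_row_norm[OF pow_mat_SO[OF A]])
    finally show ?thesis .
  qed
  have "(\<Sum>m<n. plaq_expect (S m) - pow_corr m (n - m)) + real N * \<beta> * (pow_mean (n - 1) - pow_mean (n + 1)) = 0"
  proof -
    have b: "bounded_meas (SO_borel N) (\<lambda>A. mat_trace (A ^\<^sub>m m) * mat_trace (A ^\<^sub>m (n - m)))" for m
      by (intro bounded_meas_mult bounded_meas_pow_trace)
    have "(\<Sum>m<n. plaq_expect (\<lambda>A. S m A - mat_trace (A ^\<^sub>m m) * mat_trace (A ^\<^sub>m (n - m)))) +
       real N * \<beta> * plaq_expect (\<lambda>A. mat_trace (A ^\<^sub>m (n - 1)) - mat_trace (A ^\<^sub>m (n + 1))) = 0 / Z"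
      unfolding plaq_expect_def sum_divide_distrib[symmetric] times_divide_eq_right add_divide_distrib[symmetric]
      using schwinger_dyson[OF n, of \<beta>] unfolding S_def weight_def by (simp only:)
    then show ?thesis
      unfolding plaq_expect_linear[OF bS b] plaq_expect_linear[OF bounded_meas_pow_trace bounded_meas_pow_trace]
        pow_corr_def pow_mean_def by simp
  qed
  then have "real N * \<beta> * (pow_mean (n - 1) - pow_mean (n + 1)) - (\<Sum>m<n. pow_corr m (n - m)) = - (\<Sum>m<n. plaq_expect (S m))"
    by (simp add: sum_subtractf)
  also have "\<bar>\<dots>\<bar> \<le> (\<Sum>m<n. real N)"
    unfolding abs_minus by (intro order_trans[OF sum_abs] sum_mono plaq_expect_bound bS Sb)
  finally show ?thesis by simp
qed

end

section \<open>Powers of a plaquette as loops, and exhausting boxes\<close>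

lemma nth_concat_replicate: "i < n * length p \<Longrightarrow> concat (replicate n p) ! i = p ! (i mod length p)"
proof (induction n arbitrary: i)
  case (Suc n)
  show ?case
  proof (cases "i < length p")
    case False
    then have "concat (replicate (Suc n) p) ! i = p ! ((i - length p) mod length p)"
      using Suc by (simp add: nth_append)
    then show ?thesis using False by (simp add: le_mod_geq)
  qed (simp add: nth_append)
qed simp

text \<open>Running several times around a plaquette is not simple, but it does not backtrack, so
  the hypotheses about general loops apply.\<close>

lemma is_loop_face_power:
  assumes "n \<ge> 1" shows "is_loop (concat (replicate n (face_walk (a, b))))"
proof -
  let ?p = "face_walk (a, b)" and ?c = "concat (replicate n (face_walk (a, b)))"
  have lp: "length ?p = 4" by (simp add: face_walk_def)
  have len: "length ?c = n * 4" using lp by (simp add: length_concat sum_list_replicate)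
  have *: "snd (?p ! j) = fst (?p ! (Suc j mod 4)) \<and> ?p ! (Suc j mod 4) \<noteq> rev_edge (?p ! j)" if "j < 4" for j
  proof -
    from that consider "j = 0" | "j = 1" | "j = 2" | "j = 3" by linarith
    then show ?thesis by cases (simp_all add: face_walk_def)
  qed
  have nth: "?c ! i = ?p ! (i mod 4)" "?c ! (Suc i mod length ?c) = ?p ! (Suc (i mod 4) mod 4)" if i: "i < length ?c" for i
  proof -
    show "?c ! i = ?p ! (i mod 4)" using nth_concat_replicate[of i n ?p] i len lp by simp
    have "Suc i mod length ?c < n * 4" using len assms by simp
    then have "?c ! (Suc i mod length ?c) = ?p ! ((Suc i mod length ?c) mod 4)"
      using nth_concat_replicate[of _ n ?p] lp by simp
    also have "(Suc i mod length ?c) mod 4 = Suc (i mod 4) mod 4"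
      unfolding len by (simp add: mod_mod_cancel mod_Suc_eq)
    finally show "?c ! (Suc i mod length ?c) = ?p ! (Suc (i mod 4) mod 4)" .
  qed
  have "set ?c \<subseteq> set (face_walk (a, b))" by auto
  then have "set ?c \<subseteq> edges" using face_walk_edges by (rule subset_trans)
  moreover have "?c \<noteq> []" using len assms by auto
  ultimately show ?thesis unfolding is_loop_def closed_walk_def using nth * by simp
qed

definition lattice_box :: "nat \<Rightarrow> vertex set" where
  "lattice_box M = {- int M..int M} \<times> {- int M..int M}"

lemma finite_lattice_box: "finite (lattice_box M)"
  by (simp add: lattice_box_def)

lemma exhaustion_box: "exhaustion lattice_box"
proof -
  have "x \<in> (\<Union>N\<in>{1..}. lattice_box N)" for x
  proof (rule UN_I)
    show "Suc (nat \<bar>fst x\<bar> + nat \<bar>snd x\<bar>) \<in> {1..}" by simp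
    show "x \<in> lattice_box (Suc (nat \<bar>fst x\<bar> + nat \<bar>snd x\<bar>))" by (cases x) (auto simp: lattice_box_def)
  qed
  moreover have "lattice_box N \<subseteq> lattice_box (Suc N)" for N by (auto simp: lattice_box_def)
  ultimately show ?thesis unfolding exhaustion_def using finite_lattice_box by blast
qed

lemma faces_in_box_eventually:
  assumes "finite D" shows "\<forall>\<^sub>F M in sequentially. D \<subseteq> faces_in (lattice_box M)"
proof -
  have "\<forall>\<^sub>F M in sequentially. f \<in> faces_in (lattice_box M)" for f
  proof -
    have "f \<in> faces_in (lattice_box M)" if "M \<ge> nat \<bar>fst f\<bar> + nat \<bar>snd f\<bar> + 1" for M
      using that by (cases f) (auto simp: faces_in_def unit_square_vertices_def lattice_box_def)
    then show ?thesis unfolding eventually_sequentially by blast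
  qed
  then have "\<forall>\<^sub>F M in sequentially. \<forall>f\<in>D. f \<in> faces_in (lattice_box M)"
    using assms by (intro eventually_ball_finite) auto
  then show ?thesis by (rule eventually_mono) blast
qed

section \<open>The limit of large matrices\<close>

text \<open>The point 0 is left out so that the shifted series, obtained by dividing by x, satisfies
  the same assumption and the induction can go on.\<close>

lemma powser_zero_coeff:
  fixes a :: "nat \<Rightarrow> real"
  assumes "s > 0" "\<And>x. x \<noteq> 0 \<Longrightarrow> \<bar>x\<bar> < s \<Longrightarrow> (\<lambda>n. a n * x ^ n) sums 0"
  shows "a k = 0"
  using assms(2)
proof (induction k arbitrary: a)
  case 0
  have "((\<lambda>x. 0) \<longlongrightarrow> a 0) (at (0::real))"
    by (rule powser_limit_0_strong[OF assms(1), of a "\<lambda>_. 0"]) (use 0 in auto)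
  then show ?case by (simp add: tendsto_const_iff)
next
  case (Suc k)
  have "((\<lambda>x. 0) \<longlongrightarrow> a 0) (at (0::real))"
    by (rule powser_limit_0_strong[OF assms(1), of a "\<lambda>_. 0"]) (use Suc.prems in auto)
  then have a0: "a 0 = 0" by (simp add: tendsto_const_iff)
  show ?case
  proof (rule Suc.IH[of "\<lambda>n. a (Suc n)"])
    fix x :: real assume x: "x \<noteq> 0" "\<bar>x\<bar> < s"
    have "(\<lambda>n. a (Suc n) * x ^ Suc n) sums 0"
      using Suc.prems[OF x] a0 by (subst sums_Suc_iff) simp
    from sums_divide[OF this, of x] show "(\<lambda>n. a (Suc n) * x ^ n) sums 0" using x by (simp add: field_simps)
  qed
qed

context
  fixes H :: "nat \<Rightarrow> real mat measure" and \<beta>\<^sub>0 :: real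
  assumes haar: "\<And>N. N \<ge> 1 \<Longrightarrow> is_haar_SO N (H N)" and coupling: "strong_coupling_constant H \<beta>\<^sub>0"
begin

lemma lattice_wilson_box: "N \<ge> 3 \<Longrightarrow> lattice_wilson N (H N) (pos_edges_in (lattice_box N))"
  using haar[of N] finite_pos_edges_in[OF finite_lattice_box[of N]]
  by unfold_locales (auto simp: pos_edges_in_def)

abbreviation plaq_power :: "nat \<Rightarrow> edge list" where
  "plaq_power n \<equiv> concat (replicate n (face_walk (0, 0)))"

abbreviation "W N \<equiv> lattice_wilson.pow_mean N (H N)"
abbreviation "C N \<equiv> lattice_wilson.pow_corr N (H N)"

lemma box_power:
  assumes "N \<ge> 3"
  shows "wilson_expect H (lattice_box N) N \<beta> (plaq_power n) = W N \<beta> n"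
    "(\<integral>Q. prod_list (map (wilson N Q) [plaq_power m, plaq_power n]) \<partial>gibbs H (lattice_box N) N \<beta>) = C N \<beta> m n"
proof -
  interpret lattice_wilson N "H N" "pos_edges_in (lattice_box N)" \<beta> by (rule lattice_wilson_box[OF assms])
  have "(0, 0) \<in> faces_in (lattice_box N)"
    using assms by (auto simp: faces_in_def unit_square_vertices_def lattice_box_def)
  then show "wilson_expect H (lattice_box N) N \<beta> (plaq_power n) = W N \<beta> n"
    "(\<integral>Q. prod_list (map (wilson N Q) [plaq_power m, plaq_power n]) \<partial>gibbs H (lattice_box N) N \<beta>) = C N \<beta> m n"
    by (intro wilson_expect_power refl; simp add: lattice_box_def)+
qed

lemma power_limits:
  assumes \<beta>: "\<bar>\<beta>\<bar> < \<beta>\<^sub>0" and n: "n \<ge> 1"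
  shows "(\<lambda>N. W N \<beta> n / real N) \<longlonglongrightarrow> wilson_limit H (plaq_power n) \<beta>"
    and "m \<ge> 1 \<Longrightarrow> (\<lambda>N. C N \<beta> m n / (real N)\<^sup>2) \<longlonglongrightarrow> wilson_limit H (plaq_power m) \<beta> * wilson_limit H (plaq_power n) \<beta>"
proof -
  have "(\<lambda>N. wilson_expect H (lattice_box N) N \<beta> (plaq_power n) / real N) \<longlonglongrightarrow> wilson_limit H (plaq_power n) \<beta>"
    using coupling \<beta> is_loop_face_power[OF n] exhaustion_box unfolding strong_coupling_constant_def by blast
  moreover have "\<forall>\<^sub>F N in sequentially. wilson_expect H (lattice_box N) N \<beta> (plaq_power n) / real N = W N \<beta> n / real N"
    using box_power(1) by (intro eventually_sequentiallyI[of 3]) simp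
  ultimately show "(\<lambda>N. W N \<beta> n / real N) \<longlonglongrightarrow> wilson_limit H (plaq_power n) \<beta>"
    by (rule Lim_transform_eventually)
  assume m: "m \<ge> 1"
  let ?ls = "[plaq_power m, plaq_power n]"
  have "\<forall>es\<in>set ?ls. is_loop es" using is_loop_face_power[OF n] is_loop_face_power[OF m] by simp
  then have "(\<lambda>N. (\<integral>Q. prod_list (map (wilson N Q) ?ls) \<partial>gibbs H (lattice_box N) N \<beta>) / real N ^ length ?ls)
      \<longlonglongrightarrow> prod_list (map (\<lambda>es. wilson_limit H es \<beta>) ?ls)"
    using coupling \<beta> exhaustion_box unfolding strong_coupling_constant_def by blast
  moreover have "\<forall>\<^sub>F N in sequentially. (\<integral>Q. prod_list (map (wilson N Q) ?ls) \<partial>gibbs H (lattice_box N) N \<beta>) / real N ^ length ?ls =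
      C N \<beta> m n / (real N)\<^sup>2"
    by (intro eventually_sequentiallyI[of 3]) (simp only: box_power(2), simp add: power2_eq_square)
  ultimately have "(\<lambda>N. C N \<beta> m n / (real N)\<^sup>2) \<longlonglongrightarrow> prod_list (map (\<lambda>es. wilson_limit H es \<beta>) ?ls)"
    by (rule Lim_transform_eventually)
  then show "(\<lambda>N. C N \<beta> m n / (real N)\<^sup>2) \<longlonglongrightarrow> wilson_limit H (plaq_power m) \<beta> * wilson_limit H (plaq_power n) \<beta>"
    by simp
qed

text \<open>Divided by N^2, the finite loop equations hold up to an error n / N. In the limit,
  factorization turns the correlations into products, and uniqueness applies.\<close>

lemma plaquette_limit_small:
  assumes \<beta>: "\<bar>\<beta>\<bar> < \<beta>\<^sub>0" "\<bar>\<beta>\<bar> \<le> 1/10"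
  shows "wilson_limit H (plaq_power 1) \<beta> = \<beta>"
proof -
  \<comment> \<open>The empty walk is not a loop, so the value at 0 is set by hand; it is the
    normalized trace of the identity.\<close>
  define w where "w n = (if n = 0 then 1 else wilson_limit H (plaq_power n) \<beta>)" for n
  have ev: "\<forall>\<^sub>F N in sequentially. N \<ge> (3::nat)" by (rule eventually_ge_at_top)
  have lw: "(\<lambda>N. W N \<beta> n / real N) \<longlonglongrightarrow> w n" for n
  proof (cases "n = 0")
    case True
    have "\<forall>\<^sub>F N in sequentially. 1 = W N \<beta> n / real N"
      using ev
    proof eventually_elim
      case (elim N)
      interpret lattice_wilson N "H N" "pos_edges_in (lattice_box N)" \<beta> by (rule lattice_wilson_box[OF elim])
      show ?case using pow_mean_0 True elim by simp
    qed
    from Lim_transform_eventually[OF tendsto_const this] show ?thesis by (simp add: w_def True)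
  qed (use power_limits(1)[OF \<beta>(1)] in \<open>simp add: w_def\<close>)
  have lc: "(\<lambda>N. C N \<beta> m n / (real N)\<^sup>2) \<longlonglongrightarrow> w m * w n" if n: "n \<ge> 1" for m n
  proof (cases "m = 0")
    case True
    have "\<forall>\<^sub>F N in sequentially. W N \<beta> n / real N = C N \<beta> m n / (real N)\<^sup>2"
      using ev
    proof eventually_elim
      case (elim N)
      interpret lattice_wilson N "H N" "pos_edges_in (lattice_box N)" \<beta> by (rule lattice_wilson_box[OF elim])
      show ?case using pow_corr_0 True elim by (simp add: power2_eq_square)
    qed
    from Lim_transform_eventually[OF lw this] show ?thesis by (simp add: w_def True)
  qed (use power_limits(2)[OF \<beta>(1) n] n in \<open>simp add: w_def\<close>)
  have "w 1 = \<beta>"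
  proof (rule loop_equations_unique)
    show "w 0 = 1" by (simp add: w_def)
    show "\<bar>w n\<bar> \<le> 1" for n
    proof (rule LIMSEQ_le_const2[OF tendsto_rabs[OF lw[of n]]])
      have "\<bar>W N \<beta> n / real N\<bar> \<le> 1" if N: "N \<ge> 3" for N
      proof -
        interpret lattice_wilson N "H N" "pos_edges_in (lattice_box N)" \<beta> by (rule lattice_wilson_box[OF N])
        show ?thesis using pow_mean_bound[of n] N by simp
      qed
      then show "\<exists>N0. \<forall>N\<ge>N0. \<bar>W N \<beta> n / real N\<bar> \<le> 1" by blast
    qed
    show "\<bar>\<beta>\<bar> \<le> 1/10" by (rule \<beta>)
    fix n :: nat assume n: "n \<ge> 1"
    let ?d = "\<lambda>N. \<beta> * (W N \<beta> (n - 1) / real N - W N \<beta> (n + 1) / real N) - (\<Sum>m<n. C N \<beta> m (n - m) / (real N)\<^sup>2)"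
    have "?d \<longlonglongrightarrow> \<beta> * (w (n - 1) - w (n + 1)) - (\<Sum>m<n. w m * w (n - m))"
      by (intro tendsto_intros lw lc) auto
    moreover have "?d \<longlonglongrightarrow> 0"
    proof (rule Lim_null_comparison)
      show "(\<lambda>N. real n * inverse (real N)) \<longlonglongrightarrow> 0"
        using tendsto_mult_right_zero[OF lim_inverse_n'] by (simp add: inverse_eq_divide)
      show "\<forall>\<^sub>F N in sequentially. norm (?d N) \<le> real n * inverse (real N)"
        using ev
      proof eventually_elim
        case (elim N)
        interpret lattice_wilson N "H N" "pos_edges_in (lattice_box N)" \<beta> by (rule lattice_wilson_box[OF elim])
        have N: "real N > 0" using elim by simp
        have "?d N = (real N * \<beta> * (pow_mean (n - 1) - pow_mean (n + 1)) - (\<Sum>m<n. pow_corr m (n - m))) / (real N)\<^sup>2"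
          using N by (simp add: diff_divide_distrib sum_divide_distrib power2_eq_square right_diff_distrib)
        also have "\<bar>\<dots>\<bar> \<le> (real n * real N) / (real N)\<^sup>2"
          unfolding abs_divide using loop_equation_bound[OF n] by (simp add: divide_right_mono)
        also have "\<dots> = real n * inverse (real N)" using N by (simp add: power2_eq_square field_simps)
        finally show ?case by simp
      qed
    qed
    ultimately have "\<beta> * (w (n - 1) - w (n + 1)) - (\<Sum>m<n. w m * w (n - m)) = 0"
      by (rule LIMSEQ_unique)
    then show "(\<Sum>m<n. w m * w (n - m)) = \<beta> * (w (n - 1) - w (n + 1))" by simp
  qed
  then show ?thesis by (simp add: w_def)
qed

lemma plaquette_limit:
  assumes \<beta>: "\<bar>\<beta>\<bar> < \<beta>\<^sub>0"
  shows "wilson_limit H (plaq_power 1) \<beta> = \<beta>"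
proof -
  have pos: "\<beta>\<^sub>0 > 0" using coupling by (simp add: strong_coupling_constant_def)
  from coupling obtain c where c: "\<forall>\<beta> es. \<bar>\<beta>\<bar> < \<beta>\<^sub>0 \<longrightarrow> is_loop es \<longrightarrow>
        summable (\<lambda>k. \<bar>c es k * \<beta> ^ k\<bar>) \<and> wilson_limit H es \<beta> = (\<Sum>k. c es k * \<beta> ^ k)"
    unfolding strong_coupling_constant_def by (elim conjE exE)
  define a where "a = c (plaq_power 1)"
  have a: "summable (\<lambda>k. \<bar>a k * x ^ k\<bar>)" "wilson_limit H (plaq_power 1) x = (\<Sum>k. a k * x ^ k)" if "\<bar>x\<bar> < \<beta>\<^sub>0" for x
    using c[rule_format, OF that is_loop_face_power[OF le_refl]] unfolding a_def by (rule conjunct1, rule conjunct2)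
  have sums: "(\<lambda>k. a k * x ^ k) sums wilson_limit H (plaq_power 1) x" if "\<bar>x\<bar> < \<beta>\<^sub>0" for x
    using summable_sums[OF summable_rabs_cancel[OF a(1)[OF that]]] a(2)[OF that] by simp
  have single: "(\<lambda>k. (if k = 1 then 1 else 0) * x ^ k) sums x" for x :: real
  proof -
    have "(\<lambda>k. (if k = 1 then 1 else 0) * x ^ k) = (\<lambda>k. if k = 1 then x ^ k else 0)" by auto
    then show ?thesis using sums_single[of 1 "\<lambda>k. x ^ k"] by simp
  qed
  have "a k - (if k = 1 then 1 else 0) = 0" for k
  \<comment> \<open>The radius 1/10 is that of \<open>plaquette_limit_small\<close>.\<close>
  proof (rule powser_zero_coeff[of "min (1/10) \<beta>\<^sub>0" "\<lambda>k. a k - (if k = 1 then 1 else 0)"])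
    show "min (1/10) \<beta>\<^sub>0 > 0" using pos by simp
    fix x :: real assume "\<bar>x\<bar> < min (1/10) \<beta>\<^sub>0"
    then have x: "\<bar>x\<bar> < \<beta>\<^sub>0" "\<bar>x\<bar> \<le> 1/10" by auto
    from sums_diff[OF sums[OF x(1)] single[of x]] plaquette_limit_small[OF x]
    show "(\<lambda>k. (a k - (if k = 1 then 1 else 0)) * x ^ k) sums 0" by (simp add: left_diff_distrib)
  qed
  then have "a = (\<lambda>k. if k = 1 then 1 else 0)" by (auto simp: fun_eq_iff)
  then show ?thesis using sums_unique2[OF sums[OF \<beta>] ] single[of \<beta>] by simp
qed

text \<open>Here \<open>es'\<close> stands for the counterclockwise one of \<open>es\<close> and its
  reversal, whose Wilson variables agree. Boxes serve as the exhaustion because the limit is the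
  same along all of them.\<close>

lemma wilson_limit_disc:
  assumes \<beta>: "\<bar>\<beta>\<bar> < \<beta>\<^sub>0" and es: "is_loop es" and D: "disc es' D" "D \<noteq> {}"
    and eq: "\<And>N Q. lattice_wilson N (H N) (pos_edges_in (lattice_box N)) \<Longrightarrow> D \<subseteq> faces_in (lattice_box N) \<Longrightarrow>
      Q \<in> space (PiM (pos_edges_in (lattice_box N)) (\<lambda>_. H N)) \<Longrightarrow> wilson N Q es = wilson N Q es'"
  shows "wilson_limit H es \<beta> = \<beta> ^ card D"
proof -
  have "(\<lambda>N. (W N \<beta> 1 / real N) ^ card D) \<longlonglongrightarrow> \<beta> ^ card D"
    using power_limits(1)[OF \<beta>, of 1] plaquette_limit[OF \<beta>] by (intro tendsto_power) simp
  moreover have "\<forall>\<^sub>F N in sequentially. (W N \<beta> 1 / real N) ^ card D = wilson_expect H (lattice_box N) N \<beta> es / real N"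
    using eventually_ge_at_top[of 3] faces_in_box_eventually[OF disc_finite[OF D(1)]]
  proof eventually_elim
    case (elim N)
    interpret lattice_wilson N "H N" "pos_edges_in (lattice_box N)" \<beta> by (rule lattice_wilson_box[OF elim(1)])
    have "wilson_expect H (lattice_box N) N \<beta> es = wilson_expect H (lattice_box N) N \<beta> es'"
      unfolding wilson_expect_def
      by (rule gibbs_cong_space[where H = H, OF refl refl]) (rule eq[OF lattice_wilson_axioms elim(2)])
    also have "\<dots> / real N = plaq_mean ^ card D"
      by (rule wilson_expect_disc[where H = H, OF refl refl _ D elim(2)]) (simp add: lattice_box_def)
    also have "plaq_mean = W N \<beta> 1 / real N" using pow_mean_1 elim(1) by simp
    finally show ?case by simp
  qed
  ultimately have "(\<lambda>N. wilson_expect H (lattice_box N) N \<beta> es / real N) \<longlonglongrightarrow> \<beta> ^ card D"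
    by (rule Lim_transform_eventually)
  moreover have "(\<lambda>N. wilson_expect H (lattice_box N) N \<beta> es / real N) \<longlonglongrightarrow> wilson_limit H es \<beta>"
    using coupling \<beta> es exhaustion_box unfolding strong_coupling_constant_def by blast
  ultimately show ?thesis using LIMSEQ_unique by blast
qed

end

section \<open>Reversing a circuit\<close>

lemma crossing_rev: "crossing f (rev_edge e) = - crossing f e"
  by (auto simp: crossing_def rev_edge_def)

lemma wind_rev_walk: "wind (rev_walk es) f = - wind es f"
  by (induction es) (simp_all add: rev_walk_def crossing_rev)

lemma edge_path_rev_walk: "edge_path x es y \<Longrightarrow> edge_path y (rev_walk es) x"
  by (induction es arbitrary: x) (auto simp: rev_walk_def edge_path_append)

lemma circuit_rev_walk:
  assumes "circuit es" shows "circuit (rev_walk es)"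
proof -
  have "edge_path (fst (hd es)) (rev_walk es) (fst (hd es))"
    using assms by (intro edge_path_rev_walk) (simp add: circuit_def)
  moreover have ne: "rev_walk es \<noteq> []" using assms by (simp add: circuit_def rev_walk_def)
  ultimately have "fst (hd (rev_walk es)) = fst (hd es)" by (cases "rev_walk es") auto
  moreover have "map fst (rev_walk es) = rev (map snd es)"
    by (simp add: rev_walk_def rev_map o_def)
  ultimately show ?thesis
    using \<open>edge_path _ (rev_walk es) _\<close> ne circuit_distinct_snd(1)[OF assms] by (simp add: circuit_def)
qed

theorem theorem2p8:
  fixes H :: "nat \<Rightarrow> real mat measure" and \<beta>\<^sub>0 \<beta> :: real
    and \<Lambda> :: "nat \<Rightarrow> (int \<times> int) set" and es :: "((int \<times> int) \<times> (int \<times> int)) list" and k :: nat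
  assumes haar: "\<And>N. N \<ge> 1 \<Longrightarrow> is_haar_SO N (H N)"
    and coupling: "strong_coupling_constant H \<beta>\<^sub>0"
    and beta: "\<bar>\<beta>\<bar> < \<beta>\<^sub>0"
    and exh: "exhaustion \<Lambda>"
    and simple: "simple_loop es"
    and area: "loop_area es = k"
  shows "((\<lambda>N. wilson_expect H (\<Lambda> N) N \<beta> es / real N) \<longlonglongrightarrow> wilson_limit H es \<beta>) \<and>
         wilson_limit H es \<beta> = \<beta> ^ k"
proof
  have loop: "is_loop es" using simple by (simp add: simple_loop_def)
  then show "(\<lambda>N. wilson_expect H (\<Lambda> N) N \<beta> es / real N) \<longlonglongrightarrow> wilson_limit H es \<beta>"
    using coupling beta exh unfolding strong_coupling_constant_def by blast
  note c = simple_loop_circuit[OF simple]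
  define D where "D = {f. wind es f \<noteq> 0}"
  have k: "k = card D" using loop_area_wind[OF c] area by (simp add: D_def)
  have "es \<noteq> []" using c(1) by (simp add: circuit_def)
  then have hd: "hd es \<in> set es" by simp
  obtain L where L: "L \<in> {0, 1}" "\<And>f. wind es f \<in> {L, L - 1}"
    "\<And>e. e \<in> set es \<Longrightarrow> wind es (left_face e) = L \<and> wind es (right_face e) = L - 1"
    using discrete_Jordan[OF c] by metis
  have "wind es (left_face (hd es)) \<noteq> 0 \<or> wind es (right_face (hd es)) \<noteq> 0" using L(1) L(3)[OF hd] by auto
  then have ne: "D \<noteq> {}" unfolding D_def by blast
  show "wilson_limit H es \<beta> = \<beta> ^ k"
  \<comment> \<open>\<open>L\<close> tells the orientation. If it is 0 the loop runs clockwise with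
    winding numbers 0 and -1, and its reversal is a disc with the same faces.\<close>
  proof (cases "L = 1")
    case True
    have d: "disc es D"
      by (rule discI[OF c(1)]) (use L(2) True in \<open>auto simp: D_def\<close>)
    show ?thesis unfolding k
      by (rule wilson_limit_disc[OF haar coupling beta loop d ne]) (assumption | rule refl)+
  next
    case False
    then have L0: "L = 0" using L(1) by simp
    have "wind (rev_walk es) f = of_bool (f \<in> D)" for f
      using L(2)[of f] L0 by (auto simp: wind_rev_walk D_def)
    then have d: "disc (rev_walk es) D" by (rule discI[OF circuit_rev_walk[OF c(1)]])
    show ?thesis unfolding k
    proof (rule wilson_limit_disc[OF haar coupling beta loop d ne])
      show "N \<ge> 1" if "N \<ge> 1" for N by (rule that)
    next
      fix N Q
      assume lw: "lattice_wilson N (H N) (pos_edges_in (lattice_box N))" and DN: "D \<subseteq> faces_in (lattice_box N)"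
        and Q: "Q \<in> space (PiM (pos_edges_in (lattice_box N)) (\<lambda>_. H N))"
      interpret lattice_wilson N "H N" "pos_edges_in (lattice_box N)" \<beta> by (rule lw)
      have "length (rev_walk es) \<noteq> 2" using c(2) by (simp add: rev_walk_def)
      from disc_edges[OF d this] have "pos_edge ` set (rev_walk es) \<subseteq> pos_edges_in (lattice_box N)"
        using faces_in_edges[of "lattice_box N"] DN by blast
      then have "covered (rev_walk es)"
        using circuit_edges[OF disc_circuit[OF d]] by (simp add: covered_def)
      then show "wilson N Q es = wilson N Q (rev_walk es)"
        using trace_rev_walk[OF Q, of es] by (simp add: wilson_def)
    qed
  qed
qed

end
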